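(* Suppose that $0=\phi<\mu^{C}$ and that $\tau$ (for the process started from $(0,0)$) is subexponential. Let $X^T$ denote the chain on $\hat S$ obtained by conditioning $\hat X$ on the event $(\tau>T)$, and define $h$ on $\hat S$ by $h_i=1$ for $i\in C$ and $h_{(0,u)}=\frac{1-e^{-q_0(1-u)}}{1-e^{-q_0}}$ for $u\in[0,1)$. Then, for each $s>0$, the restriction of the law of $X^T$ to $\mathcal F_s$ converges vaguely as $T\to\infty$ to that of $X^\infty$ restricted to $\mathcal F_s$, where the semigroup $P^\infty$ of $X^\infty$ is the (substochastic) $h$-transform of $\hat P$ (which dies from state $(0,u)$ with hazard rate $\lambda(u)=\frac{q_0e^{-q_0}}{1-e^{-q_0(1-u)}}$).
   Context: $X=(X_t)_{t\ge 0}$ is an irreducible, non-explosive, recurrent continuous-time Markov chain on $S=\mathbb Z^+=\{0,1,2,\dots\}$ or $S=\{0,\dots,K\}$, with distinguished state $0$; $C=S\setminus\{0\}$. Its $Q$-matrix is $(q_{i,j})$ and $q_i=-q_{i,i}$. $\tilde X$, the chain $X$ killed on first hitting $0$, is assumed irreducible on $C$. $\tau_0$ is the first hitting time of $0$ by $X$, and $$\mu^C=\inf\Big\{\lambda:\int_0^\infty\mathbb P_i(\tau_0>t)e^{\lambda t}dt=\infty\Big\},$$ which does not depend on $i\in C$. The current holding time $H_t$ is the time elapsed since the most recent entry of $X$ into $0$ if $X_t=0$, and $H_t=\emptyset$ if $X_t\ne0$. Let $\tau=\inf\{t: H_t\ge1\}$. Let $\hat S=C\cup(\{0\}\times[0,1))$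 ($C$ discrete, $[0,1)$ with its usual topology); $\hat X$ denotes the process $(X_t,H_t)$ killed at $\tau$, viewed as a process on $\hat S$: it is in state $i\in C$ when $X_t=i$ and in state $(0,u)$ when $X_t=0$, $H_t=u$. The processes start from a fixed state of $\hat S$; $\mathbb P_i$ is the law started from $i\in\hat S$ (starting from $(0,u)$ means that $X_0=0$ and the chain has already been at $0$ for time $u$) on Skorokhod path space, with corresponding filtration $(\mathcal F_t)_{t\ge0}$. $(\hat P(t))_{t\ge0}$ is the substochastic transition semigroup of $\hat X$. For a $\hat P$-superharmonic $h>0$ (i.e. $\hat P(t)h\le h$ for all $t$), the $h$-transform of $\hat P$ is the substochastic semigroup with kernel $\frac{h(y)}{h(x)}\hat P(x,dy;t)$; the associated substochastic path measure on paths alive at time $s$ has density $h(\hat X_s)/h(\hat X_0)$ on $\mathcal F_s$ with respect to the law of $\hat X$. $H^1$ denotes a full holding time of $X$ in $0$ and $R^1$ the subsequent return time (from that departure from $0$ until the next return to $0$); $W=H^1+R^1$, $I(\lambda)=\mathbb E[e^{\lambda W}1_{(H^1<1)}]$, and $\phi=\sup\{\lambda\ge0: I(\lambda)\le1\}$. A random variable $Z\ge 0$ with distribution function $F_Z$ is subexponential if $\overline{F_Z^{n}}(t)/\overline{F_Z}(t)\to n$ as $t\to\infty$ for all $n$, where $F_Z^{n}$ is the $n$-fold convolution of $F_Z$ and $\overline G=1-G$. Vague convergence on $\mathcal F_s$ (the limit may have total mass less than one): $\int f\,d\mathbb P^T\to\int f\,d\mathbb P^\infty$ for every bounded continuous function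 $f$ on the Skorokhod space of $\hat S$-valued paths on $[0,s]$ that vanishes on all paths which leave $K'\cup(\{0\}\times[0,1))$ during $[0,s]$, for some finite $K'\subset C$ depending on $f$. *)

theory Defs
  imports "HOL-Probability.Probability"
begin

section \<open>Skorokhod path space\<close>

definition cadlag :: "real set \<Rightarrow> 'a::topological_space set \<Rightarrow> (real \<Rightarrow> 'a) \<Rightarrow> bool" where
  "cadlag I E w \<longleftrightarrow> w ` I \<subseteq> E \<and>
     (\<forall>t\<in>I. (w \<longlongrightarrow> w t) (at t within I \<inter> {t<..})) \<and>
     (\<forall>t\<in>I. \<exists>l\<in>E. (w \<longlongrightarrow> l) (at t within I \<inter> {..<t}))"

definition skorokhod :: "real \<Rightarrow> 'a::topological_space set \<Rightarrow> (real \<Rightarrow> 'a) set" where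
  "skorokhod s E = {w \<in> extensional {0..s}. cadlag {0..s} E w}"

definition time_change :: "real \<Rightarrow> (real \<Rightarrow> real) set" where
  "time_change s = {l. strict_mono_on {0..s} l \<and> l ` {0..s} = {0..s}}"

text \<open>The \<open>J\<^sub>1\<close> metric. The topology it induces depends on the metric of the state space only through
  its topology, since a cadlag path on \<open>{0..s}\<close> has relatively compact range in \<open>E\<close>.\<close>

definition skorokhod_dist :: "real \<Rightarrow> (real \<Rightarrow> 'a::metric_space) \<Rightarrow> (real \<Rightarrow> 'a) \<Rightarrow> real" where
  "skorokhod_dist s v w = Inf {e. 0 < e \<and>
     (\<exists>l\<in>time_change s. \<forall>t\<in>{0..s}. \<bar>l t - t\<bar> \<le> e \<and> dist (v t) (w (l t)) \<le> e)}"

lemma cadlag_bounded: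
  fixes w :: "real \<Rightarrow> 'a::metric_space"
  assumes "cadlag {0..s} E w"
  shows "bounded (w ` {0..s})"
proof -
  define B where "B = {U. open U \<and> bounded (w ` (U \<inter> {0..s}))}"
  have near: "\<exists>U\<in>B. t \<in> U" if t: "t \<in> {0..s}" for t
  proof -
    obtain l where l: "(w \<longlongrightarrow> l) (at t within {0..s} \<inter> {..<t})"
      and r: "(w \<longlongrightarrow> w t) (at t within {0..s} \<inter> {t<..})"
      using assms t unfolding cadlag_def by blast
    have "\<forall>\<^sub>F x in at t within {0..s} \<inter> {..<t}. dist (w x) l < 1"
      using l by (rule tendstoD) simp
    then obtain U1 where U1: "open U1" "t \<in> U1"
      "\<forall>x\<in>U1. x \<noteq> t \<longrightarrow> x \<in> {0..s} \<inter> {..<t} \<longrightarrow> dist (w x) l < 1"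
      unfolding eventually_at_topological by blast
    have "\<forall>\<^sub>F x in at t within {0..s} \<inter> {t<..}. dist (w x) (w t) < 1"
      using r by (rule tendstoD) simp
    then obtain U2 where U2: "open U2" "t \<in> U2"
      "\<forall>x\<in>U2. x \<noteq> t \<longrightarrow> x \<in> {0..s} \<inter> {t<..} \<longrightarrow> dist (w x) (w t) < 1"
      unfolding eventually_at_topological by blast
    have "w ` ((U1 \<inter> U2) \<inter> {0..s}) \<subseteq> ball l 1 \<union> ball (w t) 1"
    proof (clarify)
      fix x assume x: "x \<in> U1" "x \<in> U2" "x \<in> {0..s}" "w x \<notin> ball (w t) 1"
      consider "x < t" | "x = t" | "t < x" by linarith
      then show "w x \<in> ball l 1"
        using x U1(3) U2(3) by cases (auto simp: dist_commute)
    qed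
    then have "bounded (w ` ((U1 \<inter> U2) \<inter> {0..s}))"
      by (rule bounded_subset[rotated]) auto
    then show ?thesis using U1 U2 unfolding B_def by (intro bexI[of _ "U1 \<inter> U2"]) auto
  qed
  have "compact {0..s}" by simp
  moreover have "\<And>U. U \<in> B \<Longrightarrow> open U" unfolding B_def by auto
  moreover have "{0..s} \<subseteq> \<Union>B" using near by blast
  ultimately obtain D where D: "D \<subseteq> B" "finite D" "{0..s} \<subseteq> \<Union>D"
    by (meson compactE)
  have "w ` {0..s} \<subseteq> (\<Union>U\<in>D. w ` (U \<inter> {0..s}))" using D(3) by blast
  moreover have "bounded (\<Union>U\<in>D. w ` (U \<inter> {0..s}))"
    using D(1,2) unfolding B_def by (intro bounded_UN) auto
  ultimately show ?thesis by (rule bounded_subset[rotated])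
qed

lemma time_change_id: "id \<in> time_change s"
  unfolding time_change_def by (auto simp: strict_mono_on_def)

lemma time_change_range: "l \<in> time_change s \<Longrightarrow> t \<in> {0..s} \<Longrightarrow> l t \<in> {0..s}"
  unfolding time_change_def by blast

lemma time_change_comp:
  assumes "l \<in> time_change s" "k \<in> time_change s"
  shows "k \<circ> l \<in> time_change s"
proof -
  have "strict_mono_on {0..s} (k \<circ> l)"
    using assms time_change_range[OF assms(1)] unfolding time_change_def
    by (auto simp: strict_mono_on_def)
  moreover have "(k \<circ> l) ` {0..s} = {0..s}"
    using assms unfolding time_change_def image_comp[symmetric] by simp
  ultimately show ?thesis unfolding time_change_def by blast
qed

lemma time_change_inv:
  assumes "l \<in> time_change s"
  shows "inv_into {0..s} l \<in> time_change s"
proof -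
  have m: "strict_mono_on {0..s} l" and im: "l ` {0..s} = {0..s}"
    using assms unfolding time_change_def by auto
  have inj: "inj_on l {0..s}" using m by (rule strict_mono_on_imp_inj_on)
  have "inv_into {0..s} l x < inv_into {0..s} l y"
    if xy: "x \<in> {0..s}" "y \<in> {0..s}" "x < y" for x y
  proof (rule ccontr)
    assume "\<not> ?thesis"
    then have "l (inv_into {0..s} l y) \<le> l (inv_into {0..s} l x)"
      using strict_mono_on_leD[OF m, of "inv_into {0..s} l y" "inv_into {0..s} l x"]
        inv_into_into[of x l "{0..s}"] inv_into_into[of y l "{0..s}"] xy im by simp
    then show False using xy im f_inv_into_f[of x l "{0..s}"] f_inv_into_f[of y l "{0..s}"] by simp
  qed
  then have "strict_mono_on {0..s} (inv_into {0..s} l)"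
    by (auto simp: strict_mono_on_def)
  moreover have "inv_into {0..s} l ` {0..s} = {0..s}"
    using bij_betw_imp_surj_on[OF bij_betw_inv_into[OF inj_on_imp_bij_betw[OF inj]]] im by simp
  ultimately show ?thesis unfolding time_change_def by blast
qed

lemma time_change_end:
  assumes "l \<in> time_change s" "0 \<le> s"
  shows "l s = s"
proof -
  have "s \<in> l ` {0..s}" using assms unfolding time_change_def by simp
  then obtain t where t: "t \<in> {0..s}" "l t = s" by blast
  have mono: "strict_mono_on {0..s} l" using assms(1) unfolding time_change_def by simp
  have "\<not> t < s"
  proof
    assume "t < s"
    then have "l t < l s" using strict_mono_onD[OF mono, of t s] t assms(2) by simp
    moreover have "l s \<le> s" using time_change_range[OF assms(1), of s] assms(2) by auto
    ultimately show False using t by simp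
  qed
  then have "t = s" using t by simp
  then show ?thesis using t by simp
qed

lemma skorokhod_dist_nonempty:
  fixes v w :: "real \<Rightarrow> 'a::metric_space"
  assumes "v \<in> skorokhod s E" "w \<in> skorokhod s E"
  shows "{e. 0 < e \<and>
     (\<exists>l\<in>time_change s. \<forall>t\<in>{0..s}. \<bar>l t - t\<bar> \<le> e \<and> dist (v t) (w (l t)) \<le> e)} \<noteq> {}"
proof -
  have "bounded (v ` {0..s} \<union> w ` {0..s})"
    using assms unfolding skorokhod_def by (auto intro: cadlag_bounded)
  then obtain e where e: "\<forall>x\<in>v ` {0..s} \<union> w ` {0..s}. \<forall>y\<in>v ` {0..s} \<union> w ` {0..s}. dist x y \<le> e"
    unfolding bounded_two_points by blast
  have "\<forall>t\<in>{0..s}. \<bar>id t - t\<bar> \<le> max 1 e \<and> dist (v t) (w (id t)) \<le> max 1 e"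
    using e by (auto simp: le_max_iff_disj)
  then have "max 1 e \<in> {e. 0 < e \<and>
     (\<exists>l\<in>time_change s. \<forall>t\<in>{0..s}. \<bar>l t - t\<bar> \<le> e \<and> dist (v t) (w (l t)) \<le> e)}"
    using time_change_id by fastforce
  then show ?thesis by blast
qed

lemma skorokhod_dist_le:
  assumes "0 < e" "l \<in> time_change s" "\<forall>t\<in>{0..s}. \<bar>l t - t\<bar> \<le> e \<and> dist (v t) (w (l t)) \<le> e"
  shows "skorokhod_dist s v w \<le> e"
  unfolding skorokhod_dist_def by (rule cInf_lower) (use assms in \<open>auto intro!: bdd_belowI[of _ 0]\<close>)

lemma skorokhod_dist_less:
  fixes v w :: "real \<Rightarrow> 'a::metric_space"
  assumes "v \<in> skorokhod s E" "w \<in> skorokhod s E" "skorokhod_dist s v w < e"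
  shows "\<exists>l\<in>time_change s. \<forall>t\<in>{0..s}. \<bar>l t - t\<bar> < e \<and> dist (v t) (w (l t)) < e"
proof -
  obtain d where "d < e" "\<exists>l\<in>time_change s. \<forall>t\<in>{0..s}. \<bar>l t - t\<bar> \<le> d \<and> dist (v t) (w (l t)) \<le> d"
    using cInf_lessD[OF skorokhod_dist_nonempty[OF assms(1,2)]] assms(3)
    unfolding skorokhod_dist_def by blast
  then show ?thesis by (meson le_less_trans)
qed

lemma skorokhod_dist_nonneg:
  fixes v w :: "real \<Rightarrow> 'a::metric_space"
  assumes "v \<in> skorokhod s E" "w \<in> skorokhod s E"
  shows "0 \<le> skorokhod_dist s v w"
  unfolding skorokhod_dist_def
  by (rule cInf_greatest[OF skorokhod_dist_nonempty[OF assms]]) auto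

lemma skorokhod_dist_sym_le:
  fixes v w :: "real \<Rightarrow> 'a::metric_space"
  assumes "v \<in> skorokhod s E" "w \<in> skorokhod s E"
  shows "skorokhod_dist s w v \<le> skorokhod_dist s v w"
proof (rule field_le_epsilon)
  fix e :: real assume e: "0 < e"
  let ?d = "skorokhod_dist s v w + e"
  obtain l where l: "l \<in> time_change s" "\<forall>t\<in>{0..s}. \<bar>l t - t\<bar> < ?d \<and> dist (v t) (w (l t)) < ?d"
    using skorokhod_dist_less[OF assms, of ?d] e by auto
  let ?k = "inv_into {0..s} l"
  have im: "l ` {0..s} = {0..s}" using l(1) unfolding time_change_def by auto
  show "skorokhod_dist s w v \<le> ?d"
  proof (rule skorokhod_dist_le[OF _ time_change_inv[OF l(1)]])
    show "0 < ?d" using skorokhod_dist_nonneg[OF assms] e by simp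
    show "\<forall>t\<in>{0..s}. \<bar>?k t - t\<bar> \<le> ?d \<and> dist (w t) (v (?k t)) \<le> ?d"
    proof
      fix t assume t: "t \<in> {0..s}"
      have "?k t \<in> {0..s}" "l (?k t) = t"
        using t im inv_into_into[of t l "{0..s}"] f_inv_into_f[of t l "{0..s}"] by auto
      then show "\<bar>?k t - t\<bar> \<le> ?d \<and> dist (w t) (v (?k t)) \<le> ?d"
        using l(2)[rule_format, of "?k t"] by (simp add: abs_minus_commute dist_commute)
    qed
  qed
qed

lemma skorokhod_dist_triangle:
  fixes u v w :: "real \<Rightarrow> 'a::metric_space"
  assumes "u \<in> skorokhod s E" "v \<in> skorokhod s E" "w \<in> skorokhod s E"
  shows "skorokhod_dist s u w \<le> skorokhod_dist s u v + skorokhod_dist s v w"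
proof (rule field_le_epsilon)
  fix e :: real assume e: "0 < e"
  let ?d = "skorokhod_dist s u v + e / 2" and ?d' = "skorokhod_dist s v w + e / 2"
  obtain l where l: "l \<in> time_change s" "\<forall>t\<in>{0..s}. \<bar>l t - t\<bar> < ?d \<and> dist (u t) (v (l t)) < ?d"
    using skorokhod_dist_less[OF assms(1,2), of ?d] e by auto
  obtain k where k: "k \<in> time_change s" "\<forall>t\<in>{0..s}. \<bar>k t - t\<bar> < ?d' \<and> dist (v t) (w (k t)) < ?d'"
    using skorokhod_dist_less[OF assms(2,3), of ?d'] e by auto
  have "skorokhod_dist s u w \<le> ?d + ?d'"
  proof (rule skorokhod_dist_le[OF _ time_change_comp[OF l(1) k(1)]])
    show "0 < ?d + ?d'"
      using skorokhod_dist_nonneg[OF assms(1,2)] skorokhod_dist_nonneg[OF assms(2,3)] e by simp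
    show "\<forall>t\<in>{0..s}. \<bar>(k \<circ> l) t - t\<bar> \<le> ?d + ?d' \<and> dist (u t) (w ((k \<circ> l) t)) \<le> ?d + ?d'"
    proof
      fix t assume t: "t \<in> {0..s}"
      have lt: "l t \<in> {0..s}" using time_change_range[OF l(1) t] .
      have "dist (u t) (w (k (l t))) \<le> dist (u t) (v (l t)) + dist (v (l t)) (w (k (l t)))"
        by (rule dist_triangle)
      moreover have "dist (u t) (v (l t)) < ?d" "\<bar>l t - t\<bar> < ?d" using l(2) t by auto
      moreover have "dist (v (l t)) (w (k (l t))) < ?d'" "\<bar>k (l t) - l t\<bar> < ?d'" using k(2) lt by auto
      ultimately show "\<bar>(k \<circ> l) t - t\<bar> \<le> ?d + ?d' \<and> dist (u t) (w ((k \<circ> l) t)) \<le> ?d + ?d'"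
        by (auto simp: abs_if split: if_splits)
    qed
  qed
  then show "skorokhod_dist s u w \<le> skorokhod_dist s u v + skorokhod_dist s v w + e" by simp
qed

lemma skorokhod_dist_zero:
  fixes v w :: "real \<Rightarrow> 'a::metric_space"
  assumes v: "v \<in> skorokhod s E" and w: "w \<in> skorokhod s E" and 0: "skorokhod_dist s v w = 0"
  shows "v = w"
proof (rule extensionalityI)
  show "v \<in> extensional {0..s}" "w \<in> extensional {0..s}" using v w unfolding skorokhod_def by auto
  fix t assume t: "t \<in> {0..s}"
  have near: "\<exists>l\<in>time_change s. \<forall>t\<in>{0..s}. \<bar>l t - t\<bar> < e \<and> dist (v t) (w (l t)) < e" if "0 < e" for e
    using skorokhod_dist_less[OF v w, of e] that 0 by auto
  have "dist (v t) (w t) < e" if e: "0 < e" for e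
  proof (cases "t = s")
    case True
    obtain l where "l \<in> time_change s" "\<forall>t\<in>{0..s}. \<bar>l t - t\<bar> < e \<and> dist (v t) (w (l t)) < e"
      using near[OF e] by blast
    moreover from this(1) have "l t = t" using t True by (simp add: time_change_end)
    ultimately show ?thesis using t by (metis (no_types))
  next
    case False
    then have ts: "t < s" using t by auto
    have "(v \<longlongrightarrow> v t) (at t within {0..s} \<inter> {t<..})"
      using v t unfolding skorokhod_def cadlag_def by auto
    then have "\<forall>\<^sub>F x in at t within {0..s} \<inter> {t<..}. dist (v x) (v t) < e / 3"
      by (rule tendstoD) (use e in simp)
    moreover have "(w \<longlongrightarrow> w t) (at t within {0..s} \<inter> {t<..})"
      using w t unfolding skorokhod_def cadlag_def by auto
    then have "\<forall>\<^sub>F x in at t within {0..s} \<inter> {t<..}. dist (w x) (w t) < e / 3"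
      by (rule tendstoD) (use e in simp)
    ultimately have "\<forall>\<^sub>F x in at t within {0..s} \<inter> {t<..}. dist (v x) (v t) < e / 3 \<and> dist (w x) (w t) < e / 3"
      by (rule eventually_conj)
    then obtain d where d: "0 < d" "\<forall>x\<in>{0..s} \<inter> {t<..}. x \<noteq> t \<and> dist x t < d \<longrightarrow>
        dist (v x) (v t) < e / 3 \<and> dist (w x) (w t) < e / 3"
      unfolding eventually_at by blast
    define c where "c = min d (s - t) / 2"
    have c: "0 < c" "2 * c \<le> d" "t + 2 * c \<le> s" using d(1) ts unfolding c_def by (simp_all add: min_def)
    obtain l where l: "l \<in> time_change s"
      "\<forall>t\<in>{0..s}. \<bar>l t - t\<bar> < min c (e / 3) \<and> dist (v t) (w (l t)) < min c (e / 3)"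
      using near[of "min c (e / 3)"] c(1) e by auto
    have tc: "t + c \<in> {0..s}" using t c by auto
    then have a: "\<bar>l (t + c) - (t + c)\<bar> < c" "dist (v (t + c)) (w (l (t + c))) < e / 3"
      using l(2)[rule_format, OF tc] by simp_all
    have "t + c \<in> {0..s} \<inter> {t<..}" "t + c \<noteq> t \<and> dist (t + c) t < d"
      using tc c by (simp_all add: dist_real_def)
    then have "dist (v (t + c)) (v t) < e / 3" using d(2) by blast
    moreover have "l (t + c) \<in> {0..s} \<inter> {t<..}" "l (t + c) \<noteq> t \<and> dist (l (t + c)) t < d"
      using time_change_range[OF l(1) tc] abs_less_iff[THEN iffD1, OF a(1)] c
      by (simp_all add: dist_real_def)
    then have "dist (w (l (t + c))) (w t) < e / 3" using d(2) by blast
    ultimately show ?thesis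
      using a(2) dist_triangle[of "v t" "w t" "v (t + c)"] dist_triangle[of "v (t + c)" "w t" "w (l (t + c))"]
        dist_commute[of "v t" "v (t + c)"] by linarith
  qed
  then have "dist (v t) (w t) \<le> 0" by (rule dense_ge[OF less_imp_le])
  then show "v t = w t" by simp
qed

definition skorokhod_mdist :: "real \<Rightarrow> 'a::metric_space set \<Rightarrow> (real \<Rightarrow> 'a) \<Rightarrow> (real \<Rightarrow> 'a) \<Rightarrow> real" where
  "skorokhod_mdist s E v w =
     (if v \<in> skorokhod s E \<and> w \<in> skorokhod s E then skorokhod_dist s v w else 0)"

lemma skorokhod_dist_refl: "w \<in> skorokhod s E \<Longrightarrow> skorokhod_dist s w w = 0"
proof (rule antisym)
  assume w: "w \<in> skorokhod s E"
  show "0 \<le> skorokhod_dist s w w" using skorokhod_dist_nonneg[OF w w] .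
  show "skorokhod_dist s w w \<le> 0"
  proof (rule field_le_epsilon)
    fix e :: real assume "0 < e"
    then show "skorokhod_dist s w w \<le> 0 + e"
      by (intro skorokhod_dist_le[OF _ time_change_id]) auto
  qed
qed

lemma skorokhod_mdist_eq:
  "v \<in> skorokhod s E \<Longrightarrow> w \<in> skorokhod s E \<Longrightarrow> skorokhod_mdist s E v w = skorokhod_dist s v w"
  unfolding skorokhod_mdist_def by simp

lemma skorokhod_mdist_nonneg: "0 \<le> skorokhod_mdist s E v w"
proof (cases "v \<in> skorokhod s E \<and> w \<in> skorokhod s E")
  case True
  then show ?thesis using skorokhod_dist_nonneg[of v s E w] by (simp only: skorokhod_mdist_eq)
next
  case False
  then show ?thesis unfolding skorokhod_mdist_def by argo
qed

lemma skorokhod_mdist_commute: "skorokhod_mdist s E v w = skorokhod_mdist s E w v"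
proof (cases "v \<in> skorokhod s E \<and> w \<in> skorokhod s E")
  case True
  then have "skorokhod_dist s v w = skorokhod_dist s w v"
    by (intro antisym) (blast intro: skorokhod_dist_sym_le)+
  then show ?thesis using True by (simp only: skorokhod_mdist_eq)
next
  case False
  then show ?thesis unfolding skorokhod_mdist_def by argo
qed

lemma skorokhod_mdist_zero:
  assumes "v \<in> skorokhod s E" "w \<in> skorokhod s E"
  shows "skorokhod_mdist s E v w = 0 \<longleftrightarrow> v = w"
  unfolding skorokhod_mdist_eq[OF assms]
  using skorokhod_dist_zero[OF assms] skorokhod_dist_refl[OF assms(1)] by blast

lemma skorokhod_mdist_triangle:
  assumes "u \<in> skorokhod s E" "v \<in> skorokhod s E" "w \<in> skorokhod s E"
  shows "skorokhod_mdist s E u w \<le> skorokhod_mdist s E u v + skorokhod_mdist s E v w"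
  unfolding skorokhod_mdist_eq[OF assms(1,2)] skorokhod_mdist_eq[OF assms(1,3)]
    skorokhod_mdist_eq[OF assms(2,3)]
  by (rule skorokhod_dist_triangle[OF assms])

lemma Metric_space_skorokhod: "Metric_space (skorokhod s E) (skorokhod_mdist s E)"
  using skorokhod_mdist_nonneg skorokhod_mdist_commute skorokhod_mdist_zero skorokhod_mdist_triangle
  unfolding Metric_space_def by blast

definition skorokhod_topology :: "real \<Rightarrow> 'a::metric_space set \<Rightarrow> (real \<Rightarrow> 'a) topology" where
  "skorokhod_topology s E = Metric_space.mtopology (skorokhod s E) (skorokhod_mdist s E)"

text \<open>The sigma-algebra generated by the coordinates up to time \<open>s\<close>.\<close>

definition path_sigma :: "real \<Rightarrow> 'a::topological_space set \<Rightarrow> (real \<Rightarrow> 'a) measure" where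
  "path_sigma s E = restrict_space (PiM {0..s} (\<lambda>_. borel)) (skorokhod s E)"


section \<open>Continuous-time Markov chains\<close>

definition trans_prob :: "(nat \<Rightarrow> 'w measure) \<Rightarrow> (real \<Rightarrow> 'w \<Rightarrow> nat) \<Rightarrow> real \<Rightarrow> nat \<Rightarrow> nat \<Rightarrow> real" where
  "trans_prob P X t i j = measure (P i) {\<omega> \<in> space (P i). X t \<omega> = j}"

text \<open>\<open>P i\<close> is the law under which the chain \<open>X\<close> starts from \<open>i\<close>. A cadlag path in a discrete space
  has finitely many jumps in bounded time, so \<open>cadlag\<close> includes non-explosiveness.\<close>

locale markov_chain =
  fixes S :: "nat set" and q :: "nat \<Rightarrow> nat \<Rightarrow> real"
    and P :: "nat \<Rightarrow> 'w measure" and X :: "real \<Rightarrow> 'w \<Rightarrow> nat"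
  assumes state_space: "S = UNIV \<or> (\<exists>K. S = {0..K})"
    and q_nonneg: "\<And>i j. i \<in> S \<Longrightarrow> j \<in> S \<Longrightarrow> i \<noteq> j \<Longrightarrow> 0 \<le> q i j"
    and q_conservative: "\<And>i. i \<in> S \<Longrightarrow> (q i has_sum 0) S"
    and prob_space_P: "\<And>i. i \<in> S \<Longrightarrow> prob_space (P i)"
    and measurable_X: "\<And>i t. i \<in> S \<Longrightarrow> 0 \<le> t \<Longrightarrow> X t \<in> P i \<rightarrow>\<^sub>M count_space UNIV"
    and cadlag_X: "\<And>i \<omega>. i \<in> S \<Longrightarrow> \<omega> \<in> space (P i) \<Longrightarrow> cadlag {0..} S (\<lambda>t. X t \<omega>)"
    and start_X: "\<And>i. i \<in> S \<Longrightarrow> AE \<omega> in P i. X 0 \<omega> = i"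
    and markov: "\<And>i n t j. i \<in> S \<Longrightarrow> t 0 = 0 \<Longrightarrow> (\<forall>k<n. t k \<le> t (Suc k)) \<Longrightarrow>
       j 0 = i \<Longrightarrow> (\<forall>k\<le>n. j k \<in> S) \<Longrightarrow>
       measure (P i) {\<omega> \<in> space (P i). \<forall>k\<le>n. X (t k) \<omega> = j k} =
         (\<Prod>k<n. trans_prob P X (t (Suc k) - t k) (j k) (j (Suc k)))"
    and Q_matrix: "\<And>i j. i \<in> S \<Longrightarrow> j \<in> S \<Longrightarrow>
       ((\<lambda>t. trans_prob P X t i j) has_real_derivative q i j) (at 0 within {0..})"

definition first_time :: "(real \<Rightarrow> bool) \<Rightarrow> ereal" where
  "first_time A = Inf {ereal t | t. 0 \<le> t \<and> A t}"

definition tau0 :: "(real \<Rightarrow> 'w \<Rightarrow> nat) \<Rightarrow> 'w \<Rightarrow> ereal" where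
  "tau0 X \<omega> = first_time (\<lambda>t. X t \<omega> = 0)"

definition irreducible_chain :: "nat set \<Rightarrow> (nat \<Rightarrow> 'w measure) \<Rightarrow> (real \<Rightarrow> 'w \<Rightarrow> nat) \<Rightarrow> bool" where
  "irreducible_chain S P X \<longleftrightarrow> (\<forall>i\<in>S. \<forall>j\<in>S. \<exists>t\<ge>0. 0 < trans_prob P X t i j)"

definition irreducible_killed :: "nat set \<Rightarrow> (nat \<Rightarrow> 'w measure) \<Rightarrow> (real \<Rightarrow> 'w \<Rightarrow> nat) \<Rightarrow> bool" where
  "irreducible_killed S P X \<longleftrightarrow> (\<forall>i\<in>S - {0}. \<forall>j\<in>S - {0}. \<exists>t\<ge>0.
     0 < measure (P i) {\<omega> \<in> space (P i). X t \<omega> = j \<and> ereal t < tau0 X \<omega>})"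

definition recurrent_chain :: "nat set \<Rightarrow> (nat \<Rightarrow> 'w measure) \<Rightarrow> (real \<Rightarrow> 'w \<Rightarrow> nat) \<Rightarrow> bool" where
  "recurrent_chain S P X \<longleftrightarrow> (\<forall>i\<in>S. AE \<omega> in P i. \<forall>T. \<exists>t\<ge>T. 0 \<le> t \<and> X t \<omega> = i)"

definition muC :: "(nat \<Rightarrow> 'w measure) \<Rightarrow> (real \<Rightarrow> 'w \<Rightarrow> nat) \<Rightarrow> nat \<Rightarrow> ereal" where
  "muC P X i = Inf {ereal l | l.
     (\<integral>\<^sup>+t\<in>{0..}. ennreal (measure (P i) {\<omega> \<in> space (P i). ereal t < tau0 X \<omega>} * exp (l * t)) \<partial>lborel) = \<infinity>}"

text \<open>Holding time, return time and cycle length; used only under \<open>P 0\<close>, where the holding time in \<open>0\<close>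
  starts at time \<open>0\<close> and is hence a full one. In \<open>cycle_mgf\<close>, the conversion to \<open>real\<close> is harmless
  since the cycle length of a recurrent chain is almost surely finite.\<close>

definition holding1 :: "(real \<Rightarrow> 'w \<Rightarrow> nat) \<Rightarrow> 'w \<Rightarrow> ereal" where
  "holding1 X \<omega> = first_time (\<lambda>t. X t \<omega> \<noteq> 0)"

definition return1 :: "(real \<Rightarrow> 'w \<Rightarrow> nat) \<Rightarrow> 'w \<Rightarrow> ereal" where
  "return1 X \<omega> = first_time (\<lambda>r. holding1 X \<omega> < \<infinity> \<and> X (real_of_ereal (holding1 X \<omega>) + r) \<omega> = 0)"

definition cycle1 :: "(real \<Rightarrow> 'w \<Rightarrow> nat) \<Rightarrow> 'w \<Rightarrow> ereal" where
  "cycle1 X \<omega> = holding1 X \<omega> + return1 X \<omega>"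

definition cycle_mgf :: "(nat \<Rightarrow> 'w measure) \<Rightarrow> (real \<Rightarrow> 'w \<Rightarrow> nat) \<Rightarrow> real \<Rightarrow> ennreal" where
  "cycle_mgf P X l =
     (\<integral>\<^sup>+\<omega>\<in>{\<omega>. holding1 X \<omega> < 1}. ennreal (exp (l * real_of_ereal (cycle1 X \<omega>))) \<partial>P 0)"

definition phi :: "(nat \<Rightarrow> 'w measure) \<Rightarrow> (real \<Rightarrow> 'w \<Rightarrow> nat) \<Rightarrow> ereal" where
  "phi P X = Sup {ereal l | l. 0 \<le> l \<and> cycle_mgf P X l \<le> 1}"


section \<open>The process with holding times\<close>

type_synonym hat = "nat discrete \<times> real"

text \<open>The state \<open>i \<in> C\<close> is \<open>(discrete i, 0)\<close> and the state \<open>(0, u)\<close> is \<open>(discrete 0, u)\<close>. As a subspace of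
  \<open>nat discrete \<times> real\<close>, \<open>hat_space S\<close> is the topological sum of the discrete space \<open>C\<close> and \<open>[0, 1)\<close>.\<close>

abbreviation excursion :: "nat \<Rightarrow> hat" where
  "excursion i \<equiv> (discrete i, 0)"

abbreviation holding :: "real \<Rightarrow> hat" where
  "holding u \<equiv> (discrete 0, u)"

definition hat_space :: "nat set \<Rightarrow> hat set" where
  "hat_space S = excursion ` (S - {0}) \<union> holding ` {0..<1}"

abbreviation chain_state :: "hat \<Rightarrow> nat" where
  "chain_state y \<equiv> of_discrete (fst y)"

text \<open>The current holding time along the path \<open>x\<close>, when a path starting in \<open>0\<close> has already been there for
  time \<open>u\<close>. By right-continuity, the latest entry into \<open>0\<close> before \<open>t\<close> is the supremum of the times spent
  outside \<open>0\<close>.\<close>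

definition hold_time :: "real \<Rightarrow> (real \<Rightarrow> nat) \<Rightarrow> real \<Rightarrow> real option" where
  "hold_time u x t =
     (if x t \<noteq> 0 then None
      else if \<forall>r\<in>{0..t}. x r = 0 then Some (u + t)
      else Some (t - Sup {r \<in> {0..t}. x r \<noteq> 0}))"

definition hat_path :: "real \<Rightarrow> (real \<Rightarrow> nat) \<Rightarrow> real \<Rightarrow> hat" where
  "hat_path u x t = (case hold_time u x t of None \<Rightarrow> excursion (x t) | Some a \<Rightarrow> holding a)"

text \<open>In the following, \<open>y\<close> is the starting state in \<open>hat_space S\<close>; the underlying chain has law \<open>P (chain_state y)\<close>.\<close>

definition hatX :: "(real \<Rightarrow> 'w \<Rightarrow> nat) \<Rightarrow> hat \<Rightarrow> real \<Rightarrow> 'w \<Rightarrow> hat" where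
  "hatX X y t \<omega> = hat_path (snd y) (\<lambda>r. X r \<omega>) t"

definition tau :: "(real \<Rightarrow> 'w \<Rightarrow> nat) \<Rightarrow> hat \<Rightarrow> 'w \<Rightarrow> ereal" where
  "tau X y \<omega> = first_time (\<lambda>t. \<exists>a\<ge>1. hold_time (snd y) (\<lambda>r. X r \<omega>) t = Some a)"

definition hat_kernel ::
  "nat set \<Rightarrow> (nat \<Rightarrow> 'w measure) \<Rightarrow> (real \<Rightarrow> 'w \<Rightarrow> nat) \<Rightarrow> real \<Rightarrow> hat \<Rightarrow> (hat) measure" where
  "hat_kernel S P X t y =
     distr (restrict_space (P (chain_state y)) {\<omega> \<in> space (P (chain_state y)). ereal t < tau X y \<omega>})
       (restrict_space borel (hat_space S)) (hatX X y t)"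

text \<open>The law on \<open>\<F>\<^sub>s\<close>, under the measure \<open>M\<close>, of the paths that are alive at time \<open>s\<close>. An alive path can
  fail to be cadlag in \<open>hat_space S\<close> only if \<open>X\<close> leaves \<open>0\<close> exactly when the holding time reaches \<open>1\<close>,
  which has probability zero; such paths are discarded.\<close>

definition alive_law ::
  "nat set \<Rightarrow> (real \<Rightarrow> 'w \<Rightarrow> nat) \<Rightarrow> hat \<Rightarrow> 'w measure \<Rightarrow> real \<Rightarrow> (real \<Rightarrow> hat) measure" where
  "alive_law S X y M s =
     distr (restrict_space M {\<omega> \<in> space M. ereal s < tau X y \<omega> \<and>
              (\<lambda>t\<in>{0..s}. hatX X y t \<omega>) \<in> skorokhod s (hat_space S)})
       (path_sigma s (hat_space S)) (\<lambda>\<omega>. \<lambda>t\<in>{0..s}. hatX X y t \<omega>)"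

definition hat_law ::
  "nat set \<Rightarrow> (nat \<Rightarrow> 'w measure) \<Rightarrow> (real \<Rightarrow> 'w \<Rightarrow> nat) \<Rightarrow> hat \<Rightarrow> real \<Rightarrow> (real \<Rightarrow> hat) measure" where
  "hat_law S P X y s = alive_law S X y (P (chain_state y)) s"

definition conditioned_law ::
  "nat set \<Rightarrow> (nat \<Rightarrow> 'w measure) \<Rightarrow> (real \<Rightarrow> 'w \<Rightarrow> nat) \<Rightarrow> hat \<Rightarrow> real \<Rightarrow> real
     \<Rightarrow> (real \<Rightarrow> hat) measure" where
  "conditioned_law S P X y T s =
     alive_law S X y (uniform_measure (P (chain_state y)) {\<omega> \<in> space (P (chain_state y)). ereal T < tau X y \<omega>}) s"


section \<open>Substochastic kernels and h-transforms\<close>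

definition substochastic_semigroup ::
  "'a::topological_space set \<Rightarrow> (real \<Rightarrow> 'a \<Rightarrow> 'a measure) \<Rightarrow> bool" where
  "substochastic_semigroup E K \<longleftrightarrow>
     (\<forall>t\<ge>0. K t \<in> restrict_space borel E \<rightarrow>\<^sub>M subprob_algebra (restrict_space borel E)) \<and>
     (\<forall>x\<in>E. K 0 x = return (restrict_space borel E) x) \<and>
     (\<forall>s\<ge>0. \<forall>t\<ge>0. \<forall>x\<in>E. K (s + t) x = K s x \<bind> K t)"

definition superharmonic ::
  "'a set \<Rightarrow> (real \<Rightarrow> 'a \<Rightarrow> 'a measure) \<Rightarrow> ('a \<Rightarrow> real) \<Rightarrow> bool" where
  "superharmonic E K h \<longleftrightarrow> (\<forall>t\<ge>0. \<forall>x\<in>E. (\<integral>\<^sup>+y. ennreal (h y) \<partial>K t x) \<le> ennreal (h x))"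

definition h_transform ::
  "('a \<Rightarrow> real) \<Rightarrow> (real \<Rightarrow> 'a \<Rightarrow> 'a measure) \<Rightarrow> real \<Rightarrow> 'a \<Rightarrow> 'a measure" where
  "h_transform h K t x = density (K t x) (\<lambda>y. ennreal (h y / h x))"

definition h_transform_law ::
  "('a \<Rightarrow> real) \<Rightarrow> (real \<Rightarrow> (real \<Rightarrow> 'a) measure) \<Rightarrow> real \<Rightarrow> (real \<Rightarrow> 'a) measure" where
  "h_transform_law h L s = density (L s) (\<lambda>w. ennreal (h (w s) / h (w 0)))"

text \<open>With \<open>L s\<close> the law, up to time \<open>s\<close>, of the paths alive at \<open>s\<close>: the possibly dying process described by
  \<open>L\<close> is Markov with transition semigroup \<open>K\<close>.\<close>

definition has_semigroup ::
  "'a::topological_space set \<Rightarrow> (real \<Rightarrow> (real \<Rightarrow> 'a) measure) \<Rightarrow> (real \<Rightarrow> 'a \<Rightarrow> 'a measure) \<Rightarrow> bool" where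
  "has_semigroup E L K \<longleftrightarrow>
     (\<forall>s\<ge>0. \<forall>t\<ge>0. \<forall>B\<in>sets (path_sigma s E). \<forall>A\<in>sets (restrict_space borel E).
        emeasure (L (s + t)) {w \<in> space (L (s + t)). restrict w {0..s} \<in> B \<and> w (s + t) \<in> A} =
        (\<integral>\<^sup>+w\<in>B. emeasure (K t (w s)) A \<partial>L s))"

definition dies_at_rate :: "(real \<Rightarrow> 'a \<Rightarrow> 'a measure) \<Rightarrow> 'a \<Rightarrow> real \<Rightarrow> bool" where
  "dies_at_rate K x r \<longleftrightarrow> ((\<lambda>t. (1 - measure (K t x) (space (K t x))) / t) \<longlongrightarrow> r) (at_right 0)"


section \<open>Vague convergence and subexponentiality\<close>

definition vaguely_converges ::
  "nat set \<Rightarrow> real \<Rightarrow> (real \<Rightarrow> (real \<Rightarrow> hat) measure) \<Rightarrow> (real \<Rightarrow> hat) measure \<Rightarrow> bool" where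
  "vaguely_converges S s L N \<longleftrightarrow>
     (\<forall>f. continuous_map (skorokhod_topology s (hat_space S)) euclideanreal f \<longrightarrow>
          bounded (f ` skorokhod s (hat_space S)) \<longrightarrow>
          (\<exists>K. finite K \<and> K \<subseteq> S - {0} \<and>
             (\<forall>w\<in>skorokhod s (hat_space S).
                (\<exists>r\<in>{0..s}. w r \<notin> excursion ` K \<union> holding ` {0..<1}) \<longrightarrow> f w = 0)) \<longrightarrow>
          ((\<lambda>T. \<integral>w. f w \<partial>L T) \<longlongrightarrow> (\<integral>w. f w \<partial>N)) at_top)"

fun convolution_power :: "nat \<Rightarrow> real measure \<Rightarrow> real measure" where
  "convolution_power 0 F = return borel 0"
| "convolution_power (Suc n) F = convolution F (convolution_power n F)"

definition subexponential :: "real measure \<Rightarrow> bool" where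
  "subexponential F \<longleftrightarrow> (AE z in F. 0 \<le> z) \<and>
     (\<forall>n\<ge>1. ((\<lambda>t. measure (convolution_power n F) {t<..} / measure F {t<..}) \<longlongrightarrow> real n) at_top)"

text \<open>The law of \<open>tau\<close> for the process started from \<open>(0, 0)\<close>; \<open>tau\<close> is almost surely finite when \<open>X\<close> is recurrent.\<close>

definition tau_distribution :: "(nat \<Rightarrow> 'w measure) \<Rightarrow> (real \<Rightarrow> 'w \<Rightarrow> nat) \<Rightarrow> real measure" where
  "tau_distribution P X = distr (P 0) borel (\<lambda>\<omega>. real_of_ereal (tau X (holding 0) \<omega>))"

definition h_lim :: "real \<Rightarrow> hat \<Rightarrow> real" where
  "h_lim q0 y = (if chain_state y = 0 then (1 - exp (- q0 * (1 - snd y))) / (1 - exp (- q0)) else 1)"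

end

(*
  The survival probability Fbar(t) = P(tau > t) from (0,0) is long-tailed, since tau is
  subexponential; everything else about subexponentiality is not needed. Applying the Markov property
  at a time v < 1 on the event that the chain is still in 0, and long-tailedness to ignore the
  time shift, gives two linear equations for the limits of P(H < v, tau > t) / Fbar(t) at v and 1 - v, where
  H is the first holding time; their solution is (1 - exp(-q0 v)) / (1 - exp(-q0)). From a state in C, the
  survival probability is compared with Fbar through the hitting time of 0, which has exponential
  moments as mu^C > 0 and is thus negligible against a long tail. In all cases P_y(tau > t - s) / Fbar(t)
  tends to h(y). Fatou's lemma then makes h superharmonic. By the Markov property at time s, the
  conditioned law has density P_{w s}(tau > T - s) / P_y(tau > T) with respect to the law of the
  paths alive at s, and dominated convergence yields the limit.
*)

theory Submission
  imports Defs
begin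


section \<open>Long tails\<close>

text \<open>The form of \<open>h\<close> in the holding states has a simple source: from (0, u) a
  long survival requires leaving 0 within the remaining time 1 - u, so it is the part of the
  survival from (0, 0) that starts with an early exit. If x and y are the limiting fractions with
  exit by v and by 1 - v, the Markov property at v and at 1 - v gives x + a y = 1 and y + b x = 1
  with a = exp(-q0 v), b = exp(-q0 (1 - v)). As a b = exp(-q0), this yields x (1 - exp(-q0)) = 1 -
  a, and v = 1 - u is the value of \<open>h\<close>.

  Dominated convergence needs P_z(tau > T - s) / Fbar(T) to be bounded over the states z charged by
  the test function. Fbar itself bounds the numerator in all holding states, but the comparison from
  C is made state by state. This is where the finite set of states in vague convergence is used.

  The chain is given by its finite-dimensional laws only. All conditioning is therefore reduced to
  one formula on the canonical space of chain paths, for functionals of the path stopped at s and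
  the path shifted by s. The age of the present stay in 0 obeys a flow equation under this
  splitting, which transfers the formula to the process with holding times.\<close>

lemma measure_convolution_two:
  fixes F :: "real measure"
  assumes "prob_space F" and sF: "sets F = sets borel"
  shows "emeasure (convolution_power 2 F) {t<..} = (\<integral>\<^sup>+x. emeasure F {t - x<..} \<partial>F)"
proof -
  interpret F: prob_space F by fact
  have sp: "space F = UNIV" using sF by (metis sets_eq_imp_space_eq space_borel)
  interpret R: prob_space "return borel (0::real)" by (rule prob_space_return) simp
  have c1: "emeasure (convolution F (return borel 0)) {a<..} = emeasure F {a<..}" for a
  proof -
    have "emeasure (convolution F (return borel 0)) {a<..} = (\<integral>\<^sup>+x. emeasure (return borel 0) {y. y + x \<in> {a<..}} \<partial>F)"
      by (rule convolution_emeasure) (use sF sp F.finite_measure_axioms R.finite_measure_axioms in auto)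
    also have "\<dots> = (\<integral>\<^sup>+x. indicator {a<..} x \<partial>F)"
      by (intro nn_integral_cong) (auto simp: emeasure_return indicator_def)
    also have "\<dots> = emeasure F {a<..}" using sF by (simp add: nn_integral_indicator)
    finally show ?thesis .
  qed
  have fc: "finite_measure (convolution F (return borel 0))"
    by (rule convolution_finite) (use sF F.finite_measure_axioms R.finite_measure_axioms in auto)
  have "emeasure (convolution F (convolution F (return borel 0))) {t<..}
      = (\<integral>\<^sup>+x. emeasure (convolution F (return borel 0)) {y. y + x \<in> {t<..}} \<partial>F)"
    by (rule convolution_emeasure) (use sF sp F.finite_measure_axioms fc in auto)
  also have "\<dots> = (\<integral>\<^sup>+x. emeasure F {t - x<..} \<partial>F)"
  proof (intro nn_integral_cong)
    fix x :: real
    have "{y. y + x \<in> {t<..}} = {t - x<..}" by auto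
    then show "emeasure (convolution F (return borel 0)) {y. y + x \<in> {t<..}} = emeasure F {t - x<..}"
      by (simp add: c1)
  qed
  finally show ?thesis by (simp add: numeral_2_eq_2)
qed

text \<open>The case n = 2 forces the long tail. Split the event Z1 + Z2 > t by the value x of Z1.
  The parts x > t and x \<le> s contribute at least (2 - T s) T t, and the part s < x \<le> t
  contributes at least T(t - s) (T s - T t). Since the total is asymptotically 2 T t, there is no
  room for T(t - s) to exceed T t in the limit.\<close>

lemma subexponential_long_tailed:
  fixes F :: "real measure"
  assumes "prob_space F" and sF: "sets F = sets borel" and sub: "subexponential F"
  shows "0 < measure F {t<..}"
    and "0 \<le> s \<Longrightarrow> ((\<lambda>t. measure F {t - s<..} / measure F {t<..}) \<longlongrightarrow> 1) at_top"
proof -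
  interpret F: prob_space F by fact
  define T where "T = (\<lambda>t. measure F {t<..})"
  have anti: "a \<le> b \<Longrightarrow> T b \<le> T a" for a b
    unfolding T_def by (intro F.finite_measure_mono) (auto simp: sF)
  have T0: "0 \<le> T a" for a unfolding T_def by simp
  have Tm: "emeasure F {a<..} = ennreal (T a)" for a by (simp add: F.emeasure_eq_measure T_def)
  have lim: "((\<lambda>t. measure (convolution_power n F) {t<..} / T t) \<longlongrightarrow> real n) at_top" if "n \<ge> 1" for n
    using sub that unfolding subexponential_def T_def by blast
  have pos: "0 < T t" for t
  proof (rule ccontr)
    assume "\<not> 0 < T t"
    \<comment> \<open>A vanishing tail would make the quotient for n = 1 eventually 0, because
      division by zero yields 0, whereas its limit is 1.\<close>
    then have "T r = 0" if "r \<ge> t" for r using anti[OF that] T0[of r] T0[of t] by linarith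
    then have "\<forall>\<^sub>F r in at_top. measure (convolution_power 1 F) {r<..} / T r = 0"
      by (intro eventually_at_top_linorderI[of t]) simp
    then have "((\<lambda>r. measure (convolution_power 1 F) {r<..} / T r) \<longlongrightarrow> 0) at_top"
      by (rule tendsto_eventually)
    with lim[of 1] show False using tendsto_unique[OF trivial_limit_at_top_linorder] by fastforce
  qed
  then show "0 < measure F {t<..}" unfolding T_def .
  assume s: "0 \<le> s"
  have [measurable_cong]: "sets F = sets borel" by (rule sF)
  have sp: "space F = UNIV" using sF by (metis sets_eq_imp_space_eq space_borel)
  have Tcompl: "measure F {..a} = 1 - T a" for a
  proof -
    have "{..a} = space F - {a<..}" using sp by auto
    then show ?thesis unfolding T_def using F.prob_compl[of "{a<..}"] sF by simp
  qed
  have Tdiff: "measure F {a<..b} = T a - T b" if "a \<le> b" for a b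
  proof -
    have "{a<..b} = {a<..} - {b<..}" by auto
    then show ?thesis unfolding T_def using that by (simp add: F.finite_measure_Diff sF)
  qed
  have T1: "T a \<le> 1" for a unfolding T_def by simp
  have nonneg: "AE x in F. 0 \<le> x" using sub unfolding subexponential_def by blast
  have Tneg: "T a = 1" if "a < 0" for a
  proof -
    have "AE x in F. x \<in> {a<..}" using nonneg by eventually_elim (use that in auto)
    then show ?thesis unfolding T_def by (subst F.prob_eq_1) (auto simp: sF)
  qed
  interpret R: prob_space "return borel (0::real)" by (rule prob_space_return) simp
  interpret C: finite_measure "convolution_power 2 F"
  proof -
    have "finite_measure (convolution F (return borel 0))"
      by (rule convolution_finite) (use sF F.finite_measure_axioms R.finite_measure_axioms in auto)
    then show "finite_measure (convolution_power 2 F)"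
      by (simp add: numeral_2_eq_2) (rule convolution_finite; auto simp: sF intro: F.finite_measure_axioms)
  qed
  \<comment> \<open>The integrand T(t - x) is at least T t for x \<le> s, at least T(t - s) for s <
    x \<le> t, and equal to 1 for x > t. The 1 is written as T t + (1 - T t), which gives the four
    indicator terms below.\<close>
  have key: "T t * (2 - T s) + T (t - s) * (T s - T t) \<le> measure (convolution_power 2 F) {t<..}"
    if t: "s \<le> t" for t
  proof -
    have "ennreal (T t * (2 - T s) + T (t - s) * (T s - T t))
      = ennreal (T t) * emeasure F {t<..} + (ennreal (T t) * emeasure F {..s} + ennreal (T (t - s)) * emeasure F {s<..t}) 
        + ennreal (1 - T t) * emeasure F {t<..}"
    proof -
      have "T t * (2 - T s) + T (t - s) * (T s - T t) = T t * T t + (T t * (1 - T s) + T (t - s) * (T s - T t)) + (1 - T t) * T t"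
        by (simp add: algebra_simps)
      moreover note Tm[of t]
      moreover have "0 \<le> T s - T t" "0 \<le> 1 - T t" "0 \<le> 1 - T s" using anti[OF t] T1 by simp_all
      ultimately show ?thesis
        using T0[of t] T0[of "t - s"]
        by (simp only: F.emeasure_eq_measure Tcompl Tdiff[OF t] ennreal_mult ennreal_plus mult_nonneg_nonneg add_nonneg_nonneg)
    qed
    also have "\<dots> = (\<integral>\<^sup>+x. ennreal (T t) * indicator {t<..} x + (ennreal (T t) * indicator {..s} x
        + ennreal (T (t - s)) * indicator {s<..t} x) + ennreal (1 - T t) * indicator {t<..} x \<partial>F)"
      by (simp add: nn_integral_add nn_integral_cmult sF)
    also have "\<dots> \<le> (\<integral>\<^sup>+x. emeasure F {t - x<..} \<partial>F)"
    proof (rule nn_integral_mono_AE, use nonneg in eventually_elim)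
      fix x :: real assume x: "0 \<le> x"
      consider "x \<le> s" | "s < x" "x \<le> t" | "t < x" by linarith
      then show "ennreal (T t) * indicator {t<..} x + (ennreal (T t) * indicator {..s} x
        + ennreal (T (t - s)) * indicator {s<..t} x) + ennreal (1 - T t) * indicator {t<..} x \<le> emeasure F {t - x<..}"
      proof cases
        case 1
        then show ?thesis using t anti[of "t - x" t] x by (simp add: Tm ennreal_leI)
      next
        case 2
        then show ?thesis using anti[of "t - x" "t - s"] by (simp add: Tm ennreal_leI)
      next
        case 3
        then show ?thesis using t s Tneg[of "t - x"] T0[of t] T1[of t]
          by (simp add: Tm flip: ennreal_plus)
      qed
    qed
    also have "\<dots> = ennreal (measure (convolution_power 2 F) {t<..})"
      using measure_convolution_two[OF assms(1) sF] by (simp add: C.emeasure_eq_measure)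
    finally show ?thesis by (simp add: ennreal_le_iff)
  qed
  have Tlim: "(T \<longlongrightarrow> 0) at_top"
  proof -
    interpret rd: real_distribution F
      by (simp add: real_distribution_def F.prob_space_axioms real_distribution_axioms_def sF)
    have "((\<lambda>t. 1 - cdf F t) \<longlongrightarrow> 1 - 1) at_top"
      by (intro tendsto_intros rd.cdf_lim_at_top_prob)
    moreover have "1 - cdf F t = T t" for t unfolding cdf_def Tcompl by simp
    ultimately show ?thesis by simp
  qed
  have Tlt: "\<forall>\<^sub>F t in at_top. T t < T s" using order_tendstoD(2)[OF Tlim pos[of s]] .
  \<comment> \<open>Solving \<open>key\<close> for the quotient divides by T s - T t, which is
    positive for large t. The right-hand side tends to (2 - (2 - T s)) / T s = 1.\<close>
  have up: "\<forall>\<^sub>F t in at_top. T (t - s) / T t \<le> (measure (convolution_power 2 F) {t<..} / T t - (2 - T s)) / (T s - T t)"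
    using Tlt eventually_ge_at_top[of s]
  proof eventually_elim
    case (elim t)
    have "T (t - s) / T t * (T s - T t) \<le> measure (convolution_power 2 F) {t<..} / T t - (2 - T s)"
    proof -
      have "T t * (T (t - s) / T t * (T s - T t)) \<le> T t * (measure (convolution_power 2 F) {t<..} / T t - (2 - T s))"
      proof -
        have "T t * (T (t - s) / T t * (T s - T t)) = T (t - s) * (T s - T t)"
          using pos[of t] by simp
        moreover have "T t * (measure (convolution_power 2 F) {t<..} / T t - (2 - T s))
            = measure (convolution_power 2 F) {t<..} - T t * (2 - T s)"
          using pos[of t] by (simp add: right_diff_distrib[of "T t" "measure (convolution_power 2 F) {t<..} / T t"])
        ultimately show ?thesis using key[OF elim(2)] by linarith
      qed
      then show ?thesis by (rule mult_left_le_imp_le[OF _ pos[of t]])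
    qed
    then show ?case using elim(1) by (simp add: pos_le_divide_eq)
  qed
  have "((\<lambda>t. (measure (convolution_power 2 F) {t<..} / T t - (2 - T s)) / (T s - T t)) \<longlongrightarrow> (real 2 - (2 - T s)) / (T s - 0)) at_top"
    by (intro tendsto_intros lim Tlim) (use pos[of s] in auto)
  then have L: "((\<lambda>t. (measure (convolution_power 2 F) {t<..} / T t - (2 - T s)) / (T s - T t)) \<longlongrightarrow> 1) at_top"
    using pos[of s] by simp
  have "((\<lambda>t. T (t - s) / T t) \<longlongrightarrow> 1) at_top"
    by (rule tendsto_sandwich[OF _ up tendsto_const L]) (use pos anti s in \<open>auto simp: le_divide_eq\<close>)
  then show "((\<lambda>t. measure F {t - s<..} / measure F {t<..}) \<longlongrightarrow> 1) at_top" unfolding T_def .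
qed

text \<open>Beyond some t0 a unit step back costs at most a factor exp d, and iteration over a steps
  gives exp(d a); below t0 the bound T \<le> 1 suffices. As the bound holds for all t and a, it can
  dominate F(t - a) / F t when a is an unbounded random time with an exponential moment.\<close>

lemma long_tailed_exp_bound:
  fixes T :: "real \<Rightarrow> real"
  assumes anti: "antimono T" and pos: "\<And>t. 0 < T t" and le1: "\<And>t. T t \<le> 1"
    and lim: "((\<lambda>t. T (t - 1) / T t) \<longlongrightarrow> 1) at_top" and d: "0 < d"
  shows "\<exists>C. \<forall>t a. 0 \<le> a \<longrightarrow> T (t - a) \<le> C * exp (d * a) * T t"
proof -
  have "\<forall>\<^sub>F t in at_top. T (t - 1) / T t < exp d" using order_tendstoD(2)[OF lim, of "exp d"] d by simp
  then obtain t0 where t0: "\<And>t. t \<ge> t0 \<Longrightarrow> T (t - 1) / T t < exp d" 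
    unfolding eventually_at_top_linorder by blast
  define C where "C = exp d / T t0"
  have C: "1 \<le> C * T t0" "0 < C" "exp d \<le> C" unfolding C_def using d pos[of t0] le1[of t0]
    by (auto simp: field_simps)
  have "\<forall>t a. t \<le> t0 + real n \<longrightarrow> 0 \<le> a \<longrightarrow> T (t - a) \<le> C * exp (d * a) * T t" for n
  proof (induction n)
    have base: "T (t - a) \<le> C * exp (d * a) * T t" if "t \<le> t0" "0 \<le> a" for t a
    proof -
      have "T (t - a) \<le> 1" by (rule le1)
      also have "1 \<le> C * T t0" by (rule C)
      also have "\<dots> \<le> C * T t" using antimonoD[OF anti that(1)] C by simp
      also have "\<dots> \<le> C * exp (d * a) * T t" using that d pos[of t] C by simp
      finally show ?thesis .
    qed
    case 0 then show ?case using base by simp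
    case (Suc n)
    show ?case
    proof (intro allI impI)
      fix t a :: real assume t: "t \<le> t0 + real (Suc n)" and a: "0 \<le> a"
      show "T (t - a) \<le> C * exp (d * a) * T t"
      proof (cases "t \<le> t0")
        case True then show ?thesis using base a by blast
      next
        case False
        then have st: "T (t - 1) \<le> exp d * T t" using t0[of t] pos[of t] by (simp add: field_simps)
        show ?thesis
        proof (cases "1 \<le> a")
          case True
          have "T (t - a) = T ((t - 1) - (a - 1))" by simp
          also have "\<dots> \<le> C * exp (d * (a - 1)) * T (t - 1)" using Suc.IH[rule_format, of "t - 1" "a - 1"] t True by simp
          also have "\<dots> \<le> C * exp (d * (a - 1)) * (exp d * T t)" using st C by simp
          also have "\<dots> = C * exp (d * a) * T t" by (simp add: exp_add[symmetric] algebra_simps)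
          finally show ?thesis .
        next
          case False
          then have "T (t - a) \<le> T (t - 1)" using antimonoD[OF anti, of "t - 1" "t - a"] by simp
          also have "\<dots> \<le> exp d * T t" by (rule st)
          also have "\<dots> \<le> C * T t" using C pos[of t] by simp
          also have "\<dots> \<le> C * exp (d * a) * T t" using a d pos[of t] C by simp
          finally show ?thesis .
        qed
      qed
    qed
  qed
  moreover have "\<exists>n. t \<le> t0 + real n" for t
    using real_arch_simple[of "t - t0"] by (auto simp: algebra_simps)
  ultimately show ?thesis by blast
qed

section \<open>Paths\<close>

text \<open>Extensionality lets the values at nonnegative times determine a path, so that
  \<open>paths S\<close> is a subset of the product space over \<open>{0..}\<close>.\<close>

definition paths :: "nat set \<Rightarrow> (real \<Rightarrow> nat) set" where
  "paths S = {w \<in> extensional {0..}. cadlag {0..} S w}"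

definition shift :: "real \<Rightarrow> (real \<Rightarrow> nat) \<Rightarrow> real \<Rightarrow> nat" where
  "shift s w = (\<lambda>t\<in>{0..}. w (s + t))"

text \<open>The past up to s is encoded by the stopped path and the future by the shifted path. The
  Markov property then becomes a statement about this pair of paths, and no filtration has to be set
  up.\<close>

definition stop :: "real \<Rightarrow> (real \<Rightarrow> nat) \<Rightarrow> real \<Rightarrow> nat" where
  "stop s w = (\<lambda>t\<in>{0..}. w (min t s))"

lemma shift_apply [simp]: "0 \<le> t \<Longrightarrow> shift s w t = w (s + t)"
  and stop_apply [simp]: "0 \<le> t \<Longrightarrow> stop s w t = w (min t s)"
  by (auto simp: shift_def stop_def)

text \<open>In a discrete space, convergence is eventual equality. At time 0 the left filter is
  trivial and any point of \<open>S\<close> is a left limit; the case distinction on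
  \<open>w 0\<close> supplies such a point, and the left clause is stated for t > 0 only.\<close>

lemma cadlag_nat_iff:
  "cadlag {0..} S (w :: real \<Rightarrow> nat) \<longleftrightarrow> (\<forall>t\<ge>0. w t \<in> S) \<and>
     (\<forall>t\<ge>0. \<exists>e>0. \<forall>r\<in>{t..<t+e}. w r = w t) \<and>
     (\<forall>t>0. \<exists>l\<in>S. \<exists>e>0. e \<le> t \<and> (\<forall>r\<in>{t-e<..<t}. w r = l))"
proof -
  have R: "(w \<longlongrightarrow> w t) (at t within {0..} \<inter> {t<..}) \<longleftrightarrow> (\<exists>e>0. \<forall>r\<in>{t..<t+e}. w r = w t)"
    if "0 \<le> t" for t
  proof
    assume "(w \<longlongrightarrow> w t) (at t within {0..} \<inter> {t<..})"
    then have "\<forall>\<^sub>F r in at t within {0..} \<inter> {t<..}. w r = w t" by (simp only: tendsto_discrete)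
    then obtain d where d: "d > 0" "\<forall>r\<in>{0..} \<inter> {t<..}. r \<noteq> t \<and> dist r t < d \<longrightarrow> w r = w t"
      unfolding eventually_at by blast
    have "w r = w t" if "r \<in> {t..<t+d}" for r
    proof (cases "r = t")
      case False
      then show ?thesis by (intro d(2)[rule_format]) (use that \<open>0 \<le> t\<close> in \<open>auto simp: dist_real_def\<close>)
    qed simp
    then show "\<exists>e>0. \<forall>r\<in>{t..<t+e}. w r = w t" using d(1) by blast
  next
    assume "\<exists>e>0. \<forall>r\<in>{t..<t+e}. w r = w t"
    then obtain e where e: "e > 0" "\<forall>r\<in>{t..<t+e}. w r = w t" by blast
    have "w r = w t" if "t < r" "dist r t < e" for r
      by (rule bspec[OF e(2)]) (use that in \<open>auto simp: dist_real_def\<close>)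
    then have "\<forall>\<^sub>F r in at t within {0..} \<inter> {t<..}. w r = w t"
      unfolding eventually_at using e(1) by (intro exI[of _ e]) blast
    then show "(w \<longlongrightarrow> w t) (at t within {0..} \<inter> {t<..})" by (simp only: tendsto_discrete)
  qed
  have L: "(w \<longlongrightarrow> l) (at t within {0..} \<inter> {..<t}) \<longleftrightarrow> (\<exists>e>0. e \<le> t \<and> (\<forall>r\<in>{t-e<..<t}. w r = l))"
    if t: "0 < t" for t l
  proof
    assume "(w \<longlongrightarrow> l) (at t within {0..} \<inter> {..<t})"
    then have "\<forall>\<^sub>F r in at t within {0..} \<inter> {..<t}. w r = l" by (simp only: tendsto_discrete)
    then obtain d where d: "d > 0" "\<forall>r\<in>{0..} \<inter> {..<t}. r \<noteq> t \<and> dist r t < d \<longrightarrow> w r = l"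
      unfolding eventually_at by blast
    then show "\<exists>e>0. e \<le> t \<and> (\<forall>r\<in>{t-e<..<t}. w r = l)"
      using t by (intro exI[of _ "min d t"]) (auto simp: dist_real_def)
  next
    assume "\<exists>e>0. e \<le> t \<and> (\<forall>r\<in>{t-e<..<t}. w r = l)"
    then obtain e where e: "e > 0" "\<forall>r\<in>{t-e<..<t}. w r = l" by blast
    have "\<forall>\<^sub>F r in at t within {0..} \<inter> {..<t}. w r = l"
      unfolding eventually_at using e by (intro exI[of _ e]) (auto simp: dist_real_def)
    then show "(w \<longlongrightarrow> l) (at t within {0..} \<inter> {..<t})" by (simp only: tendsto_discrete)
  qed
  have L0: "at (0::real) within {0..} \<inter> {..<0} = bot"
  proof -
    have "{0..} \<inter> {..<0::real} = {}" by auto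
    then show ?thesis by simp
  qed
  have im: "w ` {0..} \<subseteq> S \<longleftrightarrow> (\<forall>t\<ge>0. w t \<in> S)" by auto
  have RR: "(\<forall>t\<in>{0..}. (w \<longlongrightarrow> w t) (at t within {0..} \<inter> {t<..})) \<longleftrightarrow> (\<forall>t\<ge>0. \<exists>e>0. \<forall>r\<in>{t..<t+e}. w r = w t)"
  proof
    assume a: "\<forall>t\<in>{0..}. (w \<longlongrightarrow> w t) (at t within {0..} \<inter> {t<..})"
    show "\<forall>t\<ge>0. \<exists>e>0. \<forall>r\<in>{t..<t+e}. w r = w t"
    proof (intro allI impI)
      fix t :: real assume t: "0 \<le> t"
      show "\<exists>e>0. \<forall>r\<in>{t..<t+e}. w r = w t" using R[OF t] a t by blast
    qed
  qed (use R in blast)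
  have LL: "(\<forall>t\<in>{0..}. \<exists>l\<in>S. (w \<longlongrightarrow> l) (at t within {0..} \<inter> {..<t})) \<longleftrightarrow>
      (\<forall>t>0. \<exists>l\<in>S. \<exists>e>0. e \<le> t \<and> (\<forall>r\<in>{t-e<..<t}. w r = l))" (is "?X \<longleftrightarrow> ?Y") if "w 0 \<in> S"
  proof
    assume x: ?X
    show ?Y
    proof (intro allI impI)
      fix t :: real assume t: "0 < t"
      then obtain l where "l \<in> S" "(w \<longlongrightarrow> l) (at t within {0..} \<inter> {..<t})" using x by force
      then show "\<exists>l\<in>S. \<exists>e>0. e \<le> t \<and> (\<forall>r\<in>{t-e<..<t}. w r = l)" using L[OF t] by blast
    qed
  next
    assume y: ?Y
    show ?X
    proof
      fix t :: real assume "t \<in> {0..}"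
      then consider "t = 0" | "t > 0" by fastforce
      then show "\<exists>l\<in>S. (w \<longlongrightarrow> l) (at t within {0..} \<inter> {..<t})"
      proof cases
        case 1 then show ?thesis using that by (auto simp: L0)
      next
        case 2 then show ?thesis using y L[OF 2] by blast
      qed
    qed
  qed
  show ?thesis
  proof (cases "w 0 \<in> S")
    case True show ?thesis unfolding cadlag_def im RR LL[OF True] by (rule refl)
  next
    case False then show ?thesis unfolding cadlag_def im by auto
  qed
qed

lemma pathsI:
  assumes "w \<in> extensional {0..}" "\<And>t. 0 \<le> t \<Longrightarrow> w t \<in> S"
    "\<And>t. 0 \<le> t \<Longrightarrow> \<exists>e>0. \<forall>r\<in>{t..<t+e}. w r = w t"
    "\<And>t. 0 < t \<Longrightarrow> \<exists>l\<in>S. \<exists>e>0. e \<le> t \<and> (\<forall>r\<in>{t-e<..<t}. w r = l)"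
  shows "w \<in> paths S"
  using assms unfolding paths_def cadlag_nat_iff by blast

lemma paths_state: "w \<in> paths S \<Longrightarrow> 0 \<le> t \<Longrightarrow> w t \<in> S"
  and paths_right: "w \<in> paths S \<Longrightarrow> 0 \<le> t \<Longrightarrow> \<exists>e>0. \<forall>r\<in>{t..<t+e}. w r = w t"
  and paths_left: "w \<in> paths S \<Longrightarrow> 0 < t \<Longrightarrow> \<exists>l\<in>S. \<exists>e>0. e \<le> t \<and> (\<forall>r\<in>{t-e<..<t}. w r = l)"
  and paths_ext: "w \<in> paths S \<Longrightarrow> w \<in> extensional {0..}"
  unfolding paths_def cadlag_nat_iff by blast+

lemma shift_paths:
  assumes w: "w \<in> paths S" and s: "0 \<le> s"
  shows "shift s w \<in> paths S"
proof (rule pathsI)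
  show "shift s w \<in> extensional {0..}" by (auto simp: shift_def)
  show "shift s w t \<in> S" if "0 \<le> t" for t using that s paths_state[OF w] by simp
  show "\<exists>e>0. \<forall>r\<in>{t..<t+e}. shift s w r = shift s w t" if t: "0 \<le> t" for t
  proof -
    obtain e where e: "e > 0" "\<forall>r\<in>{s+t..<s+t+e}. w r = w (s+t)"
      using paths_right[OF w, of "s+t"] s t by (meson add_nonneg_nonneg)
    have "shift s w r = shift s w t" if "r \<in> {t..<t+e}" for r
      using bspec[OF e(2), of "s + r"] that t by simp
    then show ?thesis using e(1) by blast
  qed
  show "\<exists>l\<in>S. \<exists>e>0. e \<le> t \<and> (\<forall>r\<in>{t-e<..<t}. shift s w r = l)" if t: "0 < t" for t
  proof -
    obtain l e where "l \<in> S" "e > 0" "\<forall>r\<in>{s+t-e<..<s+t}. w r = l" using paths_left[OF w, of "s+t"] s t by auto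
    then show ?thesis using t by (intro bexI[of _ l] exI[of _ "min e t"]) auto
  qed
qed

lemma stop_paths:
  assumes w: "w \<in> paths S" and s: "0 \<le> s"
  shows "stop s w \<in> paths S"
proof (rule pathsI)
  show "stop s w \<in> extensional {0..}" by (auto simp: stop_def)
  show "stop s w t \<in> S" if "0 \<le> t" for t using that s paths_state[OF w] by simp
  show "\<exists>e>0. \<forall>r\<in>{t..<t+e}. stop s w r = stop s w t" if t: "0 \<le> t" for t
  proof (cases "t < s")
    case True
    obtain e where e: "e > 0" "\<forall>r\<in>{t..<t+e}. w r = w t" using paths_right[OF w t] by blast
    have "stop s w r = stop s w t" if "r \<in> {t..<t+min e (s - t)}" for r
    proof -
      have "w r = w t" "r < s" using bspec[OF e(2), of r] that by auto
      then show ?thesis using that t True by simp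
    qed
    moreover have "0 < min e (s - t)" using e(1) True by simp
    ultimately show ?thesis by blast
  next
    case False
    then show ?thesis using t s by (intro exI[of _ 1]) auto
  qed
  show "\<exists>l\<in>S. \<exists>e>0. e \<le> t \<and> (\<forall>r\<in>{t-e<..<t}. stop s w r = l)" if t: "0 < t" for t
  proof (cases "t \<le> s")
    case True
    obtain l e where "l \<in> S" "e > 0" "e \<le> t" "\<forall>r\<in>{t-e<..<t}. w r = l" using paths_left[OF w t] by auto
    then show ?thesis using True by (intro bexI[of _ l] exI[of _ e]) (auto simp: min_def)
  next
    case False
    then show ?thesis using paths_state[OF w s] s
      by (intro bexI[of _ "w s"] exI[of _ "t - s"]) (auto simp: min_def)
  qed
qed

section \<open>The current holding time as a flow\<close>

definition age :: "real \<Rightarrow> (real \<Rightarrow> nat) \<Rightarrow> real \<Rightarrow> real" where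
  "age u x t = snd (hat_path u x t)"

text \<open>This is the event \<open>t < tau\<close> spelled out along the path, as
  \<open>tau_gt_iff\<close> shows. The age is 0 outside of the state 0, so only stays in 0 can kill.
  For negative t the condition is vacuous, which matches a tail probability of 1.\<close>

definition alive :: "real \<Rightarrow> (real \<Rightarrow> nat) \<Rightarrow> real \<Rightarrow> bool" where
  "alive u x t \<longleftrightarrow> (\<forall>r\<in>{0..t}. age u x r < 1)"

lemma age_eq:
  "age u x t = (if x t \<noteq> 0 then 0 else if \<forall>r\<in>{0..t}. x r = 0 then u + t
     else t - Sup {r \<in> {0..t}. x r \<noteq> 0})"
  unfolding age_def hat_path_def hold_time_def by auto

lemma age_eq_Sup:
  assumes "x t = 0" "\<not> (\<forall>r\<in>{0..t}. x r = 0)"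
  shows "age u x t = t - Sup {r \<in> {0..t}. x r \<noteq> 0}"
  unfolding age_eq if_not_P[OF assms(2)] using assms(1) by simp

lemma hat_path_eq: "hat_path u x t = (discrete (x t), age u x t)"
  unfolding age_def hat_path_def hold_time_def by auto

lemma hold_time_age: "(\<exists>a\<ge>1. hold_time u x t = Some a) \<longleftrightarrow> 1 \<le> age u x t"
  unfolding age_def hat_path_def by (auto split: option.splits)

lemma age_cong:
  assumes "0 \<le> t" "\<And>r. r \<in> {0..t} \<Longrightarrow> x r = y r" shows "age u x t = age u y t"
proof -
  have "{r \<in> {0..t}. x r \<noteq> 0} = {r \<in> {0..t}. y r \<noteq> 0}" using assms by auto
  then show ?thesis unfolding age_eq using assms by simp
qed

lemma alive_cong:
  assumes "\<And>r. r \<in> {0..t} \<Longrightarrow> x r = y r" shows "alive u x t \<longleftrightarrow> alive u y t"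
  unfolding alive_def by (intro ball_cong refl arg_cong2[of _ _ _ _ "(<)"] age_cong) (use assms in auto)

lemma hat_path_cong:
  assumes "0 \<le> t" "\<And>r. r \<in> {0..t} \<Longrightarrow> x r = y r" shows "hat_path u x t = hat_path u y t"
  unfolding hat_path_eq using age_cong[OF assms] assms by simp

lemma age_stop [simp]: "0 \<le> t \<Longrightarrow> t \<le> s \<Longrightarrow> age u (stop s w) t = age u w t"
  and alive_stop [simp]: "t \<le> s \<Longrightarrow> alive u (stop s w) t = alive u w t"
  and hat_path_stop [simp]: "0 \<le> t \<Longrightarrow> t \<le> s \<Longrightarrow> hat_path u (stop s w) t = hat_path u w t"
  by (auto intro!: age_cong alive_cong hat_path_cong)

lemma age_nonneg: "0 \<le> u \<Longrightarrow> 0 \<le> t \<Longrightarrow> 0 \<le> age u x t"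
proof -
  assume u: "0 \<le> u" "0 \<le> t"
  have "Sup {r \<in> {0..t}. x r \<noteq> 0} \<le> t" if "\<not> (\<forall>r\<in>{0..t}. x r = 0)"
    by (rule cSup_least) (use that in auto)
  then show ?thesis unfolding age_eq using u by auto
qed

text \<open>The pair of state and age is Markov for this reason: the past before s enters the age at
  s + t only through the age at s. If the path is in 0 during all of [s, s + t], both sides are the
  age at s plus t. If it is in 0 at s + t but was outside on the way, the supremum of the times
  outside is attached to [s, s + t] and the earlier age is forgotten.\<close>

lemma age_flow:
  assumes s: "0 \<le> s" and t: "0 \<le> t"
  shows "age u x (s + t) = age (age u x s) (shift s x) t"
proof (cases "x (s + t) = 0")
  case False
  then show ?thesis using t unfolding age_eq[of _ _ "s+t"] age_eq[of _ _ t] by simp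
next
  case True
  show ?thesis
  proof (cases "\<forall>r\<in>{0..t}. x (s + r) = 0")
    case all0: True
    then have xs: "x s = 0" using t by force
    have R: "age (age u x s) (shift s x) t = age u x s + t"
      unfolding age_eq[of _ _ t] using all0 t by simp
    show ?thesis
    proof (cases "\<forall>r\<in>{0..s}. x r = 0")
      case z: True
      have "x r = 0" if "r \<in> {0..s+t}" for r
      proof (cases "r \<le> s")
        case False
        then show ?thesis using bspec[OF all0, of "r - s"] that by simp
      qed (use z that in auto)
      then show ?thesis unfolding R unfolding age_eq using z xs True by simp
    next
      case nz: False
      have "{r \<in> {0..s+t}. x r \<noteq> 0} = {r \<in> {0..s}. x r \<noteq> 0}"
      proof -
        have "r \<le> s" if "r \<le> s + t" "x r \<noteq> 0" "0 \<le> r" for r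
          using bspec[OF all0, of "r - s"] that by (cases "r \<le> s") auto
        then show ?thesis using t by auto
      qed
      moreover have "\<not> (\<forall>r\<in>{0..s+t}. x r = 0)" using nz t by fastforce
      ultimately have "age u x (s + t) = s + t - Sup {r \<in> {0..s}. x r \<noteq> 0}"
        using age_eq_Sup[of x "s + t" u] True by simp
      moreover have "age u x s = s - Sup {r \<in> {0..s}. x r \<noteq> 0}"
        by (rule age_eq_Sup[OF xs nz])
      ultimately show ?thesis unfolding R by simp
    qed
  next
    case nall: False
    then obtain r0 where r0: "r0 \<in> {0..t}" "x (s + r0) \<noteq> 0" by blast
    have A: "\<not> (\<forall>r\<in>{0..s+t}. x r = 0)" using r0 s by fastforce
    have B: "\<not> (\<forall>r\<in>{0..t}. shift s x r = 0)" using r0 by fastforce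
    let ?A = "{r \<in> {0..s+t}. x r \<noteq> 0}" and ?B = "{r \<in> {0..t}. shift s x r \<noteq> 0}"
    have "r0 \<in> ?B" "s + r0 \<in> ?A" using r0 s by auto
    then have Bne: "?B \<noteq> {}" "?A \<noteq> {}" by blast+
    have bB: "bdd_above ?B" by (rule bdd_aboveI[of _ t]) simp
    have bA: "bdd_above ?A" by (rule bdd_aboveI[of _ "s + t"]) simp
    have "Sup ?A = s + Sup ?B"
    proof (rule antisym)
      show "Sup ?A \<le> s + Sup ?B"
      proof (rule cSup_least[OF Bne(2)])
        fix r assume r: "r \<in> ?A"
        show "r \<le> s + Sup ?B"
        proof (cases "s \<le> r")
          case True
          then have "r - s \<in> ?B" using r by auto
          then show ?thesis using cSup_upper[OF _ bB] by fastforce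
        next
          case False
          have "0 \<le> r0" using r0 by simp
          also have "r0 \<le> Sup ?B" using r0 by (intro cSup_upper[OF _ bB]) auto
          finally show ?thesis using False by simp
        qed
      qed
      have "Sup ?B \<le> Sup ?A - s"
      proof (rule cSup_least[OF Bne(1)])
        fix r assume r: "r \<in> ?B"
        then have "s + r \<in> ?A" using s by auto
        then show "r \<le> Sup ?A - s" using cSup_upper[OF _ bA] by fastforce
      qed
      then show "s + Sup ?B \<le> Sup ?A" by simp
    qed
    then show ?thesis using age_eq_Sup[of x "s+t" u, OF True A] age_eq_Sup[of "shift s x" t, OF _ B] True t by simp
  qed
qed

lemma hat_path_flow:
  assumes "0 \<le> s" "0 \<le> t" shows "hat_path u x (s + t) = hat_path (age u x s) (shift s x) t"
  unfolding hat_path_eq using age_flow[OF assms] assms by simp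

lemma alive_flow:
  assumes s: "0 \<le> s" and t: "0 \<le> t"
  shows "alive u x (s + t) \<longleftrightarrow> alive u x s \<and> alive (age u x s) (shift s x) t"
proof
  assume a: "alive u x (s + t)"
  have "age (age u x s) (shift s x) r < 1" if "r \<in> {0..t}" for r
  proof -
    have "age u x (s + r) < 1" using a that s unfolding alive_def by simp
    then show ?thesis using age_flow[OF s, of r u x] that by simp
  qed
  then show "alive u x s \<and> alive (age u x s) (shift s x) t" using a t unfolding alive_def by auto
next
  assume a: "alive u x s \<and> alive (age u x s) (shift s x) t"
  have "age u x r < 1" if r: "r \<in> {0..s + t}" for r
  proof (cases "r \<le> s")
    case False
    then show ?thesis using a age_flow[OF s, of "r - s" u x] r unfolding alive_def by auto
  qed (use a r in \<open>auto simp: alive_def\<close>)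
  then show "alive u x (s + t)" unfolding alive_def by blast
qed

lemma alive_antimono: "alive u x t \<Longrightarrow> s \<le> t \<Longrightarrow> alive u x s"
  unfolding alive_def by auto

definition stay :: "real \<Rightarrow> (real \<Rightarrow> nat) \<Rightarrow> bool" where
  "stay t x \<longleftrightarrow> (\<forall>r\<in>{0..t}. x r = 0)"

text \<open>The initial age is remembered until the first exit from 0 and not longer. Different
  initial ages are compared through the single event \<open>stay\<close>.\<close>

lemma age_cases:
  "0 \<le> t \<Longrightarrow> age u x t = (if stay t x then u + t else age 0 x t)"
  unfolding age_eq stay_def by auto

lemma stay_antimono: "stay t x \<Longrightarrow> s \<le> t \<Longrightarrow> stay s x"
  unfolding stay_def by auto

lemma age_stay: "0 \<le> t \<Longrightarrow> stay t x \<Longrightarrow> age u x t = u + t"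
  by (simp add: age_cases)

text \<open>A larger initial age can kill only during the first stay in 0, and it does so exactly
  when this stay reaches the remaining time 1 - u. Every survival event from (0, u) is thereby
  expressed by survival from (0, 0) and the first exit.\<close>

lemma alive_holding:
  assumes "0 \<le> u" "u < 1"
  shows "alive u x t \<longleftrightarrow> alive 0 x t \<and> (stay (1 - u) x \<longrightarrow> t < 1 - u)"
proof
  assume a: "alive u x t"
  have "age 0 x r \<le> age u x r" if "0 \<le> r" for r
    using age_cases[OF that, of u x] age_cases[OF that, of 0 x] assms by auto
  then have "alive 0 x t" using a unfolding alive_def by fastforce
  moreover have False if "stay (1 - u) x" "1 - u \<le> t"
    using a age_stay[OF _ that(1), of u] assms that unfolding alive_def by (force dest: bspec[of _ _ "1 - u"])
  ultimately show "alive 0 x t \<and> (stay (1 - u) x \<longrightarrow> t < 1 - u)" by force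
next
  assume a: "alive 0 x t \<and> (stay (1 - u) x \<longrightarrow> t < 1 - u)"
  have "age u x r < 1" if r: "r \<in> {0..t}" for r
  proof (cases "stay r x")
    case True
    have "r < 1 - u"
    proof (rule ccontr)
      assume "\<not> ?thesis"
      then show False using a stay_antimono[OF True, of "1 - u"] r by auto
    qed
    then show ?thesis using age_stay[OF _ True] r by simp
  next
    case False
    then show ?thesis using age_cases[of r u x] a r unfolding alive_def by auto
  qed
  then show "alive u x t" unfolding alive_def by blast
qed

lemma alive_mono_age: "alive u x t \<Longrightarrow> v \<le> u \<Longrightarrow> alive v x t"
  unfolding alive_def by (metis (no_types, lifting) age_cases add_right_mono atLeastAtMost_iff le_less_trans)

lemma alive_short: "0 \<le> t \<Longrightarrow> 0 \<le> u \<Longrightarrow> u + t < 1 \<Longrightarrow> alive u x t"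
proof -
  assume a: "0 \<le> t" "0 \<le> u" "u + t < 1"
  have "age u x r < 1" if r: "r \<in> {0..t}" for r
  proof -
    have "Sup {q \<in> {0..r}. x q \<noteq> 0} \<ge> 0" if "\<not> (\<forall>q\<in>{0..r}. x q = 0)"
    proof -
      from that obtain q where q: "q \<in> {0..r}" "x q \<noteq> 0" by blast
      then have "q \<le> Sup {q \<in> {0..r}. x q \<noteq> 0}" by (intro cSup_upper) auto
      moreover have "0 \<le> q" using q by simp
      ultimately show ?thesis by simp
    qed
    then have "x r = 0 \<Longrightarrow> \<not> (\<forall>q\<in>{0..r}. x q = 0) \<Longrightarrow> r - Sup {q \<in> {0..r}. x q \<noteq> 0} < 1"
      using a r by force
    then show ?thesis unfolding age_eq using a r by simp
  qed
  then show ?thesis unfolding alive_def by blast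
qed

text \<open>The path may already be in 0 at c itself, so the supremum of the times outside 0 is
  bounded from below by approaching c from the left.\<close>

lemma age_le_since:
  assumes "0 < c" "c \<le> r" "\<And>q. 0 \<le> q \<Longrightarrow> q < c \<Longrightarrow> x q \<noteq> 0"
  shows "age u x r \<le> r - c"
proof -
  have nst: "\<not> (\<forall>q\<in>{0..r}. x q = 0)" using assms by force
  have "c \<le> Sup {q \<in> {0..r}. x q \<noteq> 0}"
  proof (rule dense_le_bounded[of 0 c])
    show "0 < c" by fact
    fix q assume q: "0 < q" "q < c"
    then show "q \<le> Sup {q \<in> {0..r}. x q \<noteq> 0}" using assms by (intro cSup_upper) auto
  qed
  then show ?thesis unfolding age_eq using nst assms by auto
qed

section \<open>First passage times and their level events\<close>

lemma first_time_gt_iff: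
  assumes t: "0 \<le> t" and right: "\<not> A t \<Longrightarrow> \<exists>e>0. \<forall>r\<in>{t..<t+e}. \<not> A r"
  shows "ereal t < first_time A \<longleftrightarrow> (\<forall>r\<in>{0..t}. \<not> A r)"
proof
  assume "ereal t < first_time A"
  moreover have "first_time A \<le> ereal r" if "0 \<le> r" "A r" for r
    unfolding first_time_def by (rule Inf_lower) (use that in auto)
  ultimately have "ereal t < ereal r" if "0 \<le> r" "A r" for r using that less_le_trans by blast
  then show "\<forall>r\<in>{0..t}. \<not> A r" by force
next
  assume n: "\<forall>r\<in>{0..t}. \<not> A r"
  then obtain e where e: "e > 0" "\<forall>r\<in>{t..<t+e}. \<not> A r" using right t by auto
  \<comment> \<open>An infimum of times after t could still equal t; the interval to the right of t
    that is free of \<open>A\<close> keeps it away.\<close>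
  have "ereal (t + e) \<le> first_time A"
    unfolding first_time_def
  proof (rule Inf_greatest)
    fix z assume "z \<in> {ereal t |t. 0 \<le> t \<and> A t}"
    then obtain r where r: "z = ereal r" "0 \<le> r" "A r" by blast
    then have "\<not> r \<le> t" "\<not> (t \<le> r \<and> r < t + e)" using n e(2) by auto
    then show "ereal (t + e) \<le> z" using r by auto
  qed
  moreover have "ereal t < ereal (t + e)" using e by simp
  ultimately show "ereal t < first_time A" by (rule less_le_trans[rotated])
qed

lemma first_time_nonneg: "0 \<le> first_time A"
  unfolding first_time_def by (rule Inf_greatest) auto

lemma first_time_path_gt_iff:
  assumes w: "w \<in> paths S" and t: "0 \<le> t"
  shows "ereal t < first_time (\<lambda>t. \<not> R (w t)) \<longleftrightarrow> (\<forall>r\<in>{0..t}. R (w r))"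
proof -
  obtain e where e: "e > 0" "\<forall>r\<in>{t..<t+e}. w r = w t" using paths_right[OF w t] by blast
  have "\<exists>e>0. \<forall>r\<in>{t..<t+e}. \<not> \<not> R (w r)" if "\<not> \<not> R (w t)"
  proof -
    have "\<not> \<not> R (w r)" if "r \<in> {t..<t+e}" for r using bspec[OF e(2) that] \<open>\<not> \<not> R (w t)\<close> by simp
    then show ?thesis using e(1) by blast
  qed
  from first_time_gt_iff[OF t, of "\<lambda>t. \<not> R (w t)", OF this] show ?thesis by simp
qed

definition exit0 :: "(real \<Rightarrow> nat) \<Rightarrow> ereal" where
  "exit0 w = first_time (\<lambda>t. w t \<noteq> 0)"

lemma exit0_gt_iff: "w \<in> paths S \<Longrightarrow> 0 \<le> t \<Longrightarrow> ereal t < exit0 w \<longleftrightarrow> stay t w"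
  unfolding exit0_def stay_def using first_time_path_gt_iff[of w S t "\<lambda>j. j = 0"] by simp

lemma exit0_nonneg: "0 \<le> exit0 w"
  unfolding exit0_def by (rule first_time_nonneg)

lemma age_right:
  assumes w: "w \<in> paths S" and t: "0 \<le> t"
  obtains e where "e > 0" "\<And>r. t \<le> r \<Longrightarrow> r < t + e \<Longrightarrow> w r = w t \<and> age u w r = (if w t = 0 then age u w t + (r - t) else 0)"
proof -
  obtain e where e: "e > 0" "\<forall>r\<in>{t..<t+e}. w r = w t" using paths_right[OF w t] by blast
  define j where "j = w t"
  have wj: "w r = j" if "t \<le> r" "r < t + e" for r using bspec[OF e(2), of r] that unfolding j_def by simp
  have "age u w r = (if w t = 0 then age u w t + (r - t) else 0)" if r: "t \<le> r" "r < t + e" for r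
  proof (cases "w t = 0")
    case False then show ?thesis using wj[OF r] r unfolding age_eq[of u w r] j_def by simp
  next
    case True
    have "shift t w q = 0" if "q \<in> {0..r - t}" for q
      using wj[of "t + q"] that r True unfolding j_def by simp
    then have "stay (r - t) (shift t w)" unfolding stay_def by blast
    then show ?thesis using age_flow[OF t, of "r - t" u w] age_stay[of "r - t" "shift t w"] r True by auto
  qed
  then show ?thesis using that[of e] e(1) wj unfolding j_def by blast
qed

lemma tau_gt_iff:
  assumes w: "(\<lambda>t\<in>{0..}. x t) \<in> paths S" and t: "0 \<le> t"
  shows "ereal t < first_time (\<lambda>t. \<exists>a\<ge>1. hold_time u x t = Some a) \<longleftrightarrow> alive u x t"
proof -
  let ?w = "\<lambda>t\<in>{0..}. x t"
  have eq: "age u x r = age u ?w r" if "0 \<le> r" for r by (rule age_cong) (use that in auto)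
  have "\<exists>e>0. \<forall>r\<in>{t..<t+e}. \<not> (1 \<le> age u x r)" if "\<not> 1 \<le> age u x t"
  proof -
    obtain e where e: "e > 0" "\<And>r. t \<le> r \<Longrightarrow> r < t + e \<Longrightarrow> ?w r = ?w t \<and> age u ?w r = (if ?w t = 0 then age u ?w t + (r - t) else 0)"
      using age_right[OF w t] by metis
    have "\<not> 1 \<le> age u x r" if r: "r \<in> {t..<t + min e (1 - age u x t)}" for r
    proof -
      have "age u x r = (if ?w t = 0 then age u x t + (r - t) else 0)"
      proof -
        have "t \<le> r" "r < t + e" using r by auto
        then show ?thesis unfolding eq[OF t] using conjunct2[OF e(2)[of r]] eq[of r] t by (simp only:)
      qed
      then show ?thesis using r by (auto split: if_splits)
    qed
    then show ?thesis using e(1) that by (intro exI[of _ "min e (1 - age u x t)"]) auto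
  qed
  then show ?thesis unfolding hold_time_age
    by (subst first_time_gt_iff[OF t]) (auto simp: alive_def not_le)
qed


section \<open>The canonical path space\<close>

definition path_space :: "nat set \<Rightarrow> (real \<Rightarrow> nat) measure" where
  "path_space S = restrict_space (PiM {0..} (\<lambda>_. count_space UNIV)) (paths S)"

lemma space_path_space [simp]: "space (path_space S) = paths S"
  unfolding path_space_def space_restrict_space space_PiM by (auto simp: PiE_def dest: paths_ext)

lemma sets_Collect_path: "Measurable.pred (path_space S) R \<Longrightarrow> {w \<in> paths S. R w} \<in> sets (path_space S)"
  by (simp add: pred_def)

lemma pred_countable_Ball:
  "countable A \<Longrightarrow> (\<And>r. r \<in> A \<Longrightarrow> Measurable.pred M (P r)) \<Longrightarrow> Measurable.pred M (\<lambda>w. \<forall>r\<in>A. P r w)"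
proof -
  assume A: "countable A" and P: "\<And>r. r \<in> A \<Longrightarrow> Measurable.pred M (P r)"
  have "{w \<in> space M. \<forall>r\<in>A. P r w} = space M - (\<Union>r\<in>A. space M - {w \<in> space M. P r w})" by auto
  also have "\<dots> \<in> sets M"
    using A P unfolding pred_def by (intro sets.Diff sets.countable_UN' sets.top) auto
  finally show ?thesis by (simp only: pred_def)
qed

lemma measurable_path_spaceI:
  assumes "\<And>x. x \<in> space N \<Longrightarrow> f x \<in> paths S"
    and "\<And>t. 0 \<le> t \<Longrightarrow> (\<lambda>x. f x t) \<in> N \<rightarrow>\<^sub>M count_space UNIV"
  shows "f \<in> N \<rightarrow>\<^sub>M path_space S"
  unfolding path_space_def
  by (intro measurable_restrict_space2 measurable_PiM_single')
    (use assms paths_ext in \<open>auto simp: PiE_def\<close>)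

lemma measurable_coordinate [measurable]:
  "0 \<le> t \<Longrightarrow> (\<lambda>w. w t) \<in> path_space S \<rightarrow>\<^sub>M count_space UNIV"
  unfolding path_space_def by (intro measurable_restrict_space1 measurable_component_singleton) simp

lemma measurable_shift [measurable]: "0 \<le> s \<Longrightarrow> shift s \<in> path_space S \<rightarrow>\<^sub>M path_space S"
  by (rule measurable_path_spaceI) (auto intro: shift_paths)

lemma measurable_stop [measurable]: "0 \<le> s \<Longrightarrow> stop s \<in> path_space S \<rightarrow>\<^sub>M path_space S"
  by (rule measurable_path_spaceI) (auto intro: stop_paths)

lemma restrict_paths:
  assumes "cadlag {0..} S x" shows "(\<lambda>t\<in>{0..}. x t) \<in> paths S"
proof (rule pathsI)
  note c = assms[unfolded cadlag_nat_iff]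
  show "(\<lambda>t\<in>{0..}. x t) t \<in> S" if "0 \<le> t" for t using c that by simp
  show "\<exists>e>0. \<forall>r\<in>{t..<t+e}. (\<lambda>t\<in>{0..}. x t) r = (\<lambda>t\<in>{0..}. x t) t" if t: "0 \<le> t" for t
  proof -
    obtain e where "e > 0" and e: "\<forall>r\<in>{t..<t+e}. x r = x t" using c t by blast
    have "(\<lambda>t\<in>{0..}. x t) r = (\<lambda>t\<in>{0..}. x t) t" if "r \<in> {t..<t+e}" for r
      using bspec[OF e that] that t by simp
    then show ?thesis using \<open>e > 0\<close> by blast
  qed
  show "\<exists>l\<in>S. \<exists>e>0. e \<le> t \<and> (\<forall>r\<in>{t-e<..<t}. (\<lambda>t\<in>{0..}. x t) r = l)" if t: "0 < t" for t
  proof -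
    obtain l e where le: "l \<in> S" "e > 0" "e \<le> t" and e: "\<forall>r\<in>{t-e<..<t}. x r = l" using c t by blast
    have "(\<lambda>t\<in>{0..}. x t) r = l" if "r \<in> {t-e<..<t}" for r
      using bspec[OF e that] that le(3) by simp
    then show ?thesis using le by blast
  qed
qed simp

text \<open>By right-continuity the value at q < t is also the value at some rational between q and
  t. The right end t has no such rational inside the interval and is tested separately.\<close>

lemma paths_ball_iff_rat:
  assumes w: "w \<in> paths S" and t: "0 \<le> t"
  shows "(\<forall>r\<in>{0..t}. R (w r)) \<longleftrightarrow> R (w t) \<and> (\<forall>r\<in>\<rat> \<inter> {0..t}. R (w r))"
proof
  assume r: "R (w t) \<and> (\<forall>r\<in>\<rat> \<inter> {0..t}. R (w r))"
  have "R (w q)" if q: "q \<in> {0..t}" for q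
  proof (cases "q = t")
    case False
    obtain e where "e > 0" and e: "\<forall>r\<in>{q..<q+e}. w r = w q" using paths_right[OF w, of q] q by auto
    then obtain p where "p \<in> \<rat>" "q < p" "p < min (q + e) t"
      using Rats_dense_in_real[of q "min (q + e) t"] q False by auto
    then show ?thesis using bspec[OF e, of p] bspec[OF conjunct2[OF r], of p] q by auto
  qed (use r in simp)
  then show "\<forall>r\<in>{0..t}. R (w r)" by blast
qed (use t in auto)

lemma pred_paths_ball:
  assumes t: "0 \<le> t"
  shows "Measurable.pred (path_space S) (\<lambda>w. \<forall>r\<in>{0..t}. R (w r))"
proof -
  have R: "Measurable.pred (path_space S) (\<lambda>w. R (w r))" if "0 \<le> r" for r
    by (rule measurable_compose[OF measurable_coordinate[OF that]]) simp
  have "countable (\<rat> \<inter> {0..t})" by (simp add: countable_rat)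
  then have m: "Measurable.pred (path_space S) (\<lambda>w. R (w t) \<and> (\<forall>r\<in>\<rat> \<inter> {0..t}. R (w r)))"
    using t by (intro pred_intros_logic(3) pred_countable_Ball R) auto
  show ?thesis
    by (rule measurable_cong[THEN iffD1, OF _ m]) (use paths_ball_iff_rat[OF _ t] in simp)
qed

lemma pred_stay [measurable]: "0 \<le> t \<Longrightarrow> Measurable.pred (path_space S) (stay t)"
  unfolding stay_def[abs_def] by (rule pred_paths_ball)

lemma borel_measurable_ereal_time:
  assumes "\<And>w. w \<in> space M \<Longrightarrow> 0 \<le> f w"
    and "\<And>t w. 0 \<le> t \<Longrightarrow> w \<in> space M \<Longrightarrow> ereal t < f w \<longleftrightarrow> R t w"
    and "\<And>t. 0 \<le> t \<Longrightarrow> Measurable.pred M (R t)"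
  shows "(f :: 'a \<Rightarrow> ereal) \<in> borel_measurable M"
proof (rule borel_measurableI_greater)
  fix y :: ereal
  consider "y < 0" | r where "y = ereal r" "0 \<le> r" | "y = \<infinity>"
    by (cases y) (auto simp: not_less[symmetric])
  then show "{w \<in> space M. y < f w} \<in> sets M"
  proof cases
    case 1
    then have "{w \<in> space M. y < f w} = space M" using assms(1) less_le_trans by blast
    then show ?thesis by (simp only: sets.top)
  next
    case 2
    then have "{w \<in> space M. y < f w} = {w \<in> space M. R r w}" using assms(2) by auto
    then show ?thesis using assms(3)[OF 2(2)] by (simp only: pred_def)
  qed simp
qed

lemma measurable_exit0 [measurable]: "exit0 \<in> borel_measurable (path_space S)"
  by (rule borel_measurable_ereal_time[where R = stay]) (auto simp: exit0_nonneg exit0_gt_iff pred_stay)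

text \<open>If the path were outside 0 only at time 0, the supremum would be 0 and the age t.
  Right-continuity excludes this, since it moves the point outside 0 to a positive time.\<close>

lemma age0_less:
  assumes w: "w \<in> paths S" and t: "0 < t" and n: "\<not> stay t w"
  shows "age 0 w t < t"
proof (cases "w t = 0")
  case True
  obtain r where r: "0 < r" "r \<le> t" "w r \<noteq> 0"
  proof -
    obtain q where q: "q \<in> {0..t}" "w q \<noteq> 0" using n unfolding stay_def by blast
    obtain e where "e > 0" and e: "\<forall>r\<in>{q..<q+e}. w r = w q" using paths_right[OF w, of q] q by auto
    show thesis
    proof (cases "q = 0")
      case True
      then show thesis using that[of "min (e/2) t"] bspec[OF e, of "min (e/2) t"] q t \<open>e > 0\<close> by auto
    qed (use that[of q] q in auto)
  qed
  have "r \<le> Sup {r \<in> {0..t}. w r \<noteq> 0}" using r by (intro cSup_upper) auto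
  then show ?thesis using age_eq_Sup[of w t 0] True n r unfolding stay_def by simp
qed (use t in \<open>simp add: age_eq\<close>)

text \<open>A supremum over uncountably many times becomes an event of the shifted path, from which
  the measurability of the age follows. The strict inequality in \<open>age0_less\<close> is what
  makes the equivalence exact at the level a.\<close>

lemma age0_ge_iff:
  assumes w: "w \<in> paths S" and a: "0 < a" "a \<le> t"
  shows "a \<le> age 0 w t \<longleftrightarrow> stay a (shift (t - a) w)"
proof -
  have f: "age 0 w t = age (age 0 w (t - a)) (shift (t - a) w) a"
    using age_flow[of "t - a" a 0 w] a by simp
  have p: "shift (t - a) w \<in> paths S" using w a by (intro shift_paths) auto
  show ?thesis
  proof (cases "stay a (shift (t - a) w)")
    case True
    then show ?thesis using f age_stay[of a "shift (t - a) w"] a age_nonneg[of 0 "t - a" w] by simp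
  next
    case False
    then have "age 0 w t = age 0 (shift (t - a) w) a" unfolding f by (subst age_cases) (use a in auto)
    then show ?thesis using False age0_less[OF p a(1) False] by simp
  qed
qed

lemma measurable_age0: "0 \<le> t \<Longrightarrow> (\<lambda>w. age 0 w t) \<in> borel_measurable (path_space S)"
proof -
  assume t: "0 \<le> t"
  have "{w \<in> space (path_space S). a \<le> age 0 w t} \<in> sets (path_space S)" for a
  proof -
    consider "a \<le> 0" | "0 < a" "a \<le> t" | "t < a" by linarith
    then show ?thesis
    proof cases
      case 1
      then have "{w \<in> space (path_space S). a \<le> age 0 w t} = space (path_space S)"
        using age_nonneg[of 0 t] t order_trans by fastforce
      then show ?thesis by (simp only: sets.top)
    next
      case 2
      then have "{w \<in> space (path_space S). a \<le> age 0 w t} = {w \<in> paths S. stay a (shift (t - a) w)}"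
        using age0_ge_iff by auto
      moreover have "Measurable.pred (path_space S) (\<lambda>w. stay a (shift (t - a) w))"
        by (rule measurable_compose[OF measurable_shift pred_stay]) (use 2 in auto)
      ultimately show ?thesis by (simp only: sets_Collect_path)
    next
      case 3
      have "age 0 w t \<le> t" if "w \<in> paths S" for w
        using age0_less[OF that, of t] age_stay[of t w 0] t
        by (cases "t = 0"; cases "stay t w") (auto simp: age_eq stay_def)
      then have "{w \<in> space (path_space S). a \<le> age 0 w t} = {}" using 3 by fastforce
      then show ?thesis by (simp only: sets.empty_sets)
    qed
  qed
  then show ?thesis unfolding borel_measurable_iff_ge by blast
qed

lemma measurable_age_pair [measurable]:
  "0 \<le> t \<Longrightarrow> (\<lambda>(u, w). age u w t) \<in> borel_measurable (borel \<Otimes>\<^sub>M path_space S)"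
proof -
  assume t: "0 \<le> t"
  note [measurable] = measurable_age0[OF t] pred_stay[OF t]
  have "(\<lambda>(u, w). if stay t w then u + t else age 0 w t) \<in> borel_measurable (borel \<Otimes>\<^sub>M path_space S)"
    by measurable
  also have "(\<lambda>(u, w). if stay t w then u + t else age 0 w t) = (\<lambda>(u, w). age u w t)"
    using age_cases[OF t] by (intro ext) (auto split: prod.split)
  finally show ?thesis .
qed

lemma measurable_age [measurable]: "0 \<le> t \<Longrightarrow> (\<lambda>w. age u w t) \<in> borel_measurable (path_space S)"
  using measurable_compose[OF measurable_Pair1'[of u borel "path_space S"] measurable_age_pair] by simp

text \<open>Immediately to the right of r the age does not drop below its value at r, so an age of
  at least 1 at some r < t would show at a rational time as well.\<close>

lemma alive_iff_rat:
  assumes w: "w \<in> paths S"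
  shows "alive u w t \<longleftrightarrow> (\<forall>r\<in>insert t \<rat> \<inter> {0..t}. age u w r < 1)"
proof
  assume a: "\<forall>r\<in>insert t \<rat> \<inter> {0..t}. age u w r < 1"
  have "age u w r < 1" if r: "r \<in> {0..t}" for r
  proof (cases "r = t")
    case False
    have "0 \<le> r" using r by simp
    then obtain e where "e > 0" and e: "\<And>q. r \<le> q \<Longrightarrow> q < r + e \<Longrightarrow> w q = w r \<and> age u w q = (if w r = 0 then age u w r + (q - r) else 0)"
      using age_right[OF w, of r u] by metis
    then obtain p where p: "p \<in> \<rat>" "r < p" "p < min (r + e) t"
      using Rats_dense_in_real[of r "min (r + e) t"] r False by auto
    then have "age u w p < 1" using a r by auto
    moreover have "age u w p = (if w r = 0 then age u w r + (p - r) else 0)" using e[of p] p by auto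
    ultimately show ?thesis using p by (auto simp: age_eq[of u w r] split: if_splits)
  qed (use a r in auto)
  then show "alive u w t" unfolding alive_def by blast
qed (auto simp: alive_def)

lemma pred_alive0: "Measurable.pred (path_space S) (\<lambda>w. alive 0 w t)"
proof -
  have "countable (insert t \<rat> \<inter> {0..t})" by (simp add: countable_rat countable_Int1)
  then have "Measurable.pred (path_space S) (\<lambda>w. \<forall>r\<in>insert t \<rat> \<inter> {0..t}. age 0 w r < 1)"
    by (rule pred_countable_Ball) (intro borel_measurable_pred_less measurable_age borel_measurable_const, auto)
  moreover have "alive 0 w t \<longleftrightarrow> (\<forall>r\<in>insert t \<rat> \<inter> {0..t}. age 0 w r < 1)" if "w \<in> space (path_space S)" for w
    using alive_iff_rat that by simp
  ultimately show ?thesis by (simp only: measurable_cong[of "path_space S" "\<lambda>w. alive 0 w t"])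
qed

text \<open>The event \<open>stay (1 - u)\<close> tests a time that varies with u. Comparing the
  random variable \<open>exit0\<close> with 1 - u instead gives joint measurability in u and the
  path.\<close>

lemma alive_exit0:
  assumes "w \<in> paths S" "0 \<le> u" "u < 1"
  shows "alive u w t \<longleftrightarrow> alive 0 w t \<and> (ereal (1 - u) < exit0 w \<longrightarrow> t < 1 - u)"
  using alive_holding[OF assms(2,3)] exit0_gt_iff[OF assms(1), of "1 - u"] assms by simp

lemma pred_alive_pair: 
  "Measurable.pred (borel \<Otimes>\<^sub>M path_space S) (\<lambda>(u, w). alive 0 w t \<and> (ereal (1 - u) < exit0 w \<longrightarrow> t < 1 - u))"
proof -
  note [measurable] = pred_alive0
  show ?thesis by measurable
qed

lemma pred_alive [measurable]:
  assumes "u \<in> {0..<1}"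
  shows "Measurable.pred (path_space S) (\<lambda>w. alive u w t)"
proof -
  note [measurable] = pred_alive0
  have "Measurable.pred (path_space S) (\<lambda>w. alive 0 w t \<and> (ereal (1 - u) < exit0 w \<longrightarrow> t < 1 - u))"
    by measurable
  moreover have "alive u w t \<longleftrightarrow> alive 0 w t \<and> (ereal (1 - u) < exit0 w \<longrightarrow> t < 1 - u)" if "w \<in> space (path_space S)" for w
    using alive_exit0[of w S u t] assms that by simp
  ultimately show ?thesis by (simp only: measurable_cong[of "path_space S" "\<lambda>w. alive u w t"])
qed

section \<open>The Markov property\<close>

definition cylinder :: "nat set \<Rightarrow> real set \<Rightarrow> (real \<Rightarrow> nat) \<Rightarrow> (real \<Rightarrow> nat) set" where
  "cylinder S I v = {w \<in> paths S. \<forall>t\<in>I. w t = v t}"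

text \<open>Indexing by a reference path rather than by a vector of values makes stability under
  intersection immediate: two cylinders meet in a cylinder around any common path, or in
  \<open>{}\<close>, which is added for this reason.\<close>

definition cylinders :: "nat set \<Rightarrow> (real \<Rightarrow> nat) set set" where
  "cylinders S = insert {} {cylinder S I v | I v. finite I \<and> I \<subseteq> {0..} \<and> v \<in> paths S}"

lemma Int_stable_cylinders: "Int_stable (cylinders S)"
proof (rule Int_stableI)
  fix a b assume ab: "a \<in> cylinders S" "b \<in> cylinders S"
  show "a \<inter> b \<in> cylinders S"
  proof (cases "a \<inter> b = {}")
    case False
    then obtain w where w: "w \<in> a" "w \<in> b" by blast
    obtain I v J u where a: "a = cylinder S I v" "finite I" "I \<subseteq> {0..}" and b: "b = cylinder S J u" "finite J" "J \<subseteq> {0..}"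
      using ab w unfolding cylinders_def by blast
    have "a \<inter> b = cylinder S (I \<union> J) w" using w unfolding a(1) b(1) cylinder_def by auto
    moreover have "w \<in> paths S" using w unfolding a(1) cylinder_def by simp
    moreover have "finite (I \<union> J)" "I \<union> J \<subseteq> {0..}" using a b by auto
    ultimately show ?thesis unfolding cylinders_def by blast
  qed (simp add: cylinders_def)
qed

lemma sets_cylinder: "finite I \<Longrightarrow> I \<subseteq> {0..} \<Longrightarrow> cylinder S I v \<in> sets (path_space S)"
proof -
  assume I: "finite I" "I \<subseteq> {0..}"
  have "Measurable.pred (path_space S) (\<lambda>w. \<forall>t\<in>I. w t = v t)"
    using I by (intro pred_intros_finite(3) pred_count_space_const1 measurable_coordinate) auto
  then show ?thesis unfolding cylinder_def by (rule sets_Collect_path)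
qed

lemma sets_path_space: "sets (path_space S) = sigma_sets (paths S) (cylinders S)"
proof
  interpret sigma_algebra "paths S" "sigma_sets (paths S) (cylinders S)"
    by (rule sigma_algebra_sigma_sets) (auto simp: cylinders_def cylinder_def)
  let ?N = "sigma (paths S) (cylinders S)"
  have sp: "space ?N = paths S" "sets ?N = sigma_sets (paths S) (cylinders S)"
    by (auto simp: cylinders_def cylinder_def intro!: space_measure_of sets_measure_of)
  have "(\<lambda>w. w t) \<in> ?N \<rightarrow>\<^sub>M count_space UNIV" if t: "0 \<le> t" for t
  proof -
    have "(\<lambda>w. w t) -` {a} \<inter> space ?N \<in> sets ?N" for a
    proof (cases "\<exists>v\<in>paths S. v t = a")
      case True
      then obtain v where v: "v \<in> paths S" "v t = a" by blast
      have "(\<lambda>w. w t) -` {a} \<inter> space ?N = cylinder S {t} v" using v unfolding cylinder_def sp by auto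
      moreover have "cylinder S {t} v \<in> cylinders S" using t v unfolding cylinders_def by blast
      ultimately show ?thesis unfolding sp by auto
    next
      case False
      then have "(\<lambda>w. w t) -` {a} \<inter> space ?N = {}" unfolding sp by auto
      then show ?thesis by (simp only: sets.empty_sets)
    qed
    then show ?thesis by (simp add: measurable_count_space_eq2_countable)
  qed
  then have id: "(\<lambda>w. w) \<in> ?N \<rightarrow>\<^sub>M path_space S" by (intro measurable_path_spaceI) (auto simp: sp)
  show "sets (path_space S) \<subseteq> sigma_sets (paths S) (cylinders S)"
  proof
    fix A assume A: "A \<in> sets (path_space S)"
    from id this have "(\<lambda>w. w) -` A \<inter> space ?N \<in> sets ?N" by (rule measurable_sets)
    moreover have "A \<subseteq> paths S" using sets.sets_into_space[OF A] by simp
    ultimately show "A \<in> sigma_sets (paths S) (cylinders S)" unfolding sp by (simp add: Int_absorb2)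
  qed
  show "sigma_sets (paths S) (cylinders S) \<subseteq> sets (path_space S)"
    using sets.sigma_sets_subset[of "cylinders S" "path_space S"] sets_cylinder[of _ S]
    unfolding cylinders_def by auto
qed

lemma path_measure_eqI:
  assumes "sets M = sets (path_space S)" "sets N = sets (path_space S)" "finite_measure M"
    and eq: "\<And>I v. finite I \<Longrightarrow> I \<subseteq> {0..} \<Longrightarrow> v \<in> paths S \<Longrightarrow>
      emeasure M (cylinder S I v) = emeasure N (cylinder S I v)"
  shows "M = N"
proof (cases "paths S = {}")
  case True
  then have "space M = {}" "space N = {}" using assms(1,2) by (metis sets_eq_imp_space_eq space_path_space)+
  then show ?thesis using space_empty[of M] space_empty[of N] by simp
next
  case False
  then obtain v where v: "v \<in> paths S" by blast
  have top: "cylinder S {} v = paths S" unfolding cylinder_def by simp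
  interpret M: finite_measure M by fact
  show ?thesis
  proof (rule measure_eqI_generator_eq[OF Int_stable_cylinders, where \<Omega> = "paths S" and A = "\<lambda>_. paths S"])
    show "cylinders S \<subseteq> Pow (paths S)" unfolding cylinders_def cylinder_def by auto
    show "emeasure M X = emeasure N X" if "X \<in> cylinders S" for X
      using that eq unfolding cylinders_def by auto
    have "paths S \<in> cylinders S" using v top unfolding cylinders_def by blast
    then show "range (\<lambda>_::nat. paths S) \<subseteq> cylinders S" by blast
  qed (use assms(1,2) sets_path_space in auto)
qed

context markov_chain
begin

lemma zero_state: "0 \<in> S"
  using state_space by auto

text \<open>Values outside of \<open>S\<close> are replaced by the state \<open>0\<close>, so that all \<open>Q j\<close> are probability measures.\<close>

definition Q :: "nat \<Rightarrow> (real \<Rightarrow> nat) measure" where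
  "Q j = distr (P (if j \<in> S then j else 0)) (path_space S) (\<lambda>\<omega>. \<lambda>t\<in>{0..}. X t \<omega>)"

lemma measurable_path: "i \<in> S \<Longrightarrow> (\<lambda>\<omega>. \<lambda>t\<in>{0..}. X t \<omega>) \<in> P i \<rightarrow>\<^sub>M path_space S"
  by (rule measurable_path_spaceI) (auto intro: restrict_paths cadlag_X measurable_X)

lemma Q_eq: "i \<in> S \<Longrightarrow> Q i = distr (P i) (path_space S) (\<lambda>\<omega>. \<lambda>t\<in>{0..}. X t \<omega>)"
  unfolding Q_def by simp

lemma prob_space_Q: "prob_space (Q j)"
  unfolding Q_def using zero_state
  by (intro prob_space.prob_space_distr prob_space_P measurable_path) auto

lemma sets_Q [simp, measurable_cong]: "sets (Q j) = sets (path_space S)"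
  and space_Q [simp]: "space (Q j) = paths S"
  unfolding Q_def by auto

lemma AE_start: "j \<in> S \<Longrightarrow> AE w in Q j. w 0 = j"
proof -
  assume j: "j \<in> S"
  have "Measurable.pred (path_space S) (\<lambda>w. w 0 = j)"
    by (rule pred_count_space_const1[OF measurable_coordinate]) simp
  then have "{w \<in> space (path_space S). w 0 = j} \<in> sets (path_space S)" by (simp add: pred_def)
  then have "{w \<in> space (path_space S). w 0 = j} \<in> sets (path_space S)" by simp
  from AE_distr_iff[OF measurable_path[OF j] this] show ?thesis
    using start_X[OF j] unfolding Q_eq[OF j] by simp
qed

lemma prod_split_lessThan: "(\<Prod>k<n + m. g k) = (\<Prod>k<n. g k) * (\<Prod>k<m. g (n + k))" for g :: "nat \<Rightarrow> 'b::comm_monoid_mult"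
  by (induction m) (simp_all add: mult.assoc)

text \<open>By \<open>markov\<close> all three probabilities are products of transition
  probabilities. Since s is the last time in \<open>I\<close> and 0 the first in \<open>J\<close>,
  the two sorted lists of times join at s and the long product factors there.\<close>

lemma cylinder_prob:
  assumes i: "i \<in> S" and s: "0 \<le> s"
    and I: "finite I" "I \<subseteq> {0..s}" "0 \<in> I" "s \<in> I" and J: "finite J" "J \<subseteq> {0..}" "0 \<in> J"
    and a: "a 0 = i" "a s = b 0" "a ` I \<subseteq> S" "b ` J \<subseteq> S"
  shows "measure (P i) {\<omega> \<in> space (P i). (\<forall>t\<in>I. X t \<omega> = a t) \<and> (\<forall>t\<in>J. X (s + t) \<omega> = b t)} =
    measure (P i) {\<omega> \<in> space (P i). \<forall>t\<in>I. X t \<omega> = a t} *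
    measure (P (b 0)) {\<omega> \<in> space (P (b 0)). \<forall>t\<in>J. X t \<omega> = b t}"
proof -
  define L M n m where "L = sorted_list_of_set I" and "M = sorted_list_of_set J"
    and "n = length L - 1" and "m = length M - 1"
  have L: "set L = I" "sorted L" "L \<noteq> []" and M: "set M = J" "sorted M" "M \<noteq> []"
    using I J unfolding L_def M_def by auto
  have len: "length L = Suc n" "length M = Suc m" using L(3) M(3) unfolding n_def m_def by (cases L; cases M; simp)+
  have Lm: "L ! k \<le> L ! l" if "k \<le> l" "l \<le> n" for k l using sorted_nth_mono[OF L(2) that(1)] that len by simp
  have Mm: "M ! k \<le> M ! l" if "k \<le> l" "l \<le> m" for k l using sorted_nth_mono[OF M(2) that(1)] that len by simp
  have allL: "(\<forall>t\<in>I. R t) \<longleftrightarrow> (\<forall>k\<le>n. R (L ! k))" for R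
    unfolding L(1)[symmetric] all_set_conv_all_nth len less_Suc_eq_le ..
  have allM: "(\<forall>t\<in>J. R t) \<longleftrightarrow> (\<forall>k\<le>m. R (M ! k))" for R
    unfolding M(1)[symmetric] all_set_conv_all_nth len less_Suc_eq_le ..
  have "\<forall>k\<le>n. L ! k \<in> I" "\<forall>k\<le>m. M ! k \<in> J" using allL[of "\<lambda>t. t \<in> I"] allM[of "\<lambda>t. t \<in> J"] by blast+
  then have LI: "\<And>k. k \<le> n \<Longrightarrow> L ! k \<in> I" and MJ: "\<And>k. k \<le> m \<Longrightarrow> M ! k \<in> J" by blast+
  have L0: "L ! 0 = 0"
  proof -
    obtain k where "k \<le> n" "L ! k = 0" using I(3) allL[of "\<lambda>t. t \<noteq> 0"] by blast
    then show ?thesis using Lm[of 0 k] LI[of 0] I(2) by fastforce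
  qed
  have Ln: "L ! n = s"
  proof -
    obtain k where "k \<le> n" "L ! k = s" using I(4) allL[of "\<lambda>t. t \<noteq> s"] by blast
    then show ?thesis using Lm[of k n] LI[of n] I(2) by fastforce
  qed
  have M0: "M ! 0 = 0"
  proof -
    obtain k where "k \<le> m" "M ! k = 0" using J(3) allM[of "\<lambda>t. t \<noteq> 0"] by blast
    then show ?thesis using Mm[of 0 k] MJ[of 0] J(2) by fastforce
  qed
  \<comment> \<open>The index n belongs to both lists: \<open>L ! n\<close> and
    \<open>s + M ! 0\<close> are both s, and the prescribed states agree there because
    \<open>a s = b 0\<close>.\<close>
  define t where "t k = (if k \<le> n then L ! k else s + M ! (k - n))" for k
  define j where "j k = (if k \<le> n then a (L ! k) else b (M ! (k - n)))" for k
  have tj: "t (n + k) = s + M ! k" "j (n + k) = b (M ! k)" for k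
    using Ln M0 a(2) unfolding t_def j_def by auto
  have t_mono: "t k \<le> t (Suc k)" if "k < n + m" for k
  proof (cases "k < n")
    case True then show ?thesis unfolding t_def using Lm[of k "Suc k"] by simp
  next
    case False
    then obtain l where l: "k = n + l" using le_Suc_ex not_less by blast
    then have "Suc k = n + Suc l" by simp
    then show ?thesis unfolding l tj using that l Mm[of l "Suc l"] by (simp only: tj) simp
  qed
  have jS: "j k \<in> S" if "k \<le> n + m" for k
    unfolding j_def using that LI MJ a(3,4) by (auto simp: image_subset_iff)
  have split: "(\<forall>k\<le>n + m. R k) \<longleftrightarrow> (\<forall>k\<le>n. R k) \<and> (\<forall>k\<le>m. R (n + k))" for R
    by (metis add_le_cancel_left le_Suc_ex linorder_linear trans_le_add1)
  have "measure (P i) {\<omega> \<in> space (P i). (\<forall>t\<in>I. X t \<omega> = a t) \<and> (\<forall>t\<in>J. X (s + t) \<omega> = b t)}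
    = measure (P i) {\<omega> \<in> space (P i). \<forall>k\<le>n + m. X (t k) \<omega> = j k}"
    unfolding split allL allM tj by (simp add: t_def j_def)
  also have "\<dots> = (\<Prod>k<n + m. trans_prob P X (t (Suc k) - t k) (j k) (j (Suc k)))"
  proof (rule markov[OF i])
    show "t 0 = 0" "j 0 = i" using L0 a(1) by (simp_all add: t_def j_def)
    show "\<forall>k<n + m. t k \<le> t (Suc k)" "\<forall>k\<le>n + m. j k \<in> S" using t_mono jS by auto
  qed
  also have "\<dots> = (\<Prod>k<n. trans_prob P X (t (Suc k) - t k) (j k) (j (Suc k))) *
      (\<Prod>k<m. trans_prob P X (t (Suc (n + k)) - t (n + k)) (j (n + k)) (j (Suc (n + k))))"
    by (rule prod_split_lessThan)
  also have "(\<Prod>k<n. trans_prob P X (t (Suc k) - t k) (j k) (j (Suc k))) =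
      measure (P i) {\<omega> \<in> space (P i). \<forall>k\<le>n. X (t k) \<omega> = j k}"
  proof (rule markov[OF i, symmetric])
    show "t 0 = 0" "j 0 = i" using L0 a(1) by (simp_all add: t_def j_def)
    show "\<forall>k<n. t k \<le> t (Suc k)" "\<forall>k\<le>n. j k \<in> S" using t_mono jS by auto
  qed
  also have "{\<omega> \<in> space (P i). \<forall>k\<le>n. X (t k) \<omega> = j k} = {\<omega> \<in> space (P i). \<forall>t\<in>I. X t \<omega> = a t}"
    unfolding allL by (simp add: t_def j_def)
  also have "(\<Prod>k<m. trans_prob P X (t (Suc (n + k)) - t (n + k)) (j (n + k)) (j (Suc (n + k)))) =
     (\<Prod>k<m. trans_prob P X (M ! Suc k - M ! k) (b (M ! k)) (b (M ! Suc k)))"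
    by (simp only: add_Suc_right[symmetric] tj) simp
  also have "\<dots> = measure (P (b 0)) {\<omega> \<in> space (P (b 0)). \<forall>k\<le>m. X (M ! k) \<omega> = b (M ! k)}"
    by (rule markov[symmetric]) (use M0 Mm MJ a(4) J(3) in \<open>auto simp: image_subset_iff\<close>)
  also have "{\<omega> \<in> space (P (b 0)). \<forall>k\<le>m. X (M ! k) \<omega> = b (M ! k)} = {\<omega> \<in> space (P (b 0)). \<forall>t\<in>J. X t \<omega> = b t}"
    unfolding allM ..
  finally show ?thesis .
qed

lemma Q_Collect:
  assumes "i \<in> S" "{w \<in> paths S. R w} \<in> sets (path_space S)"
  shows "measure (Q i) {w \<in> paths S. R w} = measure (P i) {\<omega> \<in> space (P i). R (\<lambda>t\<in>{0..}. X t \<omega>)}"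
proof -
  have "(\<lambda>\<omega>. \<lambda>t\<in>{0..}. X t \<omega>) -` {w \<in> paths S. R w} \<inter> space (P i) = {\<omega> \<in> space (P i). R (\<lambda>t\<in>{0..}. X t \<omega>)}"
    using restrict_paths cadlag_X[OF assms(1)] by auto
  then show ?thesis using assms by (simp add: Q_eq measure_distr measurable_path)
qed

text \<open>The time sets need not contain the times 0 and s that \<open>cylinder_prob\<close> asks
  for. The time 0 is added because the start is almost surely fixed, the time s because
  \<open>w s = j\<close> is part of the event. The prescribed values are read off from paths
  \<open>w1\<close> and \<open>w2\<close> realising the past and the future event; if one of them
  does not exist, both sides are 0.\<close>

lemma markov_cylinder:
  assumes i: "i \<in> S" and j: "j \<in> S" and s: "0 \<le> s"
    and I: "finite I" "I \<subseteq> {0..}" and J: "finite J" "J \<subseteq> {0..}"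
  shows "measure (Q i) {w \<in> paths S. stop s w \<in> cylinder S I v \<and> w s = j \<and> shift s w \<in> cylinder S J u} =
    measure (Q i) {w \<in> paths S. stop s w \<in> cylinder S I v \<and> w s = j} * measure (Q j) (cylinder S J u)"
proof -
  interpret Qi: prob_space "Q i" by (rule prob_space_Q)
  interpret Qj: prob_space "Q j" by (rule prob_space_Q)
  note [measurable] = sets_cylinder[OF I] sets_cylinder[OF J] measurable_stop[OF s] measurable_shift[OF s] 
    measurable_coordinate[OF s] measurable_coordinate[OF order_refl]
  have [measurable]: "Measurable.pred (path_space S) (\<lambda>w. stop s w \<in> cylinder S I v)"
    "Measurable.pred (path_space S) (\<lambda>w. shift s w \<in> cylinder S J u)"
    "Measurable.pred (path_space S) (\<lambda>w. w \<in> cylinder S J u)"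
    by measurable
  have A1: "measure (Q i) {w \<in> paths S. R w} = measure (Q i) {w \<in> paths S. R w \<and> w 0 = i}"
    if [measurable]: "Measurable.pred (path_space S) R" for R
  proof (rule Qi.finite_measure_eq_AE)
    show "AE w in Q i. (w \<in> {w \<in> paths S. R w}) = (w \<in> {w \<in> paths S. R w \<and> w 0 = i})"
      using AE_start[OF i] by eventually_elim auto
  qed (auto simp: sets_Collect_path)
  let ?E1 = "\<lambda>w. (stop s w \<in> cylinder S I v \<and> w s = j) \<and> w 0 = i"
  let ?E2 = "\<lambda>w. shift s w \<in> cylinder S J u"
  have L: "measure (Q i) {w \<in> paths S. stop s w \<in> cylinder S I v \<and> w s = j \<and> ?E2 w} =
      measure (Q i) {w \<in> paths S. ?E1 w \<and> ?E2 w}"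
    using A1[of "\<lambda>w. stop s w \<in> cylinder S I v \<and> w s = j \<and> ?E2 w"] by (simp add: conj_ac)
  have R: "measure (Q i) {w \<in> paths S. stop s w \<in> cylinder S I v \<and> w s = j} =
      measure (Q i) {w \<in> paths S. ?E1 w}"
    using A1[of "\<lambda>w. stop s w \<in> cylinder S I v \<and> w s = j"] by simp
  have A2: "measure (Q j) (cylinder S J u) = measure (Q j) {w \<in> paths S. w \<in> cylinder S J u \<and> w 0 = j}"
  proof (rule Qj.finite_measure_eq_AE)
    show "AE w in Q j. (w \<in> cylinder S J u) = (w \<in> {w \<in> paths S. w \<in> cylinder S J u \<and> w 0 = j})"
      using AE_start[OF j] by eventually_elim (auto simp: cylinder_def)
  qed (simp_all add: sets_cylinder[OF J] sets_Collect_path)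
  show ?thesis
  proof (cases "\<exists>w\<in>paths S. ?E1 w")
    case False
    then have "{w \<in> paths S. ?E1 w \<and> ?E2 w} = {}" "{w \<in> paths S. ?E1 w} = {}" by blast+
    then show ?thesis unfolding L R by (simp only: measure_empty mult_zero_left)
  next
    case True
    then obtain w1 where w1: "w1 \<in> paths S" "?E1 w1" by blast
    show ?thesis
    proof (cases "\<exists>w\<in>paths S. w \<in> cylinder S J u \<and> w 0 = j")
      case False
      then have e: "{w \<in> paths S. w \<in> cylinder S J u \<and> w 0 = j} = {}" by blast
      have "shift s w \<in> paths S" "shift s w 0 = w s" if "w \<in> paths S" for w using shift_paths[OF that s] by auto
      then have "{w \<in> paths S. stop s w \<in> cylinder S I v \<and> w s = j \<and> ?E2 w} = {}" using e by fastforce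
      then show ?thesis unfolding A2 e by (simp only: measure_empty mult_zero_right)
    next
      case True
      then obtain w2 where w2: "w2 \<in> paths S" "w2 \<in> cylinder S J u" "w2 0 = j" by blast
      define I1 where "I1 = insert 0 (insert s ((\<lambda>t. min t s) ` I))"
      define J1 where "J1 = insert 0 J"
      have I1: "finite I1" "I1 \<subseteq> {0..s}" "0 \<in> I1" "s \<in> I1" and J1: "finite J1" "J1 \<subseteq> {0..}" "0 \<in> J1"
        using I J s unfolding I1_def J1_def by auto
      have st: "stop s w \<in> cylinder S I v \<longleftrightarrow> (\<forall>t\<in>I. w (min t s) = v t)" if "w \<in> paths S" for w
        using stop_paths[OF that s] I unfolding cylinder_def by (auto simp: subset_iff)
      have e1: "?E1 w \<longleftrightarrow> (\<forall>t\<in>I1. w t = w1 t)" if "w \<in> paths S" for w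
        using w1 st[OF that] st[OF w1(1)] unfolding I1_def by auto
      have e2: "w s = j \<and> ?E2 w \<longleftrightarrow> (\<forall>t\<in>J1. w (s + t) = w2 t)" if "w \<in> paths S" for w
        using w2 shift_paths[OF that s] J unfolding J1_def cylinder_def by (auto simp: subset_iff)
      have e3: "w \<in> cylinder S J u \<and> w 0 = j \<longleftrightarrow> (\<forall>t\<in>J1. w t = w2 t)" if "w \<in> paths S" for w
        using w2 that unfolding J1_def cylinder_def by auto
      have pI: "Measurable.pred (path_space S) (\<lambda>w. \<forall>t\<in>I1. w t = w1 t)"
        using I1 by (intro pred_intros_finite(3) pred_count_space_const1 measurable_coordinate) auto
      have pJ: "Measurable.pred (path_space S) (\<lambda>w. \<forall>t\<in>J1. w t = w2 t)"
        using J1 by (intro pred_intros_finite(3) pred_count_space_const1 measurable_coordinate) auto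
      have pJ': "Measurable.pred (path_space S) (\<lambda>w. \<forall>t\<in>J1. w (s + t) = w2 t)"
        using J1 s by (intro pred_intros_finite(3) pred_count_space_const1 measurable_coordinate) auto
      have pIJ: "Measurable.pred (path_space S) (\<lambda>w. (\<forall>t\<in>I1. w t = w1 t) \<and> (\<forall>t\<in>J1. w (s + t) = w2 t))"
        using pI pJ' by (rule pred_intros_logic)
      have rI: "(\<forall>t\<in>I1. (\<lambda>t\<in>{0..}. X t \<omega>) t = w1 t) \<longleftrightarrow> (\<forall>t\<in>I1. X t \<omega> = w1 t)"
        and rJ: "(\<forall>t\<in>J1. (\<lambda>t\<in>{0..}. X t \<omega>) t = w2 t) \<longleftrightarrow> (\<forall>t\<in>J1. X t \<omega> = w2 t)"
        and rJ': "(\<forall>t\<in>J1. (\<lambda>t\<in>{0..}. X t \<omega>) (s + t) = w2 t) \<longleftrightarrow> (\<forall>t\<in>J1. X (s + t) \<omega> = w2 t)" for \<omega>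
        using I1(2) J1(2) s by (auto simp: subset_iff)
      have "measure (Q i) {w \<in> paths S. ?E1 w \<and> ?E2 w} = measure (Q i) {w \<in> paths S. (\<forall>t\<in>I1. w t = w1 t) \<and> (\<forall>t\<in>J1. w (s + t) = w2 t)}"
        by (rule arg_cong[of _ _ "measure (Q i)"], rule Collect_cong) (use e1 e2 in blast)
      also have "\<dots> = measure (P i) {\<omega> \<in> space (P i). (\<forall>t\<in>I1. X t \<omega> = w1 t) \<and> (\<forall>t\<in>J1. X (s + t) \<omega> = w2 t)}"
        unfolding Q_Collect[OF i sets_Collect_path[OF pIJ]] rI rJ' ..
      also have "\<dots> = measure (P i) {\<omega> \<in> space (P i). \<forall>t\<in>I1. X t \<omega> = w1 t} *
          measure (P (w2 0)) {\<omega> \<in> space (P (w2 0)). \<forall>t\<in>J1. X t \<omega> = w2 t}"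
        by (rule cylinder_prob[OF i s I1 J1]) (use w1 w2 I1 J1 paths_state in \<open>auto simp: image_subset_iff subset_iff\<close>)
      also have "measure (P i) {\<omega> \<in> space (P i). \<forall>t\<in>I1. X t \<omega> = w1 t} = measure (Q i) {w \<in> paths S. \<forall>t\<in>I1. w t = w1 t}"
        unfolding Q_Collect[OF i sets_Collect_path[OF pI]] rI ..
      also have "{w \<in> paths S. \<forall>t\<in>I1. w t = w1 t} = {w \<in> paths S. ?E1 w}"
        by (rule Collect_cong) (use e1 in blast)
      also have "measure (P (w2 0)) {\<omega> \<in> space (P (w2 0)). \<forall>t\<in>J1. X t \<omega> = w2 t} = measure (Q j) {w \<in> paths S. \<forall>t\<in>J1. w t = w2 t}"
        unfolding w2(3) Q_Collect[OF j sets_Collect_path[OF pJ]] rJ ..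
      also have "{w \<in> paths S. \<forall>t\<in>J1. w t = w2 t} = {w \<in> paths S. w \<in> cylinder S J u \<and> w 0 = j}"
        by (rule Collect_cong) (use e3 in blast)
      finally show ?thesis unfolding L R A2 .
    qed
  qed
qed

text \<open>The extension from cylinders takes two rounds. With A a fixed cylinder, both sides are
  finite measures in B that agree on cylinders; with B then arbitrary but fixed, the same holds for
  them as measures in A.\<close>

lemma markov_event:
  assumes i: "i \<in> S" and j: "j \<in> S" and s: "0 \<le> s"
    and A: "A \<in> sets (path_space S)" and B: "B \<in> sets (path_space S)"
  shows "emeasure (Q i) {w \<in> paths S. stop s w \<in> A \<and> w s = j \<and> shift s w \<in> B} =
    emeasure (Q i) {w \<in> paths S. stop s w \<in> A \<and> w s = j} * emeasure (Q j) B"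
proof -
  interpret Qi: prob_space "Q i" by (rule prob_space_Q)
  interpret Qj: prob_space "Q j" by (rule prob_space_Q)
  note [measurable] = measurable_stop[OF s] measurable_shift[OF s] measurable_coordinate[OF s]
  define D where "D R = density (Q i) (indicator {w \<in> paths S. R w \<and> w s = j})" for R
  have emD: "emeasure (distr (D R) (path_space S) f) C = emeasure (Q i) {w \<in> paths S. R w \<and> w s = j \<and> f w \<in> C}"
    if R: "Measurable.pred (path_space S) R" and f: "f \<in> path_space S \<rightarrow>\<^sub>M path_space S" and C: "C \<in> sets (path_space S)" for R f C
  proof -
    note [measurable] = R f C
    have m1: "{w \<in> paths S. R w \<and> w s = j} \<in> sets (path_space S)" by (rule sets_Collect_path) measurable
    have m2: "{w \<in> paths S. f w \<in> C} \<in> sets (path_space S)" by (rule sets_Collect_path) measurable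
    have "emeasure (distr (D R) (path_space S) f) C = emeasure (D R) {w \<in> paths S. f w \<in> C}"
      unfolding D_def by (subst emeasure_distr) (auto intro!: arg_cong2[of _ _ _ _ emeasure] f C)
    also have "\<dots> = (\<integral>\<^sup>+w. indicator {w \<in> paths S. R w \<and> w s = j} w * indicator {w \<in> paths S. f w \<in> C} w \<partial>Q i)"
      unfolding D_def using m1 m2 by (subst emeasure_density) auto
    also have "\<dots> = (\<integral>\<^sup>+w. indicator ({w \<in> paths S. R w \<and> w s = j} \<inter> {w \<in> paths S. f w \<in> C}) w \<partial>Q i)"
      by (intro nn_integral_cong) (auto split: split_indicator)
    also have "\<dots> = emeasure (Q i) ({w \<in> paths S. R w \<and> w s = j} \<inter> {w \<in> paths S. f w \<in> C})"
      using m1 m2 by (subst nn_integral_indicator) auto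
    also have "{w \<in> paths S. R w \<and> w s = j} \<inter> {w \<in> paths S. f w \<in> C} = {w \<in> paths S. R w \<and> w s = j \<and> f w \<in> C}" by auto
    finally show ?thesis .
  qed
  have fin: "finite_measure (distr (D R) (path_space S) f)"
    if R: "Measurable.pred (path_space S) R" and f: "f \<in> path_space S \<rightarrow>\<^sub>M path_space S" for R f
  proof (rule finite_measureI)
    have "paths S \<in> sets (path_space S)" using sets.top[of "path_space S"] by simp
    from emD[OF R f this] show "emeasure (distr (D R) (path_space S) f) (space (distr (D R) (path_space S) f)) \<noteq> \<infinity>"
      by simp
  qed
  have cyl: "emeasure (Q i) {w \<in> paths S. stop s w \<in> A \<and> w s = j \<and> shift s w \<in> B} =
    emeasure (Q i) {w \<in> paths S. stop s w \<in> A \<and> w s = j} * emeasure (Q j) B"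
    if A: "A = cylinder S I v" "finite I" "I \<subseteq> {0..}" and B: "B \<in> sets (path_space S)" for A I v B
  proof -
    have mA: "A \<in> sets (path_space S)" using sets_cylinder A by simp
    have pA: "Measurable.pred (path_space S) (\<lambda>w. stop s w \<in> A)" using mA by measurable
    let ?c = "emeasure (Q i) {w \<in> paths S. stop s w \<in> A \<and> w s = j}"
    have "distr (D (\<lambda>w. stop s w \<in> A)) (path_space S) (shift s) = scale_measure ?c (Q j)"
    proof (rule path_measure_eqI)
      fix J :: "real set" and u assume J: "finite J" "J \<subseteq> {0..}"
      show "emeasure (distr (D (\<lambda>w. stop s w \<in> A)) (path_space S) (shift s)) (cylinder S J u) =
         emeasure (scale_measure ?c (Q j)) (cylinder S J u)"
        unfolding emD[OF pA measurable_shift[OF s] sets_cylinder[OF J]] emeasure_scale_measure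
        using markov_cylinder[OF i j s A(2,3) J, of v u] 
        unfolding A(1)[symmetric] Qi.emeasure_eq_measure Qj.emeasure_eq_measure by (simp add: ennreal_mult)
    qed (auto intro: fin[OF pA measurable_shift[OF s]])
    then show ?thesis using emD[OF pA measurable_shift[OF s] B] by (simp add: emeasure_scale_measure)
  qed
  have pB: "Measurable.pred (path_space S) (\<lambda>w. shift s w \<in> B)" using B by measurable
  have pT: "Measurable.pred (path_space S) (\<lambda>w. True)" by measurable
  have "distr (D (\<lambda>w. shift s w \<in> B)) (path_space S) (stop s) =
     scale_measure (emeasure (Q j) B) (distr (D (\<lambda>w. True)) (path_space S) (stop s))"
  proof (rule path_measure_eqI)
    fix I :: "real set" and v assume I: "finite I" "I \<subseteq> {0..}"
    show "emeasure (distr (D (\<lambda>w. shift s w \<in> B)) (path_space S) (stop s)) (cylinder S I v) =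
      emeasure (scale_measure (emeasure (Q j) B) (distr (D (\<lambda>w. True)) (path_space S) (stop s))) (cylinder S I v)"
      unfolding emD[OF pB measurable_stop[OF s] sets_cylinder[OF I]] emeasure_scale_measure
        emD[OF pT measurable_stop[OF s] sets_cylinder[OF I]]
      using cyl[OF refl I B, of v] by (simp add: conj_ac mult.commute)
  qed (auto intro: fin[OF pB measurable_stop[OF s]])
  then have "emeasure (distr (D (\<lambda>w. shift s w \<in> B)) (path_space S) (stop s)) A =
    emeasure (Q j) B * emeasure (distr (D (\<lambda>w. True)) (path_space S) (stop s)) A"
    by (simp add: emeasure_scale_measure)
  then show ?thesis unfolding emD[OF pB measurable_stop[OF s] A] emD[OF pT measurable_stop[OF s] A]
    by (simp add: conj_ac mult.commute)
qed

text \<open>On \<open>w s = j\<close> the product formula for events says that the stopped and the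
  shifted path have the joint law \<open>N \<Otimes>\<^sub>M Q j\<close>, so that Fubini applies
  even if F couples past and future. Since the states are countable, the pieces over j add up to the
  claim.\<close>

lemma markov_nn_integral:
  assumes i: "i \<in> S" and s: "0 \<le> s"
    and F[measurable]: "F \<in> borel_measurable (path_space S \<Otimes>\<^sub>M path_space S)"
  shows "(\<integral>\<^sup>+w. F (stop s w, shift s w) \<partial>Q i) = (\<integral>\<^sup>+w. (\<integral>\<^sup>+w'. F (stop s w, w') \<partial>Q (w s)) \<partial>Q i)"
proof -
  interpret Qi: prob_space "Q i" by (rule prob_space_Q)
  note [measurable] = measurable_stop[OF s] measurable_shift[OF s] measurable_coordinate[OF s]
  have [measurable]: "(\<lambda>w. indicator {j} (w s) :: ennreal) \<in> borel_measurable (path_space S)" for j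
    by (rule measurable_compose[OF measurable_coordinate[OF s]]) simp
  have [measurable]: "(\<lambda>w. \<integral>\<^sup>+w'. F (stop s w, w') \<partial>Q j) \<in> borel_measurable (path_space S)" for j
  proof -
    interpret Qj: prob_space "Q j" by (rule prob_space_Q)
    have "F \<in> borel_measurable (path_space S \<Otimes>\<^sub>M Q j)" by measurable
    from measurable_compose[OF measurable_stop[OF s] Qj.borel_measurable_nn_integral_fst[OF this]]
    show ?thesis .
  qed
  have piece: "(\<integral>\<^sup>+w. F (stop s w, shift s w) * indicator {j} (w s) \<partial>Q i) =
      (\<integral>\<^sup>+w. (\<integral>\<^sup>+w'. F (stop s w, w') \<partial>Q j) * indicator {j} (w s) \<partial>Q i)" for j
  proof (cases "j \<in> S")
    case False
    have "indicator {j} (w s) = (0::ennreal)" if "w \<in> space (Q i)" for w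
      using paths_state[of w S s] that s False by (auto simp: indicator_def)
    then have "F (stop s w, shift s w) * indicator {j} (w s) = (\<integral>\<^sup>+w'. F (stop s w, w') \<partial>Q j) * indicator {j} (w s)"
      if "w \<in> space (Q i)" for w using that by (simp only: mult_zero_right)
    then show ?thesis by (rule nn_integral_cong)
  next
    case j: True
    interpret Qj: prob_space "Q j" by (rule prob_space_Q)
    define D where "D = density (Q i) (\<lambda>w. indicator {j} (w s))"
    define N where "N = distr D (path_space S) (stop s)"
    have [simp, measurable_cong]: "sets D = sets (path_space S)" unfolding D_def by simp
    have spD [simp]: "space D = paths S" unfolding D_def by simp
    have emD: "emeasure D A = emeasure (Q i) {w \<in> paths S. w \<in> A \<and> w s = j}" if "A \<in> sets (path_space S)" for A
    proof -
      have "emeasure D A = (\<integral>\<^sup>+w. indicator {j} (w s) * indicator A w \<partial>Q i)"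
        unfolding D_def using that by (subst emeasure_density) auto
      also have "\<dots> = (\<integral>\<^sup>+w. indicator {w \<in> paths S. w \<in> A \<and> w s = j} w \<partial>Q i)"
        by (intro nn_integral_cong) (auto split: split_indicator)
      also have "\<dots> = emeasure (Q i) {w \<in> paths S. w \<in> A \<and> w s = j}"
        using that by (intro nn_integral_indicator) (auto intro!: sets_Collect_path)
      finally show ?thesis .
    qed
    have emN: "emeasure N A = emeasure (Q i) {w \<in> paths S. stop s w \<in> A \<and> w s = j}" if A: "A \<in> sets (path_space S)" for A
    proof -
      have "emeasure N A = emeasure D {w \<in> paths S. stop s w \<in> A}"
        unfolding N_def using A by (subst emeasure_distr) (auto intro!: arg_cong2[of _ _ _ _ emeasure])
      also have "\<dots> = emeasure (Q i) {w \<in> paths S. stop s w \<in> A \<and> w s = j}"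
        using A by (subst emD) (auto intro!: sets_Collect_path arg_cong2[of _ _ _ _ emeasure])
      finally show ?thesis .
    qed
    have finN: "finite_measure N"
      by (rule finite_measureI) (use emN[of "space N"] in \<open>auto simp: N_def sets.top[of "path_space S", simplified]\<close>)
    have "N \<Otimes>\<^sub>M Q j = distr D (path_space S \<Otimes>\<^sub>M path_space S) (\<lambda>w. (stop s w, shift s w))"
    proof (rule pair_measure_eqI)
      show "sigma_finite_measure N" using finN by (rule finite_measure.sigma_finite_measure)
      show "sigma_finite_measure (Q j)" by (rule Qj.sigma_finite_measure_axioms)
      show "sets (N \<Otimes>\<^sub>M Q j) = sets (distr D (path_space S \<Otimes>\<^sub>M path_space S) (\<lambda>w. (stop s w, shift s w)))"
        unfolding sets_distr by (intro sets_pair_measure_cong) (auto simp: N_def)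
      fix A B assume "A \<in> sets N" "B \<in> sets (Q j)"
      then have A: "A \<in> sets (path_space S)" and B: "B \<in> sets (path_space S)" by (auto simp: N_def)
      have "emeasure (distr D (path_space S \<Otimes>\<^sub>M path_space S) (\<lambda>w. (stop s w, shift s w))) (A \<times> B)
        = emeasure D {w \<in> paths S. stop s w \<in> A \<and> shift s w \<in> B}"
        using A B by (subst emeasure_distr) (auto intro!: arg_cong2[of _ _ _ _ emeasure])
      also have "\<dots> = emeasure (Q i) {w \<in> paths S. stop s w \<in> A \<and> w s = j \<and> shift s w \<in> B}"
        using A B by (subst emD) (auto intro!: sets_Collect_path arg_cong2[of _ _ _ _ emeasure])
      also have "\<dots> = emeasure N A * emeasure (Q j) B"
        unfolding emN[OF A] by (rule markov_event[OF i j s A B])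
      finally show "emeasure N A * emeasure (Q j) B =
        emeasure (distr D (path_space S \<Otimes>\<^sub>M path_space S) (\<lambda>w. (stop s w, shift s w))) (A \<times> B)" by simp
    qed
    note prod = this
    have "(\<integral>\<^sup>+w. F (stop s w, shift s w) * indicator {j} (w s) \<partial>Q i) = (\<integral>\<^sup>+w. F (stop s w, shift s w) \<partial>D)"
      unfolding D_def by (subst nn_integral_density) (auto simp: mult.commute)
    also have "\<dots> = (\<integral>\<^sup>+p. F p \<partial>distr D (path_space S \<Otimes>\<^sub>M path_space S) (\<lambda>w. (stop s w, shift s w)))"
      by (subst nn_integral_distr) auto
    also have "\<dots> = (\<integral>\<^sup>+v. \<integral>\<^sup>+w'. F (v, w') \<partial>Q j \<partial>N)"
      unfolding prod[symmetric] by (rule Qj.nn_integral_fst[symmetric]) (simp add: N_def)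
    also have "\<dots> = (\<integral>\<^sup>+w. \<integral>\<^sup>+w'. F (stop s w, w') \<partial>Q j \<partial>D)"
      unfolding N_def by (subst nn_integral_distr) auto
    also have "\<dots> = (\<integral>\<^sup>+w. (\<integral>\<^sup>+w'. F (stop s w, w') \<partial>Q j) * indicator {j} (w s) \<partial>Q i)"
      unfolding D_def by (subst nn_integral_density) (auto simp: mult.commute)
    finally show ?thesis .
  qed
  have sumj: "(\<Sum>j. f j * indicator {j} (k::nat)) = f k" for f :: "nat \<Rightarrow> ennreal" and k
    by (subst suminf_finite[of "{k}"]) (auto simp: indicator_def)
  have "(\<integral>\<^sup>+w. F (stop s w, shift s w) \<partial>Q i) = (\<integral>\<^sup>+w. (\<Sum>j. F (stop s w, shift s w) * indicator {j} (w s)) \<partial>Q i)"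
    by (simp only: sumj)
  also have "\<dots> = (\<Sum>j. \<integral>\<^sup>+w. F (stop s w, shift s w) * indicator {j} (w s) \<partial>Q i)"
    by (rule nn_integral_suminf) measurable
  also have "\<dots> = (\<Sum>j. \<integral>\<^sup>+w. (\<integral>\<^sup>+w'. F (stop s w, w') \<partial>Q j) * indicator {j} (w s) \<partial>Q i)"
    by (simp only: piece)
  also have "\<dots> = (\<integral>\<^sup>+w. (\<Sum>j. (\<integral>\<^sup>+w'. F (stop s w, w') \<partial>Q j) * indicator {j} (w s)) \<partial>Q i)"
    by (rule nn_integral_suminf[symmetric]) measurable
  finally show ?thesis by (simp only: sumj)
qed

end


section \<open>Survival probabilities\<close>

definition hit0 :: "(real \<Rightarrow> nat) \<Rightarrow> ereal" where
  "hit0 w = first_time (\<lambda>t. w t = 0)"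

lemma hit0_gt_iff: "w \<in> paths S \<Longrightarrow> 0 \<le> t \<Longrightarrow> ereal t < hit0 w \<longleftrightarrow> (\<forall>r\<in>{0..t}. w r \<noteq> 0)"
  unfolding hit0_def using first_time_path_gt_iff[of w S t "\<lambda>j. j \<noteq> 0"] by simp

lemma hit0_nonneg: "0 \<le> hit0 w"
  unfolding hit0_def by (rule first_time_nonneg)

lemma measurable_hit0 [measurable]: "hit0 \<in> borel_measurable (path_space S)"
  by (rule borel_measurable_ereal_time[where R = "\<lambda>t w. \<forall>r\<in>{0..t}. w r \<noteq> 0"])
    (simp_all add: hit0_nonneg hit0_gt_iff pred_paths_ball[where R = "\<lambda>j. j \<noteq> 0"] del: neq0_conv)

context markov_chain
begin

lemma markov_measure:
  assumes "i \<in> S" "j \<in> S" "0 \<le> s" "Measurable.pred (path_space S) A" "Measurable.pred (path_space S) B"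
  shows "measure (Q i) {w \<in> paths S. A (stop s w) \<and> w s = j \<and> B (shift s w)} =
    measure (Q i) {w \<in> paths S. A (stop s w) \<and> w s = j} * measure (Q j) {w \<in> paths S. B w}"
proof -
  have eq: "{w \<in> paths S. stop s w \<in> {w \<in> paths S. A w} \<and> w s = j \<and> shift s w \<in> {w \<in> paths S. B w}}
      = {w \<in> paths S. A (stop s w) \<and> w s = j \<and> B (shift s w)}"
    "{w \<in> paths S. stop s w \<in> {w \<in> paths S. A w} \<and> w s = j} = {w \<in> paths S. A (stop s w) \<and> w s = j}"
    using assms(3) shift_paths stop_paths by auto
  show ?thesis
    using markov_event[OF assms(1-3) sets_Collect_path[OF assms(4)] sets_Collect_path[OF assms(5)]]
    unfolding eq by (simp add: measure_def enn2real_mult)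
qed

text \<open>The Q-matrix is available as the derivative of the transition function at 0. On the grid
  of mesh t / 2^n, being in 0 at all grid points has probability p(t / 2^n)^(2^n), which tends to
  exp(q00 t). Dyadic grids are nested, so these events decrease, and by right-continuity their
  intersection is \<open>stay t\<close>.\<close>

lemma stay_prob:
  assumes t: "0 \<le> t"
  shows "measure (Q 0) {w \<in> paths S. stay t w} = exp (q 0 0 * t)"
proof (cases "t = 0")
  case True
  interpret Q0: prob_space "Q 0" by (rule prob_space_Q)
  have "measure (Q 0) {w \<in> space (Q 0). stay 0 w} = 1"
  proof (subst Q0.prob_Collect_eq_1)
    show "AE w in Q 0. stay 0 w" using AE_start[OF zero_state] by eventually_elim (simp add: stay_def)
  qed (use sets_Collect_path[OF pred_stay[of 0]] in simp)
  then show ?thesis using True by simp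
next
  case False
  then have t0: "0 < t" using t by simp
  interpret Q0: prob_space "Q 0" by (rule prob_space_Q)
  interpret P0: prob_space "P 0" by (rule prob_space_P[OF zero_state])
  define p where "p = (\<lambda>h. trans_prob P X h 0 0)"
  define A where "A n = {w \<in> paths S. \<forall>k\<in>{..(2::nat)^n}. w (t * real k / 2^n) = 0}" for n
  have predA: "Measurable.pred (path_space S) (\<lambda>w. \<forall>k\<in>{..(2::nat)^n}. w (t * real k / 2^n) = 0)" for n
    using t by (intro pred_countable_Ball pred_count_space_const1 measurable_coordinate) auto
  have setA: "A n \<in> sets (path_space S)" for n unfolding A_def by (rule sets_Collect_path[OF predA])
  have mA: "measure (Q 0) (A n) = p (t / 2^n) ^ (2^n)" for n
  proof -
    have "measure (Q 0) (A n) = measure (P 0) {\<omega> \<in> space (P 0). \<forall>k\<le>2^n. X (t * real k / 2^n) \<omega> = 0}"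
      unfolding A_def Q_Collect[OF zero_state setA[unfolded A_def]] using t by (simp add: Ball_def)
    also have "\<dots> = (\<Prod>k<(2::nat)^n. trans_prob P X (t * real (Suc k) / 2^n - t * real k / 2^n) 0 0)"
      by (rule markov[OF zero_state]) (use t zero_state in \<open>auto simp: field_simps\<close>)
    also have "\<dots> = p (t / 2^n) ^ (2^n)" unfolding p_def by (simp add: field_simps)
    finally show ?thesis .
  qed
  have dec: "decseq A"
  proof (rule decseq_SucI, unfold A_def, safe)
    fix n w k assume w: "\<forall>k\<in>{..2 ^ Suc n}. w (t * real k / 2 ^ Suc n) = 0" and k: "k \<le> (2::nat) ^ n"
    have "w (t * real (2 * k) / 2 ^ Suc n) = 0" using w k by (intro bspec[OF w]) simp
    then show "w (t * real k / 2 ^ n) = 0" by (simp add: mult.left_commute)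
  qed
  have "(\<Inter>n. A n) = {w \<in> paths S. stay t w}"
  proof safe
    fix w assume w: "w \<in> (\<Inter>n. A n)"
    then have wp: "w \<in> paths S" unfolding A_def by auto
    then show "w \<in> paths S" .
    have z: "w (t * real k / 2^n) = 0" if "k \<le> 2^n" for k n using w that unfolding A_def by auto
    have "w r = 0" if r: "r \<in> {0..t}" for r
    proof (cases "r = t")
      case True then show ?thesis using z[of 1 0] by simp
    next
      case False
      obtain e where e0: "e > 0" and e: "\<forall>x\<in>{r..<r+e}. w x = w r" using paths_right[OF wp, of r] r by auto
      obtain n :: nat where n: "t / e < 2^n" using real_arch_pow[of 2 "t/e"] by auto
      \<comment> \<open>The ceiling selects the first grid point at or after r. Once the mesh is
        below e, this point lies in [r, r + e), where the path still has the value
        \<open>w r\<close>.\<close>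
      define k where "k = nat \<lceil>r * 2^n / t\<rceil>"
      have kr: "real k = of_int \<lceil>r * 2^n / t\<rceil>" unfolding k_def using r t by simp
      have k1: "r * 2^n / t \<le> real k" "real k < r * 2^n / t + 1" unfolding kr by linarith+
      have "r * 2^n / t \<le> 2^n" using r t0 by (simp add: field_simps)
      then have "\<lceil>r * 2^n / t\<rceil> \<le> 2^n" by (simp add: ceiling_le_iff)
      then have "k \<le> 2^n" unfolding k_def by (simp add: nat_le_iff)
      moreover have "r \<le> t * real k / 2^n" using k1(1) t0 by (simp add: field_simps)
      moreover have "t * real k / 2^n < r + e"
      proof -
        have "t * real k < t * (r * 2^n / t + 1)" using k1(2) t0 by (intro mult_strict_left_mono)
        also have "\<dots> = r * 2^n + t" using t0 by (simp add: field_simps)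
        also have "\<dots> < r * 2^n + e * 2^n" using n e0 by (simp add: field_simps)
        finally show ?thesis by (simp add: field_simps)
      qed
      ultimately show ?thesis using z[of k n] bspec[OF e, of "t * real k / 2^n"] by simp
    qed
    then show "stay t w" unfolding stay_def by blast
  next
    fix w n assume w: "w \<in> paths S" "stay t w"
    have "t * real k / 2^n \<in> {0..t}" if "k \<le> (2::nat)^n" for k
    proof -
      have "real k \<le> 2^n" using that by (metis of_nat_le_iff of_nat_numeral of_nat_power)
      then show ?thesis using t t0 by (simp add: field_simps)
    qed
    then show "w \<in> A n" using w unfolding A_def stay_def by auto
  qed
  then have lim1: "(\<lambda>n. measure (Q 0) (A n)) \<longlonglongrightarrow> measure (Q 0) {w \<in> paths S. stay t w}"
    using Q0.finite_Lim_measure_decseq[OF _ dec] setA by auto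
  have p0: "p 0 = 1"
    unfolding p_def trans_prob_def using start_X[OF zero_state]
    by (subst P0.prob_Collect_eq_1) (use measurable_X[OF zero_state order_refl] in auto)
  have "((\<lambda>h. ln (p h)) has_real_derivative (1 / p 0) * q 0 0) (at 0 within {0..})"
    by (rule DERIV_chain2[OF DERIV_ln_divide]) (use p0 Q_matrix[OF zero_state zero_state] in \<open>auto simp: p_def\<close>)
  \<comment> \<open>Since p(0) = 1, the difference quotient of ln p at 0 is ln p(h) / h, and its
    limit is the derivative of p itself.\<close>
  then have d: "((\<lambda>h. ln (p h) / h) \<longlongrightarrow> q 0 0) (at 0 within {0..})"
    by (simp add: has_field_derivative_iff p0)
  have h0: "(\<lambda>n. t / 2^n) \<longlonglongrightarrow> 0"
    using LIMSEQ_divide_realpow_zero[of 2 t] by simp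
  have hat: "filterlim (\<lambda>n. t / 2^n) (at 0 within {0..}) sequentially"
    unfolding filterlim_at using h0 t0 by auto
  have pc: "(p \<longlongrightarrow> 1) (at 0 within {0..})"
    using DERIV_continuous[OF Q_matrix[OF zero_state zero_state]] p0
    unfolding continuous_within p_def by simp
  have ev: "\<forall>\<^sub>F n in sequentially. p (t / 2^n) > 0"
    using order_tendstoD(1)[OF filterlim_compose[OF pc hat], of 0] by simp
  have "(\<lambda>n. exp (t * (ln (p (t / 2^n)) / (t / 2^n)))) \<longlonglongrightarrow> exp (t * q 0 0)"
    by (intro tendsto_intros filterlim_compose[OF d hat])
  moreover have "\<forall>\<^sub>F n in sequentially. exp (t * (ln (p (t / 2^n)) / (t / 2^n))) = measure (Q 0) (A n)"
    using ev
  proof eventually_elim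
    case (elim n)
    have "exp (t * (ln (p (t / 2^n)) / (t / 2^n))) = exp (real (2^n) * ln (p (t / 2^n)))"
      using t0 by (simp add: field_simps)
    also have "\<dots> = exp (ln (p (t / 2^n))) ^ (2^n)" by (rule exp_of_nat_mult)
    finally show ?case using elim mA by simp
  qed
  ultimately have "(\<lambda>n. measure (Q 0) (A n)) \<longlonglongrightarrow> exp (t * q 0 0)" by (rule Lim_transform_eventually)
  then show ?thesis using LIMSEQ_unique[OF lim1] by (simp add: mult.commute)
qed

definition surv :: "hat \<Rightarrow> real \<Rightarrow> real" where
  "surv y t = measure (Q (chain_state y)) {w \<in> paths S. alive (snd y) w t}"

abbreviation F :: "real \<Rightarrow> real" where
  "F \<equiv> surv (holding 0)"

text \<open>The part of \<open>F t\<close> carried by paths whose first stay in 0 ends by time b.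
  Its limiting share of \<open>F t\<close> gives the values of \<open>h\<close> in the holding
  states.\<close>

definition exit_surv :: "real \<Rightarrow> real \<Rightarrow> real" where
  "exit_surv b t = measure (Q 0) {w \<in> paths S. \<not> stay b w \<and> alive 0 w t}"

lemma pred_alive00 [measurable]: "Measurable.pred (path_space S) (\<lambda>w. alive 0 w t)"
  by (rule pred_alive) simp

lemma surv_antimono: "snd y \<in> {0..<1} \<Longrightarrow> antimono (surv y)"
proof (rule antimonoI)
  fix s t :: real assume y: "snd y \<in> {0..<1}" and st: "s \<le> t"
  interpret Qy: prob_space "Q (chain_state y)" by (rule prob_space_Q)
  show "surv y t \<le> surv y s"
    unfolding surv_def by (rule Qy.finite_measure_mono)
      (use alive_antimono[OF _ st] sets_Collect_path[OF pred_alive[OF y]] in auto)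
qed

lemma surv_nonneg: "0 \<le> surv y t"
  unfolding surv_def by simp

lemma surv_le_1: "surv y t \<le> 1"
  unfolding surv_def by (rule prob_space.prob_le_1[OF prob_space_Q])

lemma alive_neg: "t < 0 \<Longrightarrow> alive u w t"
  unfolding alive_def by auto

lemma not_stay_of_alive: "alive 0 w t \<Longrightarrow> 1 \<le> t \<Longrightarrow> \<not> stay 1 w"
  using alive_holding[of 0 w t] by auto

lemma surv_holding:
  assumes "u \<in> {0..<1}" "1 - u \<le> t"
  shows "surv (holding u) t = exit_surv (1 - u) t"
proof -
  have "alive u w t \<longleftrightarrow> \<not> stay (1 - u) w \<and> alive 0 w t" for w
    using alive_holding[of u w t] assms by auto
  then show ?thesis unfolding surv_def exit_surv_def by (simp add: discrete_inverse)
qed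

lemma exit_surv_antimono: "antimono (exit_surv b)" if "0 \<le> b"
proof (rule antimonoI)
  fix s t :: real assume st: "s \<le> t"
  interpret Q0: prob_space "Q 0" by (rule prob_space_Q)
  note [measurable] = pred_stay[OF that]
  have "{w \<in> paths S. \<not> stay b w \<and> alive 0 w s} \<in> sets (path_space S)"
    by (rule sets_Collect_path) measurable
  then show "exit_surv b t \<le> exit_surv b s"
    unfolding exit_surv_def by (intro Q0.finite_measure_mono) (use alive_antimono[OF _ st] in auto)
qed

text \<open>Dying between s and t after an early exit is a special case of dying between s and t.
  Time shifts that are negligible for \<open>F\<close> are therefore negligible for
  \<open>exit_surv\<close> too.\<close>

lemma exit_surv_diff:
  assumes b: "0 \<le> b" and st: "s \<le> t"
  shows "exit_surv b s - exit_surv b t \<le> F s - F t"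
proof -
  interpret Q0: prob_space "Q 0" by (rule prob_space_Q)
  note [measurable] = pred_stay[OF b]
  have m: "{w \<in> paths S. R w} \<in> sets (Q 0)" if "Measurable.pred (path_space S) R" for R
    using sets_Collect_path[OF that] by simp
  have "exit_surv b s - exit_surv b t = measure (Q 0) ({w \<in> paths S. \<not> stay b w \<and> alive 0 w s} - {w \<in> paths S. \<not> stay b w \<and> alive 0 w t})"
    unfolding exit_surv_def
    by (rule Q0.finite_measure_Diff[symmetric]; (rule m, measurable)?) (use alive_antimono[OF _ st] in auto)
  also have "\<dots> \<le> measure (Q 0) ({w \<in> paths S. alive 0 w s} - {w \<in> paths S. alive 0 w t})"
    by (intro Q0.finite_measure_mono sets.Diff m) (auto, measurable)
  also have "\<dots> = F s - F t"
    unfolding surv_def prod.sel of_discrete_inverse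
    by (simp add: discrete_inverse, rule Q0.finite_measure_Diff; (rule m, measurable)?) (use alive_antimono[OF _ st] in auto)
  finally show ?thesis .
qed

text \<open>Split by whether the first stay in 0 lasts until v. If it does, the age at v is v and
  the chain has to leave 0 within another 1 - v; here t \<ge> 1 ensures that the horizon t - v
  reaches this deadline.\<close>

lemma surv_renewal:
  assumes v: "0 \<le> v" "v < 1" and t: "1 \<le> t"
  shows "F t = exit_surv v t + exp (q 0 0 * v) * exit_surv (1 - v) (t - v)"
proof -
  interpret Q0: prob_space "Q 0" by (rule prob_space_Q)
  have v1: "0 \<le> 1 - v" using v by simp
  note [measurable] = pred_stay[OF v(1)] pred_stay[OF v1] pred_alive00
  have m: "{w \<in> paths S. R w} \<in> sets (Q 0)" if "Measurable.pred (path_space S) R" for R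
    using sets_Collect_path[OF that] by simp
  have pm: "Measurable.pred (path_space S) (\<lambda>w. \<not> stay (1 - v) w \<and> alive 0 w (t - v))"
    by (intro pred_intros_logic pred_stay[OF v1] pred_alive00)
  have al: "alive 0 w t \<longleftrightarrow> \<not> stay (1 - v) (shift v w) \<and> alive 0 (shift v w) (t - v)" if "stay v w" for w
  proof -
    have "alive 0 w t \<longleftrightarrow> alive 0 w v \<and> alive v (shift v w) (t - v)"
      using alive_flow[of v "t - v" 0 w] age_stay[OF v(1) that, of 0] v t by simp
    moreover have "alive 0 w v" using alive_short[of v 0 w] v by simp
    ultimately show ?thesis using alive_holding[of v "shift v w" "t - v"] v t by auto
  qed
  have sv: "stay v (stop v w) \<and> w v = 0 \<longleftrightarrow> stay v w" for w
    unfolding stay_def using v by (auto simp: min_absorb1)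
  have "F t = measure (Q 0) ({w \<in> paths S. \<not> stay v w \<and> alive 0 w t} \<union> {w \<in> paths S. stay v w \<and> alive 0 w t})"
    unfolding surv_def by (auto simp: discrete_inverse intro!: arg_cong2[of _ _ _ _ measure])
  also have "\<dots> = exit_surv v t + measure (Q 0) {w \<in> paths S. stay v w \<and> alive 0 w t}"
    unfolding exit_surv_def
    by (rule Q0.finite_measure_Union; (rule m, measurable)?) auto
  also have "{w \<in> paths S. stay v w \<and> alive 0 w t} = {w \<in> paths S. stay v (stop v w) \<and> w v = 0 \<and> 
      (\<not> stay (1 - v) (shift v w) \<and> alive 0 (shift v w) (t - v))}"
    using al sv by blast
  also have "measure (Q 0) \<dots> = measure (Q 0) {w \<in> paths S. stay v (stop v w) \<and> w v = 0} * exit_surv (1 - v) (t - v)"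
    unfolding exit_surv_def
    by (rule markov_measure[OF zero_state zero_state v(1) pred_stay[OF v(1)] pm])
  also have "measure (Q 0) {w \<in> paths S. stay v (stop v w) \<and> w v = 0} = exp (q 0 0 * v)"
    unfolding sv by (rule stay_prob[OF v(1)])
  finally show ?thesis .
qed

end


section \<open>Comparing other states with 0 through the hitting time of 0\<close>

lemma first_time_less_iff: "first_time A < ereal s \<longleftrightarrow> (\<exists>r\<ge>0. r < s \<and> A r)"
  unfolding first_time_def Inf_less_iff by auto

lemma hit0_zero:
  assumes w: "w \<in> paths S" and r: "hit0 w = ereal r"
  shows "0 \<le> r" "w r = 0"
proof -
  show "0 \<le> r" using hit0_nonneg[of w] r by simp
  then have "\<not> (\<forall>q\<in>{0..r}. w q \<noteq> 0)" using hit0_gt_iff[OF w, of r] r by simp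
  then obtain q where q: "q \<in> {0..r}" "w q = 0" by blast
  have "\<not> q < r"
  proof
    assume "q < r"
    then have "hit0 w < ereal r" unfolding hit0_def first_time_less_iff using q by auto
    then show False using r by simp
  qed
  then show "w r = 0" using q by (cases "q = r") auto
qed

lemma age0_le: "0 \<le> t \<Longrightarrow> age 0 w t \<le> t"
proof -
  assume t: "0 \<le> t"
  have "0 \<le> Sup {r \<in> {0..t}. w r \<noteq> 0}" if "\<not> (\<forall>r\<in>{0..t}. w r = 0)"
  proof -
    from that obtain q where q: "q \<in> {0..t}" "w q \<noteq> 0" by blast
    then have "q \<le> Sup {r \<in> {0..t}. w r \<noteq> 0}" by (intro cSup_upper) auto
    then show ?thesis using q by simp
  qed
  then show ?thesis using age_eq[of 0 w t] t by (auto split: if_splits)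
qed

text \<open>The offset 2 keeps the mesh at most 1/2: an age of one mesh is then below 1, and 1 -
  \<open>mesh n\<close> is a nonnegative time.\<close>

definition mesh :: "nat \<Rightarrow> real" where
  "mesh n = 1 / real (n + 2)"

lemma mesh_bounds: "0 < mesh n" "mesh n \<le> 1 / 2"
  unfolding mesh_def by (auto simp: field_simps)

lemma mesh_lim: "mesh \<longlonglongrightarrow> 0"
  unfolding mesh_def using LIMSEQ_ignore_initial_segment[OF lim_1_over_n, of 2] by simp

text \<open>The strong Markov property at the hitting time of \<open>0\<close> is only needed in the form of two
  inequalities. They follow from the Markov property at the first grid point after the hitting
  time; \<open>first_grid S n k\<close> is the event that this is the point \<open>Suc k\<close> and that the path has not
  left \<open>0\<close> by then.\<close>

definition first_grid :: "nat set \<Rightarrow> nat \<Rightarrow> nat \<Rightarrow> (real \<Rightarrow> nat) set" where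
  "first_grid S n k = {w \<in> paths S. \<not> hit0 w < ereal (real k * mesh n) \<and> hit0 w < ereal (real (Suc k) * mesh n) \<and>
     w (real (Suc k) * mesh n) = 0}"

lemma sets_first_grid [measurable]: "first_grid S n k \<in> sets (path_space S)"
proof -
  have "Measurable.pred (path_space S) (\<lambda>w. w (real (Suc k) * mesh n) = 0)"
    by (intro pred_count_space_const1 measurable_coordinate) (use mesh_bounds(1)[of n] in simp)
  moreover have "Measurable.pred (path_space S) (\<lambda>w. \<not> hit0 w < ereal (real k * mesh n) \<and> hit0 w < ereal (real (Suc k) * mesh n))"
    by measurable
  ultimately show ?thesis unfolding first_grid_def
    by (intro sets_Collect_path) (simp only: conj_assoc[symmetric] pred_intros_logic)
qed

lemma disjoint_first_grid: "disjoint_family (first_grid S n)"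
proof -
  have "first_grid S n k \<inter> first_grid S n l = {}" if "k < l" for k l
  proof -
    have "real (Suc k) * mesh n \<le> real l * mesh n"
      using that mesh_bounds(1)[of n] by (intro mult_right_mono) auto
    then have "ereal (real (Suc k) * mesh n) \<le> ereal (real l * mesh n)" by simp
    then show ?thesis unfolding first_grid_def using less_le_trans by blast
  qed
  then show ?thesis unfolding disjoint_family_on_def by (metis Int_commute linorder_neqE_nat)
qed

text \<open>After hitting 0 the path stays there for some positive time e, and every grid of mesh
  below e has a point in this stay.\<close>

lemma eventually_first_grid:
  assumes w: "w \<in> paths S" and fin: "hit0 w < \<infinity>"
  shows "\<forall>\<^sub>F n in sequentially. w \<in> (\<Union>k. first_grid S n k)"
proof -
  obtain r where r: "hit0 w = ereal r" using fin hit0_nonneg[of w] by (cases "hit0 w") auto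
  note z = hit0_zero[OF w r]
  obtain e where e0: "e > 0" and e: "\<forall>x\<in>{r..<r+e}. w x = w r" using paths_right[OF w z(1)] by auto
  have "\<forall>\<^sub>F n in sequentially. mesh n < e" using order_tendstoD(2)[OF mesh_lim e0] .
  then show ?thesis
  proof eventually_elim
    case (elim n)
    define k where "k = nat \<lfloor>r / mesh n\<rfloor>"
    have "0 \<le> r / mesh n" using z(1) mesh_bounds(1)[of n] by simp
    then have "real k \<le> r / mesh n" "r / mesh n < real k + 1" unfolding k_def by linarith+
    then have k: "real k * mesh n \<le> r" "r < real (Suc k) * mesh n"
      using mesh_bounds(1)[of n] by (auto simp: field_simps)
    have "real (Suc k) * mesh n = real k * mesh n + mesh n" by (simp add: algebra_simps)
    then have "w (real (Suc k) * mesh n) = 0"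
      using bspec[OF e, of "real (Suc k) * mesh n"] k elim z(2) by simp
    then have "w \<in> first_grid S n k" unfolding first_grid_def using w r k by simp
    then show ?case by blast
  qed
qed

context markov_chain
begin

lemma F_eq: "F t = measure (Q 0) {w \<in> paths S. alive 0 w t}"
  and surv_excursion: "surv (excursion j) t = measure (Q j) {w \<in> paths S. alive 0 w t}"
  unfolding surv_def by (simp_all add: discrete_inverse)

text \<open>The event is decided by the path up to the grid point g: strict inequalities for
  \<open>hit0\<close> at levels up to g do not change when the path is stopped at g. Hence the
  Markov property at the deterministic time g applies.\<close>

lemma first_grid_markov:
  assumes j: "j \<in> S" and B: "Measurable.pred (path_space S) B"
  shows "emeasure (Q j) {w \<in> first_grid S n k. B (shift (real (Suc k) * mesh n) w)} =
    emeasure (Q j) (first_grid S n k) * emeasure (Q 0) {w \<in> paths S. B w}"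
proof -
  interpret Qj: prob_space "Q j" by (rule prob_space_Q)
  interpret Q0: prob_space "Q 0" by (rule prob_space_Q)
  let ?g = "real (Suc k) * mesh n"
  let ?A = "\<lambda>w. \<not> hit0 w < ereal (real k * mesh n) \<and> hit0 w < ereal ?g"
  have g: "0 \<le> ?g" "real k * mesh n \<le> ?g" using mesh_bounds(1)[of n] by (auto intro: mult_right_mono)
  have "hit0 (stop ?g w) < ereal c \<longleftrightarrow> hit0 w < ereal c" if "c \<le> ?g" for c w
    unfolding hit0_def first_time_less_iff using that by (auto simp: min_absorb1)
  then have A: "?A (stop ?g w) \<longleftrightarrow> ?A w" for w using g(2) by blast
  have pA: "Measurable.pred (path_space S) ?A" by measurable
  have 1: "{w \<in> first_grid S n k. B (shift ?g w)} = {w \<in> paths S. ?A (stop ?g w) \<and> w ?g = 0 \<and> B (shift ?g w)}"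
    unfolding first_grid_def A by blast
  have 2: "first_grid S n k = {w \<in> paths S. ?A (stop ?g w) \<and> w ?g = 0}"
    unfolding first_grid_def A by blast
  have "measure (Q j) {w \<in> paths S. ?A (stop ?g w) \<and> w ?g = 0 \<and> B (shift ?g w)} =
      measure (Q j) {w \<in> paths S. ?A (stop ?g w) \<and> w ?g = 0} * measure (Q 0) {w \<in> paths S. B w}"
    by (rule markov_measure[OF j zero_state g(1) pA B])
  then show ?thesis
    by (subst 1, subst 2) (simp only: Qj.emeasure_eq_measure Q0.emeasure_eq_measure ennreal_mult measure_nonneg)
qed

lemma first_grid_lim:
  assumes fin: "AE w in Q j. hit0 w < \<infinity>"
  shows "(\<lambda>n. measure (Q j) (\<Union>k. first_grid S n k)) \<longlonglongrightarrow> 1"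
proof -
  interpret Qj: prob_space "Q j" by (rule prob_space_Q)
  have m: "(\<Union>k. first_grid S n k) \<in> sets (Q j)" for n by (simp add: sets_first_grid sets.countable_UN)
  have "(\<lambda>n. \<integral>w. indicator (\<Union>k. first_grid S n k) w \<partial>Q j) \<longlonglongrightarrow> (\<integral>w. (1::real) \<partial>Q j)"
  proof (rule integral_dominated_convergence[where w = "\<lambda>_. 1"])
    show "AE w in Q j. (\<lambda>n. indicator (\<Union>k. first_grid S n k) w) \<longlonglongrightarrow> (1::real)"
      using fin AE_space
    proof eventually_elim
      case (elim w)
      have "\<forall>\<^sub>F n in sequentially. w \<in> (\<Union>k. first_grid S n k)"
        by (rule eventually_first_grid) (use elim in auto)
      then have "\<forall>\<^sub>F n in sequentially. indicator (\<Union>k. first_grid S n k) w = (1::real)"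
        by eventually_elim (simp add: indicator_def)
      then show ?case by (rule tendsto_eventually)
    qed
  qed (use m in \<open>auto simp: indicator_def\<close>)
  moreover have "(\<integral>w. indicator (\<Union>k. first_grid S n k) w \<partial>Q j) = measure (Q j) (\<Union>k. first_grid S n k)" for n
    using m[of n] Bochner_Integration.integral_indicator[of "Q j" "\<Union>k. first_grid S n k"]
      sets.sets_into_space[OF m[of n]] by (simp add: Int_absorb2)
  moreover have "(\<integral>w. (1::real) \<partial>Q j) = 1" using Qj.prob_space by simp
  ultimately show ?thesis by simp
qed

text \<open>Restart the chain at the grid point after the hitting time. Its position is at most hit0
  + 1, so monotonicity of \<beta> bounds the contribution of each grid point; the summand 1
  dominates all meshes and makes the bound independent of the grid. Paths that leave 0 before the
  grid point are missed, but their mass vanishes as the grid is refined.\<close>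

lemma hit_upper:
  fixes \<beta> :: "real \<Rightarrow> real"
  assumes j: "j \<in> S" and fin: "AE w in Q j. hit0 w < \<infinity>"
    and A: "Measurable.pred (path_space S) A" and B: "\<And>d. 0 \<le> d \<Longrightarrow> Measurable.pred (path_space S) (B d)"
    and AB: "\<And>w d. w \<in> paths S \<Longrightarrow> 0 \<le> d \<Longrightarrow> w d = 0 \<Longrightarrow> A w \<Longrightarrow> B d (shift d w)"
    and \<beta>: "mono \<beta>" "\<And>d. 0 \<le> d \<Longrightarrow> measure (Q 0) {w \<in> paths S. B d w} \<le> \<beta> d"
  shows "ennreal (measure (Q j) {w \<in> paths S. A w}) \<le> (\<integral>\<^sup>+w. ennreal (\<beta> (real_of_ereal (hit0 w) + 1)) \<partial>Q j)"
proof -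
  interpret Qj: prob_space "Q j" by (rule prob_space_Q)
  interpret Q0: prob_space "Q 0" by (rule prob_space_Q)
  note [measurable] = A
  let ?V = "\<integral>\<^sup>+w. ennreal (\<beta> (real_of_ereal (hit0 w) + 1)) \<partial>Q j"
  have [measurable]: "\<beta> \<in> borel_measurable borel" by (rule borel_measurable_mono[OF \<beta>(1)])
  have mA: "{w \<in> paths S. A w} \<in> sets (path_space S)" by (rule sets_Collect_path[OF A])
  have mU: "(\<Union>k. first_grid S n k) \<in> sets (path_space S)" for n by auto
  have on_grid: "emeasure (Q j) ({w \<in> paths S. A w} \<inter> (\<Union>k. first_grid S n k)) \<le> ?V" for n
  proof -
    let ?g = "\<lambda>k. real (Suc k) * mesh n"
    have g: "0 \<le> ?g k" for k using mesh_bounds(1)[of n] by simp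
    have "{w \<in> paths S. A w} \<inter> (\<Union>k. first_grid S n k) = (\<Union>k. {w \<in> paths S. A w} \<inter> first_grid S n k)" by blast
    also have "emeasure (Q j) \<dots> = (\<Sum>k. emeasure (Q j) ({w \<in> paths S. A w} \<inter> first_grid S n k))"
      using disjoint_first_grid[of S n] mA
      by (intro suminf_emeasure[symmetric]) (auto simp: disjoint_family_on_def)
    also have "\<dots> \<le> (\<Sum>k. \<integral>\<^sup>+w. ennreal (\<beta> (real_of_ereal (hit0 w) + 1)) * indicator (first_grid S n k) w \<partial>Q j)"
    proof (rule suminf_le[OF _ summableI summableI])
      fix k
      have mS: "{w \<in> first_grid S n k. B (?g k) (shift (?g k) w)} \<in> sets (path_space S)"
      proof -
        have "{w \<in> paths S. w \<in> first_grid S n k \<and> B (?g k) (shift (?g k) w)} \<in> sets (path_space S)"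
          by (intro sets_Collect_path pred_intros_logic measurable_compose[OF measurable_shift B]) (use g in auto)
        moreover have "{w \<in> paths S. w \<in> first_grid S n k \<and> B (?g k) (shift (?g k) w)} = {w \<in> first_grid S n k. B (?g k) (shift (?g k) w)}"
          unfolding first_grid_def by blast
        ultimately show ?thesis by simp
      qed
      have "emeasure (Q j) ({w \<in> paths S. A w} \<inter> first_grid S n k) \<le> emeasure (Q j) {w \<in> first_grid S n k. B (?g k) (shift (?g k) w)}"
      proof (rule emeasure_mono)
        show "{w \<in> paths S. A w} \<inter> first_grid S n k \<subseteq> {w \<in> first_grid S n k. B (?g k) (shift (?g k) w)}"
        proof
          fix w assume w: "w \<in> {w \<in> paths S. A w} \<inter> first_grid S n k"
          then have "w \<in> paths S" "A w" "w (?g k) = 0" unfolding first_grid_def by auto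
          then have "B (?g k) (shift (?g k) w)" using AB g by blast
          then show "w \<in> {w \<in> first_grid S n k. B (?g k) (shift (?g k) w)}" using w by blast
        qed
      qed (use mS in simp)
      also have "\<dots> = emeasure (Q j) (first_grid S n k) * emeasure (Q 0) {w \<in> paths S. B (?g k) w}"
        by (rule first_grid_markov[OF j B[OF g]])
      also have "\<dots> \<le> emeasure (Q j) (first_grid S n k) * ennreal (\<beta> (?g k))"
        unfolding Q0.emeasure_eq_measure by (intro mult_left_mono ennreal_leI \<beta>(2) g) simp
      also have "\<dots> = (\<integral>\<^sup>+w. ennreal (\<beta> (?g k)) * indicator (first_grid S n k) w \<partial>Q j)"
        by (subst nn_integral_cmult_indicator) (auto simp: mult.commute)
      also have "\<dots> \<le> (\<integral>\<^sup>+w. ennreal (\<beta> (real_of_ereal (hit0 w) + 1)) * indicator (first_grid S n k) w \<partial>Q j)"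
      proof (intro nn_integral_mono)
        fix w
        show "ennreal (\<beta> (?g k)) * indicator (first_grid S n k) w \<le> ennreal (\<beta> (real_of_ereal (hit0 w) + 1)) * indicator (first_grid S n k) w"
        proof (cases "w \<in> first_grid S n k")
          case True
          then have h: "\<not> hit0 w < ereal (real k * mesh n)" "hit0 w < ereal (?g k)" unfolding first_grid_def by auto
          then obtain r where r: "hit0 w = ereal r" using hit0_nonneg[of w] by (cases "hit0 w") auto
          then have "?g k \<le> r + 1" using h mesh_bounds[of n] by (simp add: algebra_simps)
          then have "\<beta> (?g k) \<le> \<beta> (r + 1)" by (rule monoD[OF \<beta>(1)])
          then show ?thesis using r True by (simp add: ennreal_leI)
        qed simp
      qed
      finally show "emeasure (Q j) ({w \<in> paths S. A w} \<inter> first_grid S n k) \<le>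
        (\<integral>\<^sup>+w. ennreal (\<beta> (real_of_ereal (hit0 w) + 1)) * indicator (first_grid S n k) w \<partial>Q j)" .
    qed
    also have "\<dots> = (\<integral>\<^sup>+w. (\<Sum>k. ennreal (\<beta> (real_of_ereal (hit0 w) + 1)) * indicator (first_grid S n k) w) \<partial>Q j)"
      by (rule nn_integral_suminf[symmetric]) measurable
    also have "\<dots> = (\<integral>\<^sup>+w. ennreal (\<beta> (real_of_ereal (hit0 w) + 1)) * indicator (\<Union>k. first_grid S n k) w \<partial>Q j)"
      by (simp add: suminf_indicator[OF disjoint_first_grid])
    also have "\<dots> \<le> ?V"
      by (intro nn_integral_mono) (auto split: split_indicator)
    finally show ?thesis .
  qed
  have "emeasure (Q j) {w \<in> paths S. A w} \<le> ?V + ennreal (1 - measure (Q j) (\<Union>k. first_grid S n k))" for n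
  proof -
    have "emeasure (Q j) {w \<in> paths S. A w} \<le> emeasure (Q j) (({w \<in> paths S. A w} \<inter> (\<Union>k. first_grid S n k)) \<union> (space (Q j) - (\<Union>k. first_grid S n k)))"
      using mA mU[of n] sets.Diff[OF sets.top mU[of n]] by (intro emeasure_mono sets.Un sets.Int) auto
    also have "\<dots> \<le> emeasure (Q j) ({w \<in> paths S. A w} \<inter> (\<Union>k. first_grid S n k)) + emeasure (Q j) (space (Q j) - (\<Union>k. first_grid S n k))"
      using mA mU[of n] sets.Diff[OF sets.top mU[of n]] by (intro emeasure_subadditive sets.Int) auto
    also have "emeasure (Q j) (space (Q j) - (\<Union>k. first_grid S n k)) = ennreal (1 - measure (Q j) (\<Union>k. first_grid S n k))"
      unfolding Qj.emeasure_eq_measure using mU by (subst Qj.prob_compl) auto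
    finally show ?thesis using on_grid by (meson add_right_mono order_trans)
  qed
  moreover have "(\<lambda>n. ?V + ennreal (1 - measure (Q j) (\<Union>k. first_grid S n k))) \<longlonglongrightarrow> ?V + ennreal (1 - 1)"
    by (intro tendsto_intros first_grid_lim[OF fin])
  ultimately have "emeasure (Q j) {w \<in> paths S. A w} \<le> ?V + ennreal (1 - 1)"
    by (intro LIMSEQ_le_const) auto
  then show ?thesis by (simp add: Qj.emeasure_eq_measure)
qed

text \<open>There is no death before 0 is hit, and at the next grid point the age is at most one
  mesh. Surviving another t from there follows from surviving t with initial age 0 and leaving 0 by
  1 - \<open>mesh n\<close>. The probability of the latter approaches F t as the mesh
  shrinks.\<close>

lemma hit_lower:
  assumes j: "j \<in> S" and fin: "AE w in Q j. hit0 w < \<infinity>" and t: "1 \<le> t"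
  shows "F t \<le> surv (excursion j) t"
proof -
  interpret Qj: prob_space "Q j" by (rule prob_space_Q)
  interpret Q0: prob_space "Q 0" by (rule prob_space_Q)
  define c where "c n = measure (Q 0) {w \<in> paths S. alive 0 w t \<and> \<not> stay (1 - mesh n) w}" for n
  have m1: "0 \<le> 1 - mesh n" for n using mesh_bounds[of n] by simp
  have pB: "Measurable.pred (path_space S) (\<lambda>w. alive 0 w t \<and> \<not> stay (1 - mesh n) w)" for n
    by (intro pred_intros_logic pred_stay[OF m1] pred_alive00)
  have mA: "{w \<in> paths S. alive 0 w t} \<in> sets (path_space S)" by (rule sets_Collect_path[OF pred_alive00])
  have incl: "alive 0 w t"
    if w: "w \<in> first_grid S n k" and B: "alive 0 (shift (real (Suc k) * mesh n) w) t" "\<not> stay (1 - mesh n) (shift (real (Suc k) * mesh n) w)" for w n k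
  proof -
    let ?g = "real (Suc k) * mesh n"
    have g: "0 \<le> ?g" "?g = real k * mesh n + mesh n" using mesh_bounds(1)[of n] by (auto simp: algebra_simps)
    have nz: "w r \<noteq> 0" if "0 \<le> r" "r < real k * mesh n" for r
    proof
      assume "w r = 0"
      then have "hit0 w < ereal (real k * mesh n)" unfolding hit0_def first_time_less_iff using that by blast
      then show False using w unfolding first_grid_def by blast
    qed
    \<comment> \<open>Up to \<open>real k * mesh n\<close> the path is outside 0, so an age can only
      have accumulated since then. For k = 0 no such time is available and the age is bounded by the
      elapsed time.\<close>
    have age: "age 0 w r \<le> mesh n" if r: "0 \<le> r" "r \<le> ?g" for r
    proof -
      consider "r < real k * mesh n" | "k = 0" | "real k * mesh n \<le> r" "0 < real k * mesh n"
        using mesh_bounds(1)[of n] by (cases "k = 0") (auto, meson not_less)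
      then show ?thesis
      proof cases
        case 1 then show ?thesis using nz[OF r(1)] mesh_bounds(1)[of n] by (simp add: age_eq)
      next
        case 2 then show ?thesis using age0_le[OF r(1), of w] r by simp
      next
        case 3 then show ?thesis using age_le_since[of "real k * mesh n" r w 0] nz r g by simp
      qed
    qed
    have a: "alive 0 w ?g" unfolding alive_def
    proof
      fix r assume "r \<in> {0..?g}"
      then show "age 0 w r < 1" using age[of r] mesh_bounds[of n] by simp
    qed
    have u: "0 \<le> age 0 w ?g" "age 0 w ?g \<le> mesh n"
      using age[OF g(1) order_refl] age_nonneg[OF order_refl g(1), of w] by blast+
    then have u1: "age 0 w ?g < 1" "1 - mesh n \<le> 1 - age 0 w ?g" using mesh_bounds(2)[of n] by linarith+
    have "\<not> stay (1 - age 0 w ?g) (shift ?g w)" using B(2) stay_antimono[OF _ u1(2)] by blast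
    then have "alive (age 0 w ?g) (shift ?g w) t"
      using alive_holding[OF u(1) u1(1), of "shift ?g w" t] B(1) by blast
    then have "alive 0 w (?g + t)" using alive_flow[OF g(1), of t 0 w] a t by (simp only:)
    then show ?thesis by (rule alive_antimono) (use g in simp)
  qed
  have ge: "measure (Q j) (\<Union>k. first_grid S n k) * c n \<le> surv (excursion j) t" for n
  proof -
    let ?g = "\<lambda>k. real (Suc k) * mesh n"
    let ?B = "\<lambda>w. alive 0 w t \<and> \<not> stay (1 - mesh n) w"
    have g: "0 \<le> ?g k" for k using mesh_bounds(1)[of n] by simp
    have mS: "{w \<in> first_grid S n k. ?B (shift (?g k) w)} \<in> sets (path_space S)" for k
    proof -
      have "{w \<in> paths S. w \<in> first_grid S n k \<and> ?B (shift (?g k) w)} \<in> sets (path_space S)"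
        by (intro sets_Collect_path pred_intros_logic(3) measurable_compose[OF measurable_shift pB]) (use g in auto)
      moreover have "{w \<in> paths S. w \<in> first_grid S n k \<and> ?B (shift (?g k) w)} = {w \<in> first_grid S n k. ?B (shift (?g k) w)}"
        unfolding first_grid_def by blast
      ultimately show ?thesis by simp
    qed
    have "emeasure (Q j) (\<Union>k. first_grid S n k) * ennreal (c n) = (\<Sum>k. emeasure (Q j) (first_grid S n k)) * ennreal (c n)"
      by (subst suminf_emeasure) (auto intro: disjoint_first_grid)
    also have "\<dots> = (\<Sum>k. emeasure (Q j) (first_grid S n k) * emeasure (Q 0) {w \<in> paths S. ?B w})"
      unfolding c_def Q0.emeasure_eq_measure by (rule ennreal_suminf_multc[symmetric])
    also have "\<dots> = (\<Sum>k. emeasure (Q j) {w \<in> first_grid S n k. ?B (shift (?g k) w)})"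
      by (simp only: first_grid_markov[OF j pB])
    also have "\<dots> = emeasure (Q j) (\<Union>k. {w \<in> first_grid S n k. ?B (shift (?g k) w)})"
      using mS disjoint_first_grid[of S n] by (intro suminf_emeasure) (auto simp: disjoint_family_on_def)
    also have "\<dots> \<le> emeasure (Q j) {w \<in> paths S. alive 0 w t}"
    proof (rule emeasure_mono)
      show "(\<Union>k. {w \<in> first_grid S n k. ?B (shift (?g k) w)}) \<subseteq> {w \<in> paths S. alive 0 w t}"
      proof
        fix w assume "w \<in> (\<Union>k. {w \<in> first_grid S n k. ?B (shift (?g k) w)})"
        then obtain k where k: "w \<in> first_grid S n k" "?B (shift (?g k) w)" by blast
        then have "w \<in> paths S" unfolding first_grid_def by blast
        then show "w \<in> {w \<in> paths S. alive 0 w t}" using incl[OF k(1)] k(2) by blast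
      qed
    qed (use mA in simp)
    finally show ?thesis unfolding surv_def c_def Qj.emeasure_eq_measure
      by (simp add: discrete_inverse flip: ennreal_mult)
  qed
  \<comment> \<open>For t \<ge> 1 survival forces an exit from 0 by time 1. What is lost by
    demanding an exit by 1 - \<open>mesh n\<close> is at most the probability of leaving in between,
    a difference of two exponentials.\<close>
  have cn: "F t - (exp (q 0 0 * (1 - mesh n)) - exp (q 0 0 * 1)) \<le> c n" for n
  proof -
    have ms: "{w \<in> paths S. stay b w} \<in> sets (Q 0)" if "0 \<le> b" for b
      using sets_Collect_path[OF pred_stay[OF that]] by simp
    have "F t \<le> measure (Q 0) ({w \<in> paths S. alive 0 w t \<and> \<not> stay (1 - mesh n) w} \<union>
        ({w \<in> paths S. stay (1 - mesh n) w} - {w \<in> paths S. stay 1 w}))"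
      unfolding F_eq
      by (rule Q0.finite_measure_mono)
        (use not_stay_of_alive[OF _ t] sets_Collect_path[OF pB] ms m1 in auto)
    also have "\<dots> \<le> c n + measure (Q 0) ({w \<in> paths S. stay (1 - mesh n) w} - {w \<in> paths S. stay 1 w})"
      unfolding c_def by (rule measure_Un_le) (use sets_Collect_path[OF pB] ms m1 in auto)
    also have "measure (Q 0) ({w \<in> paths S. stay (1 - mesh n) w} - {w \<in> paths S. stay 1 w}) = exp (q 0 0 * (1 - mesh n)) - exp (q 0 0 * 1)"
      by (subst Q0.finite_measure_Diff)
        (use ms m1 mesh_bounds[of n] stay_prob[of 1] stay_prob[OF m1] in \<open>auto elim: stay_antimono\<close>)
    finally show ?thesis by simp
  qed
  have "(\<lambda>n. measure (Q j) (\<Union>k. first_grid S n k) * (F t - (exp (q 0 0 * (1 - mesh n)) - exp (q 0 0 * 1)))) \<longlonglongrightarrow>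
     1 * (F t - (exp (q 0 0 * (1 - 0)) - exp (q 0 0 * 1)))"
    by (intro tendsto_intros first_grid_lim[OF fin] mesh_lim)
  then have "(\<lambda>n. measure (Q j) (\<Union>k. first_grid S n k) * (F t - (exp (q 0 0 * (1 - mesh n)) - exp (q 0 0 * 1)))) \<longlonglongrightarrow> F t"
    by simp
  then show ?thesis
  proof (rule LIMSEQ_le_const2)
    show "\<exists>N. \<forall>n\<ge>N. measure (Q j) (\<Union>k. first_grid S n k) * (F t - (exp (q 0 0 * (1 - mesh n)) - exp (q 0 0 * 1))) \<le> surv (excursion j) t"
      using ge cn by (meson measure_nonneg mult_left_mono order_trans)
  qed
qed

end


section \<open>Asymptotics of the survival probabilities\<close>

locale subexponential_chain = markov_chain S q P X
  for S :: "nat set" and q :: "nat \<Rightarrow> nat \<Rightarrow> real" and P :: "nat \<Rightarrow> 'w measure" and X :: "real \<Rightarrow> 'w \<Rightarrow> nat" +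
  fixes i :: nat
  assumes irreducible: "irreducible_chain S P X"
    and irreducible_killed: "irreducible_killed S P X"
    and i: "i \<in> S - {0}"
    and muC_pos: "0 < muC P X i"
    and subexponential: "subexponential (tau_distribution P X)"
begin

text \<open>Otherwise \<open>stay_prob\<close> would make 0 absorbing, while irreducibility leads
  from 0 to i with positive probability.\<close>

lemma q00_neg: "q 0 0 < 0"
proof -
  interpret Q0: prob_space "Q 0" by (rule prob_space_Q)
  obtain t where t: "t \<ge> 0" "0 < trans_prob P X t 0 i"
    using irreducible zero_state i unfolding irreducible_chain_def by blast
  have m: "{w \<in> paths S. w t = i} \<in> sets (path_space S)"
    by (intro sets_Collect_path pred_count_space_const1 measurable_coordinate t)
  have ms: "{w \<in> paths S. stay t w} \<in> sets (path_space S)"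
    by (rule sets_Collect_path[OF pred_stay[OF t(1)]])
  have "0 < measure (Q 0) {w \<in> paths S. w t = i}"
    using t unfolding Q_Collect[OF zero_state m] trans_prob_def by simp
  moreover have "measure (Q 0) {w \<in> paths S. w t = i} + measure (Q 0) {w \<in> paths S. stay t w} =
      measure (Q 0) ({w \<in> paths S. w t = i} \<union> {w \<in> paths S. stay t w})"
    using m ms i t by (intro Q0.finite_measure_Union[symmetric]) (auto simp: stay_def)
  moreover have "\<dots> \<le> 1" by (rule Q0.prob_le_1)
  ultimately have "exp (q 0 0 * t) < 1" unfolding stay_prob[OF t(1)] by linarith
  then show ?thesis using t by (simp add: mult_less_0_iff)
qed

section \<open>Exponential tails of the hitting time of 0\<close>

definition hit_tail :: "nat \<Rightarrow> real \<Rightarrow> real" where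
  "hit_tail j t = measure (Q j) {w \<in> paths S. ereal t < hit0 w}"

lemma sets_hit_tail: "{w \<in> paths S. ereal t < hit0 w} \<in> sets (path_space S)"
  by (rule sets_Collect_path) measurable

lemma tau0_path: "tau0 X \<omega> = hit0 (\<lambda>t\<in>{0..}. X t \<omega>)"
  unfolding tau0_def hit0_def first_time_def by (intro arg_cong[of _ _ Inf]) auto

lemma hit_tail_eq:
  assumes "j \<in> S"
  shows "hit_tail j t = measure (P j) {\<omega> \<in> space (P j). ereal t < tau0 X \<omega>}"
  unfolding hit_tail_def tau0_path by (rule Q_Collect[OF assms sets_hit_tail])

lemma hit_tail_antimono: "s \<le> t \<Longrightarrow> hit_tail j t \<le> hit_tail j s"
proof -
  assume st: "s \<le> t"
  interpret Qj: prob_space "Q j" by (rule prob_space_Q)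
  have st': "ereal s \<le> ereal t" using st by simp
  show ?thesis unfolding hit_tail_def
    using sets_hit_tail le_less_trans[OF st'] by (intro Qj.finite_measure_mono) auto
qed

lemma hit_tail_le_1: "hit_tail j t \<le> 1"
  unfolding hit_tail_def by (rule prob_space.prob_le_1[OF prob_space_Q])

text \<open>For a \<delta> below \<open>muC\<close> the weighted tail integral is finite. The tail
  is decreasing, so its value at t is controlled by the integral over [t - 1, t]. The factor exp
  \<delta> in the constant pays for this unit window, and \<open>max J 1\<close> covers t <
  1.\<close>

lemma hit_tail_exp_i: "\<exists>\<delta>>0. \<exists>C. \<forall>t\<ge>0. hit_tail i t \<le> C * exp (- \<delta> * t)"
proof -
  obtain \<delta> where \<delta>: "0 < \<delta>" "ereal \<delta> < muC P X i"
    using ereal_dense2[OF muC_pos] by (metis ereal_less(2))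
  define I where "I = (\<integral>\<^sup>+t\<in>{0..}. ennreal (hit_tail i t * exp (\<delta> * t)) \<partial>lborel)"
  have "I \<noteq> \<infinity>"
  proof
    assume "I = \<infinity>"
    then have "muC P X i \<le> ereal \<delta>"
      unfolding muC_def I_def using hit_tail_eq[of i] i by (intro Inf_lower) auto
    then show False using \<delta>(2) by simp
  qed
  then obtain J where J: "I = ennreal J" "0 \<le> J" by (cases I) auto
  have "hit_tail i t \<le> (max J 1 * exp \<delta>) * exp (- \<delta> * t)" if t: "0 \<le> t" for t
  proof (cases "t < 1")
    case True
    then have "1 \<le> exp (\<delta> * (1 - t))" using \<delta>(1) by simp
    also have "\<dots> \<le> max J 1 * exp (\<delta> * (1 - t))" by simp
    also have "\<dots> = (max J 1 * exp \<delta>) * exp (- \<delta> * t)" by (simp add: exp_add[symmetric] algebra_simps)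
    finally show ?thesis using hit_tail_le_1[of i t] by linarith
  next
    case False
    have "ennreal (hit_tail i t * exp (\<delta> * (t - 1))) = (\<integral>\<^sup>+r. ennreal (hit_tail i t * exp (\<delta> * (t - 1))) * indicator {t-1..t} r \<partial>lborel)"
      by (subst nn_integral_cmult_indicator) auto
    also have "\<dots> \<le> I" unfolding I_def
    proof (intro nn_integral_mono)
      fix r
      show "ennreal (hit_tail i t * exp (\<delta> * (t - 1))) * indicator {t-1..t} r \<le> ennreal (hit_tail i r * exp (\<delta> * r)) * indicator {0..} r"
      proof (cases "r \<in> {t-1..t}")
        case True
        then have "hit_tail i t \<le> hit_tail i r" by (intro hit_tail_antimono) simp
        moreover have "exp (\<delta> * (t - 1)) \<le> exp (\<delta> * r)" using True \<delta>(1) by simp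
        moreover have "0 \<le> hit_tail i r" unfolding hit_tail_def by simp
        ultimately have "hit_tail i t * exp (\<delta> * (t - 1)) \<le> hit_tail i r * exp (\<delta> * r)"
          by (intro mult_mono) auto
        then show ?thesis using True False by (simp add: ennreal_leI)
      qed simp
    qed
    finally have "hit_tail i t * exp (\<delta> * (t - 1)) \<le> J" unfolding J(1) using J(2) by (simp add: ennreal_le_iff)
    then have "hit_tail i t * exp (\<delta> * (t - 1)) * exp (\<delta> * (1 - t)) \<le> max J 1 * exp (\<delta> * (1 - t))"
      by (intro mult_right_mono) auto
    moreover have "hit_tail i t * exp (\<delta> * (t - 1)) * exp (\<delta> * (1 - t)) = hit_tail i t"
      by (simp add: mult.assoc exp_add[symmetric] algebra_simps)
    moreover have "max J 1 * exp (\<delta> * (1 - t)) = (max J 1 * exp \<delta>) * exp (- \<delta> * t)"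
      by (simp add: exp_add[symmetric] algebra_simps)
    ultimately show ?thesis by linarith
  qed
  then show ?thesis using \<delta>(1) by blast
qed

text \<open>\<open>muC\<close> is given for the single state i. Going from i to j without visiting 0
  within time s, with probability c > 0, and then avoiding 0 for time t is one way of avoiding 0 for
  time s + t, so the tail from j is at most the tail from i divided by c.\<close>

lemma hit_tail_exp:
  assumes j: "j \<in> S - {0}"
  shows "\<exists>\<delta>>0. \<exists>C. \<forall>t\<ge>0. hit_tail j t \<le> C * exp (- \<delta> * t)"
proof -
  obtain \<delta> C where \<delta>: "\<delta> > 0" and C: "\<And>t. t \<ge> 0 \<Longrightarrow> hit_tail i t \<le> C * exp (- \<delta> * t)"
    using hit_tail_exp_i by blast
  obtain s where s: "s \<ge> 0" and pos: "0 < measure (P i) {\<omega> \<in> space (P i). X s \<omega> = j \<and> ereal s < tau0 X \<omega>}"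
    using irreducible_killed i j unfolding irreducible_killed_def by blast
  have inv: "ereal s < hit0 (stop s w) \<longleftrightarrow> ereal s < hit0 w" if w: "w \<in> paths S" for w
    using hit0_gt_iff[OF w s] hit0_gt_iff[OF stop_paths[OF w s] s] by simp
  define c where "c = measure (Q i) {w \<in> paths S. ereal s < hit0 (stop s w) \<and> w s = j}"
  have c: "0 < c"
  proof -
    have "Measurable.pred (path_space S) (\<lambda>w. w s = j)"
      by (intro pred_count_space_const1 measurable_coordinate s)
    then have m: "{w \<in> paths S. w s = j \<and> ereal s < hit0 w} \<in> sets (path_space S)"
      by (intro sets_Collect_path pred_intros_logic borel_measurable_pred_less measurable_hit0 borel_measurable_const)
    have "0 < measure (Q i) {w \<in> paths S. w s = j \<and> ereal s < hit0 w}"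
      using pos s i unfolding tau0_path by (simp add: Q_Collect[OF _ m])
    also have "{w \<in> paths S. w s = j \<and> ereal s < hit0 w} = {w \<in> paths S. ereal s < hit0 (stop s w) \<and> w s = j}"
      using inv by blast
    finally show ?thesis unfolding c_def .
  qed
  have "hit_tail j t \<le> (C * exp (- \<delta> * s) / c) * exp (- \<delta> * t)" if t: "t \<ge> 0" for t
  proof -
    have p: "Measurable.pred (path_space S) (\<lambda>w. ereal r < hit0 w)" for r
      by (intro borel_measurable_pred_less measurable_hit0 borel_measurable_const)
    have "c * hit_tail j t = measure (Q i) {w \<in> paths S. ereal s < hit0 (stop s w) \<and> w s = j \<and> ereal t < hit0 (shift s w)}"
      unfolding c_def hit_tail_def by (rule markov_measure[symmetric]) (use i j s p in auto)
    also have "\<dots> \<le> hit_tail i (s + t)"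
    proof -
      interpret Qi: prob_space "Q i" by (rule prob_space_Q)
      have "ereal (s + t) < hit0 w" if w: "w \<in> paths S" "ereal s < hit0 (stop s w)" "ereal t < hit0 (shift s w)" for w
      proof -
        have a: "\<forall>r\<in>{0..s}. w r \<noteq> 0" using w hit0_gt_iff[OF w(1) s] inv[OF w(1)] by blast
        have b: "\<forall>r\<in>{0..t}. shift s w r \<noteq> 0" using hit0_gt_iff[OF shift_paths[OF w(1) s] t] w(3) by blast
        have "w r \<noteq> 0" if "r \<in> {0..s+t}" for r
          using a bspec[OF b, of "r - s"] that by (cases "r \<le> s") auto
        then show ?thesis using hit0_gt_iff[OF w(1), of "s + t"] s t by simp
      qed
      then show ?thesis unfolding hit_tail_def using sets_hit_tail by (intro Qi.finite_measure_mono) auto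
    qed
    also have "\<dots> \<le> C * exp (- \<delta> * (s + t))" using C s t by simp
    also have "\<dots> = C * exp (- \<delta> * s) * exp (- \<delta> * t)" by (simp add: exp_add[symmetric] algebra_simps)
    finally show ?thesis using c by (simp add: field_simps)
  qed
  then show ?thesis using \<delta> by blast
qed

lemma hit0_finite:
  assumes j: "j \<in> S - {0}"
  shows "AE w in Q j. hit0 w < \<infinity>"
proof -
  interpret Qj: prob_space "Q j" by (rule prob_space_Q)
  obtain \<delta> C where \<delta>: "\<delta> > 0" and C: "\<And>t. t \<ge> 0 \<Longrightarrow> hit_tail j t \<le> C * exp (- \<delta> * t)"
    using hit_tail_exp[OF j] by blast
  have m: "{w \<in> paths S. hit0 w = \<infinity>} \<in> sets (path_space S)" by (rule sets_Collect_path) measurable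
  have le: "measure (Q j) {w \<in> paths S. hit0 w = \<infinity>} \<le> C * exp (- \<delta> * real n)" for n
  proof -
    have "measure (Q j) {w \<in> paths S. hit0 w = \<infinity>} \<le> hit_tail j (real n)"
      unfolding hit_tail_def using sets_hit_tail by (intro Qj.finite_measure_mono) auto
    then show ?thesis using C[of "real n"] by linarith
  qed
  have "(\<lambda>n. C * exp (- \<delta> * real n)) \<longlonglongrightarrow> 0" using \<delta> by real_asymp
  then have "measure (Q j) {w \<in> paths S. hit0 w = \<infinity>} \<le> 0"
    by (rule LIMSEQ_le_const) (use le in auto)
  then have "measure (Q j) {w \<in> paths S. hit0 w = \<infinity>} = 0" by (rule antisym) (rule measure_nonneg)
  then have "{w \<in> paths S. hit0 w = \<infinity>} \<in> null_sets (Q j)" using m by (auto simp: null_sets_def Qj.emeasure_eq_measure)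
  then show ?thesis by (rule AE_I') auto
qed

text \<open>Half of the decay rate is spent on the moment and half on convergence: summing over the
  integers n < hit0 leaves a geometric series with ratio exp(- a). The separate term exp a covers
  hit0 = 0, which exceeds no integer level.\<close>

lemma hit0_exp_moment:
  assumes j: "j \<in> S - {0}"
  shows "\<exists>a>0. integrable (Q j) (\<lambda>w. exp (a * real_of_ereal (hit0 w)))"
proof -
  interpret Qj: prob_space "Q j" by (rule prob_space_Q)
  obtain \<delta> C where \<delta>: "\<delta> > 0" and C: "\<And>t. t \<ge> 0 \<Longrightarrow> hit_tail j t \<le> C * exp (- \<delta> * t)"
    using hit_tail_exp[OF j] by blast
  define a where "a = \<delta> / 2"
  have a: "a > 0" "a - \<delta> = - a" using \<delta> unfolding a_def by (auto simp: field_simps)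
  have single_le: "g n \<le> (\<Sum>n. g n)" for g :: "nat \<Rightarrow> ennreal" and n
    using sum_le_suminf[of g "{n}"] by simp
  have C0: "0 \<le> C" using C[of 0] measure_nonneg[of "Q j"] unfolding hit_tail_def by (metis mult_zero_right exp_zero mult.right_neutral order_refl order_trans)
  have "(\<integral>\<^sup>+w. ennreal (exp (a * real_of_ereal (hit0 w))) \<partial>Q j) \<le>
      (\<integral>\<^sup>+w. ennreal (exp a) + (\<Sum>n. ennreal (exp (a * (real n + 1))) * indicator {w \<in> paths S. ereal (real n) < hit0 w} w) \<partial>Q j)"
  proof (rule nn_integral_mono_AE, use hit0_finite[OF j] AE_space in eventually_elim)
    case (elim w)
    then obtain r where r: "hit0 w = ereal r" "0 \<le> r" using hit0_nonneg[of w] by (cases "hit0 w") auto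
    show ?case
    proof (cases "r = 0")
      case True
      then have "ennreal (exp (a * real_of_ereal (hit0 w))) \<le> ennreal (exp a)" using r a by simp
      then show ?thesis by (meson add_increasing2 order_refl order_trans zero_le)
    next
      case False
      \<comment> \<open>The ceiling minus one gives n < r \<le> n + 1, strict on the left as the
        definition of \<open>hit_tail\<close> requires.\<close>
      define n where "n = nat (\<lceil>r\<rceil> - 1)"
      have "1 \<le> \<lceil>r\<rceil>" using False r by (simp add: le_ceiling_iff)
      then have n: "real n < r" "r \<le> real n + 1" unfolding n_def by linarith+
      let ?f = "\<lambda>n. ennreal (exp (a * (real n + 1))) * indicator {w \<in> paths S. ereal (real n) < hit0 w} w"
      have "ennreal (exp (a * real_of_ereal (hit0 w))) \<le> ?f n"
        using n r a elim by (auto intro!: ennreal_leI)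
      also have "?f n \<le> (\<Sum>n. ?f n)" by (rule single_le)
      also have "\<dots> \<le> ennreal (exp a) + (\<Sum>n. ?f n)" by (rule add_increasing) auto
      finally show ?thesis .
    qed
  qed
  also have "\<dots> = ennreal (exp a) + (\<Sum>n. ennreal (exp (a * (real n + 1))) * ennreal (hit_tail j (real n)))"
  proof -
    have m: "{w \<in> paths S. ereal (real n) < hit0 w} \<in> sets (Q j)" for n using sets_hit_tail by simp
    have "(\<integral>\<^sup>+w. (\<Sum>n. ennreal (exp (a * (real n + 1))) * indicator {w \<in> paths S. ereal (real n) < hit0 w} w) \<partial>Q j) =
      (\<Sum>n. \<integral>\<^sup>+w. ennreal (exp (a * (real n + 1))) * indicator {w \<in> paths S. ereal (real n) < hit0 w} w \<partial>Q j)"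
      by (intro nn_integral_suminf borel_measurable_times_ennreal borel_measurable_const borel_measurable_indicator m)
    also have "\<dots> = (\<Sum>n. ennreal (exp (a * (real n + 1))) * ennreal (hit_tail j (real n)))"
      using m by (simp add: nn_integral_cmult_indicator hit_tail_def Qj.emeasure_eq_measure)
    finally show ?thesis using m Qj.emeasure_space_1 
      by (subst nn_integral_add) (auto simp: Qj.emeasure_space_1[simplified])
  qed
  also have "\<dots> \<le> ennreal (exp a) + (\<Sum>n. ennreal (C * exp a * exp (- a) ^ n))"
  proof (intro add_left_mono suminf_le summableI)
    fix n
    have "exp (a * (real n + 1)) * hit_tail j (real n) \<le> exp (a * (real n + 1)) * (C * exp (- \<delta> * real n))"
      by (intro mult_left_mono C) auto
    also have "\<dots> = C * exp a * exp ((a - \<delta>) * real n)" by (simp add: exp_add[symmetric] algebra_simps)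
    also have "\<dots> = C * exp a * exp (- a) ^ n" unfolding a by (simp add: exp_of_nat_mult[symmetric] mult.commute)
    finally show "ennreal (exp (a * (real n + 1))) * ennreal (hit_tail j (real n)) \<le> ennreal (C * exp a * exp (- a) ^ n)"
      by (simp add: ennreal_mult[symmetric] ennreal_leI hit_tail_def)
  qed
  also have "(\<Sum>n. ennreal (C * exp a * exp (- a) ^ n)) = ennreal (\<Sum>n. C * exp a * exp (- a) ^ n)"
    using C0 a by (intro suminf_ennreal2 summable_mult summable_geometric) auto
  also have "ennreal (exp a) + \<dots> < \<infinity>" by simp
  finally have "integrable (Q j) (\<lambda>w. exp (a * real_of_ereal (hit0 w)))"
    by (intro integrableI_bounded) (auto simp: measurable_cong_sets[OF sets_Q refl])
  then show ?thesis using a by blast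
qed

section \<open>Almost sure finiteness of \<open>tau\<close>\<close>

definition immortal :: "(real \<Rightarrow> nat) \<Rightarrow> bool" where
  "immortal w \<longleftrightarrow> (\<forall>n. alive 0 w (real n))"

lemma pred_immortal [measurable]: "Measurable.pred (path_space S) immortal"
proof -
  have "Measurable.pred (path_space S) (\<lambda>w. \<forall>n. alive 0 w (real n))" by measurable
  then show ?thesis unfolding immortal_def[abs_def] .
qed

text \<open>The shifted path restarts with age 0 in place of the age reached at d, and a smaller age
  only helps survival.\<close>

lemma immortal_shift:
  assumes "immortal w" "0 \<le> d" shows "immortal (shift d w)"
  unfolding immortal_def
proof
  fix n
  obtain N :: nat where "d + real n \<le> real N" using real_arch_simple by blast
  then have "alive 0 w (d + real n)" using assms(1) alive_antimono unfolding immortal_def by blast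
  then have "alive (age 0 w d) (shift d w) (real n)" using alive_flow[OF assms(2), of "real n" 0 w] by simp
  then show "alive 0 (shift d w) (real n)" by (rule alive_mono_age) (use age_nonneg assms in simp)
qed

text \<open>Let \<rho> be the probability of immortality from 0. From any other state 0 is hit first
  and immortality is inherited, so \<rho> is an upper bound there too. From 0 an immortal path must
  leave 0 by time 1, and restarting at time 1 gives \<rho> \<le> \<rho> (1 - exp(q00)), hence \<rho>
  = 0.\<close>

lemma immortal_null: "measure (Q j) {w \<in> paths S. immortal w} = 0" if j: "j \<in> S"
proof -
  interpret Q0: prob_space "Q 0" by (rule prob_space_Q)
  let ?\<rho> = "measure (Q 0) {w \<in> paths S. immortal w}"
  have le: "measure (Q j) {w \<in> paths S. immortal w} \<le> ?\<rho>" if j: "j \<in> S" for j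
  proof (cases "j = 0")
    case False
    interpret Qj: prob_space "Q j" by (rule prob_space_Q)
    have "ennreal (measure (Q j) {w \<in> paths S. immortal w}) \<le> (\<integral>\<^sup>+w. ennreal ?\<rho> \<partial>Q j)"
      by (rule hit_upper[where \<beta> = "\<lambda>_. ?\<rho>" and B = "\<lambda>_. immortal"])
        (use j False hit0_finite immortal_shift in \<open>auto simp: mono_def\<close>)
    then show ?thesis using Qj.emeasure_space_1 by (simp add: ennreal_le_iff)
  qed simp
  have mI: "{w \<in> paths S. immortal w} \<in> sets (Q j)" for j using sets_Collect_path[OF pred_immortal] by simp
  have ms: "{w \<in> paths S. stay 1 w} \<in> sets (path_space S)" by (rule sets_Collect_path[OF pred_stay]) simp
  define G :: "(real \<Rightarrow> nat) \<times> (real \<Rightarrow> nat) \<Rightarrow> ennreal" where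
    "G = (\<lambda>(v, w). indicator {v \<in> paths S. \<not> stay 1 v} v * indicator {w \<in> paths S. immortal w} w)"
  have nst: "{v \<in> paths S. \<not> stay 1 v} = space (path_space S) - {w \<in> paths S. stay 1 w}" by auto
  have mn: "{v \<in> paths S. \<not> stay 1 v} \<in> sets (path_space S)" unfolding nst using ms by (rule sets.Diff[OF sets.top])
  have G: "G \<in> borel_measurable (path_space S \<Otimes>\<^sub>M path_space S)"
    unfolding G_def using mn mI[of 0] by simp
  have "ennreal ?\<rho> = (\<integral>\<^sup>+w. indicator {w \<in> paths S. immortal w} w \<partial>Q 0)"
    using mI[of 0] by (simp add: nn_integral_indicator Q0.emeasure_eq_measure)
  also have "\<dots> \<le> (\<integral>\<^sup>+w. G (stop 1 w, shift 1 w) \<partial>Q 0)"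
  proof (rule nn_integral_mono)
    fix w assume "w \<in> space (Q 0)"
    then have w: "w \<in> paths S" by simp
    have st: "stay 1 (stop 1 w) \<longleftrightarrow> stay 1 w" unfolding stay_def by (auto simp: min_absorb1)
    have "\<not> stay 1 w" if "immortal w"
    proof -
      have "alive 0 w (real 1)" using that unfolding immortal_def by blast
      then show ?thesis by (rule not_stay_of_alive) simp
    qed
    then show "indicator {w \<in> paths S. immortal w} w \<le> G (stop 1 w, shift 1 w)"
      unfolding G_def using w immortal_shift[of w 1] shift_paths[OF w] stop_paths[OF w] st by (auto simp: indicator_def)
  qed
  also have "\<dots> = (\<integral>\<^sup>+w. (\<integral>\<^sup>+w'. G (stop 1 w, w') \<partial>Q (w 1)) \<partial>Q 0)"
    by (rule markov_nn_integral[OF zero_state _ G]) simp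
  also have "\<dots> \<le> (\<integral>\<^sup>+w. ennreal ?\<rho> * indicator {w \<in> paths S. \<not> stay 1 w} w \<partial>Q 0)"
  proof (rule nn_integral_mono)
    fix w assume "w \<in> space (Q 0)"
    then have w: "w \<in> paths S" by simp
    interpret Qw: prob_space "Q (w 1)" by (rule prob_space_Q)
    have st: "stay 1 (stop 1 w) \<longleftrightarrow> stay 1 w" unfolding stay_def by (auto simp: min_absorb1)
    have "(\<integral>\<^sup>+w'. G (stop 1 w, w') \<partial>Q (w 1)) = indicator {v \<in> paths S. \<not> stay 1 v} (stop 1 w) * emeasure (Q (w 1)) {w \<in> paths S. immortal w}"
      unfolding G_def using mI by (simp add: nn_integral_cmult)
    also have "\<dots> \<le> indicator {v \<in> paths S. \<not> stay 1 v} (stop 1 w) * ennreal ?\<rho>"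
      unfolding Qw.emeasure_eq_measure by (intro mult_left_mono ennreal_leI le paths_state[OF w]) auto
    also have "\<dots> = ennreal ?\<rho> * indicator {w \<in> paths S. \<not> stay 1 w} w"
      using st stop_paths[OF w] w by (auto simp: indicator_def)
    finally show "(\<integral>\<^sup>+w'. G (stop 1 w, w') \<partial>Q (w 1)) \<le> ennreal ?\<rho> * indicator {w \<in> paths S. \<not> stay 1 w} w" .
  qed
  also have "\<dots> = ennreal ?\<rho> * ennreal (1 - exp (q 0 0))"
  proof -
    have "measure (Q 0) (space (Q 0) - {w \<in> paths S. stay 1 w}) = 1 - exp (q 0 0)"
      using ms stay_prob[of 1] by (subst Q0.prob_compl) auto
    then show ?thesis using mn by (subst nn_integral_cmult_indicator) (auto simp: Q0.emeasure_eq_measure nst)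
  qed
  also have "\<dots> = ennreal (?\<rho> * (1 - exp (q 0 0)))" using q00_neg by (simp add: ennreal_mult)
  finally have "?\<rho> \<le> ?\<rho> * (1 - exp (q 0 0))" using q00_neg by (simp add: ennreal_le_iff)
  then have "?\<rho> * exp (q 0 0) \<le> 0" by (simp add: algebra_simps)
  then have "?\<rho> \<le> 0" by (simp add: mult_le_0_iff)
  then show ?thesis using le[OF j] measure_nonneg[of "Q j"] by (meson antisym order_trans)
qed

lemma alive_path_iff: "alive u (\<lambda>t\<in>{0..}. x t) t \<longleftrightarrow> alive u x t"
  by (rule alive_cong) auto

lemma tau_gt_alive:
  assumes "j \<in> S" "\<omega> \<in> space (P j)" "0 \<le> t"
  shows "ereal t < tau X y \<omega> \<longleftrightarrow> alive (snd y) (\<lambda>t\<in>{0..}. X t \<omega>) t"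
  unfolding tau_def alive_path_iff
  by (rule tau_gt_iff[OF restrict_paths[OF cadlag_X[OF assms(1,2)]] assms(3)])

lemma tau_nonneg: "0 \<le> tau X y \<omega>"
  unfolding tau_def by (rule first_time_nonneg)

lemma measurable_tau:
  assumes "j \<in> S" "snd y \<in> {0..<1}"
  shows "tau X y \<in> borel_measurable (P j)"
proof (rule borel_measurable_ereal_time[where R = "\<lambda>t \<omega>. alive (snd y) (\<lambda>t\<in>{0..}. X t \<omega>) t"])
  show "Measurable.pred (P j) (\<lambda>\<omega>. alive (snd y) (\<lambda>t\<in>{0..}. X t \<omega>) t)" for t
    by (rule measurable_compose[OF measurable_path[OF assms(1)] pred_alive[OF assms(2)]])
qed (use tau_nonneg tau_gt_alive[OF assms(1)] in auto)

lemma AE_tau_finite: "AE \<omega> in P 0. tau X (holding 0) \<omega> < \<infinity>"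
proof -
  interpret P0: prob_space "P 0" by (rule prob_space_P[OF zero_state])
  have mI: "{w \<in> paths S. immortal w} \<in> sets (path_space S)" using sets_Collect_path[OF pred_immortal] by simp
  let ?N = "{\<omega> \<in> space (P 0). immortal (\<lambda>t\<in>{0..}. X t \<omega>)}"
  have "measure (P 0) ?N = 0" using immortal_null[OF zero_state] Q_Collect[OF zero_state mI] by simp
  moreover have "?N \<in> sets (P 0)"
    using measurable_compose[OF measurable_path[OF zero_state] pred_immortal] by (simp add: pred_def)
  ultimately have "?N \<in> null_sets (P 0)" by (auto simp: null_sets_def P0.emeasure_eq_measure)
  moreover have "{\<omega> \<in> space (P 0). \<not> tau X (holding 0) \<omega> < \<infinity>} \<subseteq> ?N"
    using tau_gt_alive[OF zero_state, where y = "holding 0"] unfolding immortal_def by force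
  ultimately show ?thesis by (rule AE_I')
qed

text \<open>\<open>real_of_ereal\<close> would send an infinite \<open>tau\<close> to 0, so almost
  sure finiteness is what identifies the two tails. For t < 0 both sides are 1.\<close>

lemma tau_distribution_tail: "measure (tau_distribution P X) {t<..} = F t"
proof -
  interpret P0: prob_space "P 0" by (rule prob_space_P[OF zero_state])
  have m: "(\<lambda>\<omega>. real_of_ereal (tau X (holding 0) \<omega>)) \<in> borel_measurable (P 0)"
    by (intro borel_measurable_real_of_ereal measurable_tau zero_state) simp
  have "measure (tau_distribution P X) {t<..} = measure (P 0) {\<omega> \<in> space (P 0). t < real_of_ereal (tau X (holding 0) \<omega>)}"
    unfolding tau_distribution_def using m by (subst measure_distr) (auto intro!: arg_cong2[of _ _ _ _ measure])
  also have "\<dots> = measure (P 0) {\<omega> \<in> space (P 0). alive 0 (\<lambda>t\<in>{0..}. X t \<omega>) t}"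
  proof (rule P0.finite_measure_eq_AE)
    show "AE \<omega> in P 0. (\<omega> \<in> {\<omega> \<in> space (P 0). t < real_of_ereal (tau X (holding 0) \<omega>)}) =
        (\<omega> \<in> {\<omega> \<in> space (P 0). alive 0 (\<lambda>t\<in>{0..}. X t \<omega>) t})"
      using AE_tau_finite AE_space
    proof eventually_elim
      case (elim \<omega>)
      then obtain r where r: "tau X (holding 0) \<omega> = ereal r" "0 \<le> r"
        using tau_nonneg[of "holding 0" \<omega>] by (cases "tau X (holding 0) \<omega>") auto
      show ?case
      proof (cases "0 \<le> t")
        case True then show ?thesis using tau_gt_alive[OF zero_state elim(2) True, of "holding 0"] r elim by simp
      next
        case False then show ?thesis using alive_neg[of t 0] r elim by simp
      qed
    qed
  qed (use m measurable_compose[OF measurable_path[OF zero_state] pred_alive00] in \<open>simp_all add: pred_def\<close>)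
  also have "\<dots> = F t" unfolding F_eq by (rule Q_Collect[OF zero_state sets_Collect_path[OF pred_alive00], symmetric])
  finally show ?thesis .
qed

lemma prob_tau_distribution: "prob_space (tau_distribution P X)"
  unfolding tau_distribution_def
  by (intro prob_space.prob_space_distr prob_space_P zero_state borel_measurable_real_of_ereal measurable_tau) simp

lemma F_pos: "0 < F t"
  using subexponential_long_tailed(1)[OF prob_tau_distribution _ subexponential, of t] tau_distribution_tail
  by (simp add: tau_distribution_def)

lemma F_long_tailed: "0 \<le> s \<Longrightarrow> ((\<lambda>t. F (t - s) / F t) \<longlongrightarrow> 1) at_top"
  using subexponential_long_tailed(2)[OF prob_tau_distribution _ subexponential, of s]
  unfolding tau_distribution_tail by (simp add: tau_distribution_def)

lemma F_antimono: "antimono F"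
  by (rule surv_antimono) simp

section \<open>Limits of the normalised survival probabilities\<close>

lemma exit_surv_ratio:
  assumes v: "0 < v" "v < 1"
  shows "((\<lambda>t. exit_surv v t / F t) \<longlongrightarrow> (1 - exp (q 0 0 * v)) / (1 - exp (q 0 0))) at_top"
proof -
  \<comment> \<open>The error of a time shift by c is squeezed between 0 and F(t - c) / F t - 1,
    which tends to 0 because \<open>F\<close> is long-tailed.\<close>
  have shift: "((\<lambda>t. exit_surv (1 - c) (t - c) / F t - exit_surv (1 - c) t / F t) \<longlongrightarrow> 0) at_top"
    if c: "0 < c" "c < 1" for c
  proof (rule tendsto_sandwich[OF _ _ tendsto_const])
    have "((\<lambda>t. F (t - c) / F t - 1) \<longlongrightarrow> 1 - 1) at_top"
      by (intro tendsto_intros F_long_tailed) (use c in simp)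
    then show "((\<lambda>t. F (t - c) / F t - 1) \<longlongrightarrow> 0) at_top" by simp
    have *: "0 \<le> exit_surv (1 - c) (t - c) - exit_surv (1 - c) t" "exit_surv (1 - c) (t - c) - exit_surv (1 - c) t \<le> F (t - c) - F t" for t
      using antimonoD[OF exit_surv_antimono, of "1 - c" "t - c" t] exit_surv_diff[of "1 - c" "t - c" t] c by simp_all
    show "\<forall>\<^sub>F t in at_top. 0 \<le> exit_surv (1 - c) (t - c) / F t - exit_surv (1 - c) t / F t"
    proof (intro always_eventually allI)
      fix t show "0 \<le> exit_surv (1 - c) (t - c) / F t - exit_surv (1 - c) t / F t"
        using divide_nonneg_pos[OF *(1)[of t] F_pos[of t]] by (simp only: diff_divide_distrib)
    qed
    show "\<forall>\<^sub>F t in at_top. exit_surv (1 - c) (t - c) / F t - exit_surv (1 - c) t / F t \<le> F (t - c) / F t - 1"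
    proof (intro always_eventually allI)
      fix t
      have "F (t - c) / F t - 1 = (F (t - c) - F t) / F t" using F_pos[of t] by (simp add: field_simps)
      then show "exit_surv (1 - c) (t - c) / F t - exit_surv (1 - c) t / F t \<le> F (t - c) / F t - 1"
        using *(2)[of t] F_pos[of t] by (simp add: diff_divide_distrib[symmetric] divide_right_mono)
    qed
  qed
  \<comment> \<open>With the shift errors as explicit terms, the renewal identities at v and at 1 -
    v become exact linear equations for x and y below.\<close>
  define E1 where "E1 t = exit_surv (1 - v) (t - v) / F t - exit_surv (1 - v) t / F t" for t
  define E2 where "E2 t = exit_surv v (t - (1 - v)) / F t - exit_surv v t / F t" for t
  have E: "(E1 \<longlongrightarrow> 0) at_top" "(E2 \<longlongrightarrow> 0) at_top"
    unfolding E1_def[abs_def] E2_def[abs_def] using shift[of v] shift[of "1 - v"] v by simp_all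
  let ?a = "exp (q 0 0 * v)" and ?b = "exp (q 0 0)"
  have b: "?b < 1" using q00_neg by simp
  have ev: "\<forall>\<^sub>F t in at_top. (1 - ?a + ?b * E2 t - ?a * E1 t) / (1 - ?b) = exit_surv v t / F t"
    using eventually_ge_at_top[of 1]
  proof eventually_elim
    case (elim t)
    define x y where "x = exit_surv v t / F t" and "y = exit_surv (1 - v) t / F t"
    have R1: "1 = x + ?a * (E1 t + y)"
    proof -
      have "1 = F t / F t" using F_pos[of t] by simp
      also have "F t / F t = exit_surv v t / F t + ?a * (exit_surv (1 - v) (t - v) / F t)"
        by (subst surv_renewal[of v t]) (use v elim in \<open>auto simp: add_divide_distrib\<close>)
      finally show ?thesis unfolding E1_def x_def y_def by simp
    qed
    have R2: "1 = y + exp (q 0 0 * (1 - v)) * (E2 t + x)"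
    proof -
      have "1 = F t / F t" using F_pos[of t] by simp
      also have "F t / F t = exit_surv (1 - v) t / F t + exp (q 0 0 * (1 - v)) * (exit_surv v (t - (1 - v)) / F t)"
        by (subst surv_renewal[of "1 - v" t]) (use v elim in \<open>auto simp: add_divide_distrib\<close>)
      finally show ?thesis unfolding E2_def x_def y_def by simp
    qed
    \<comment> \<open>Multiplying the second equation by exp(q00 v) turns its coefficient into
      exp(q00), which is free of v; subtracting the first equation then eliminates y.\<close>
    have ab: "?a * exp (q 0 0 * (1 - v)) = ?b" by (simp add: exp_add[symmetric] algebra_simps)
    have "?a = ?a * y + ?b * (E2 t + x)"
      using arg_cong[OF R2, of "\<lambda>x. ?a * x"] ab by (simp only: distrib_left mult.assoc[symmetric] mult_1_right)
    then have "(1 - ?b) * x = 1 - ?a + ?b * E2 t - ?a * E1 t"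
      using R1 by (simp add: algebra_simps)
    then have "(1 - ?a + ?b * E2 t - ?a * E1 t) / (1 - ?b) = x" using b by (simp add: field_simps)
    then show ?case unfolding x_def .
  qed
  have "((\<lambda>t. (1 - ?a + ?b * E2 t - ?a * E1 t) / (1 - ?b)) \<longlongrightarrow> (1 - ?a + ?b * 0 - ?a * 0) / (1 - ?b)) at_top"
    by (intro tendsto_intros E) (use b in simp)
  then show ?thesis using Lim_transform_eventually[OF _ ev] by simp
qed

abbreviation h :: "hat \<Rightarrow> real" where
  "h \<equiv> h_lim (- q 0 0)"

lemma h_excursion: "j \<noteq> 0 \<Longrightarrow> h (excursion j) = 1"
  unfolding h_lim_def by (simp add: discrete_inverse)

lemma h_holding: "h (holding u) = (1 - exp (q 0 0 * (1 - u))) / (1 - exp (q 0 0))"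
  unfolding h_lim_def by (simp add: discrete_inverse)

lemma hat_space_cases:
  assumes "y \<in> hat_space S"
  obtains j where "j \<in> S - {0}" "y = excursion j" | u where "u \<in> {0..<1}" "y = holding u"
  using assms unfolding hat_space_def by blast

lemma h_pos: "y \<in> hat_space S \<Longrightarrow> 0 < h y"
  by (erule hat_space_cases) (use q00_neg in \<open>auto simp: h_excursion h_holding mult_less_0_iff\<close>)

text \<open>In (0, u) with u > 0 this is \<open>exit_surv_ratio\<close> at v = 1 - u; for u = 0 the
  quotient is constantly 1. From j in C the survival probability lies, for t \<ge> 1, between F t
  and the expectation of F(t - hit0 - 1). Divided by F t, the latter integrand tends to 1 pointwise,
  and the exponential moment of \<open>hit0\<close> allows dominated convergence.\<close>

lemma surv_limit:
  assumes y: "y \<in> hat_space S"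
  shows "((\<lambda>t. surv y t / F t) \<longlongrightarrow> h y) at_top"
  using y
proof (cases rule: hat_space_cases)
  case (2 u)
  show ?thesis
  proof (cases "u = 0")
    case True
    then have "h y = 1" using 2 h_holding[of 0] q00_neg by simp
    moreover have "\<forall>\<^sub>F t in at_top. surv y t / F t = 1" using 2 True F_pos by (simp add: less_imp_neq[symmetric])
    ultimately show ?thesis by (simp only: tendsto_eventually)
  next
    case False
    then have "((\<lambda>t. exit_surv (1 - u) t / F t) \<longlongrightarrow> h y) at_top"
      using exit_surv_ratio[of "1 - u"] 2 h_holding[of u] by simp
    moreover have "\<forall>\<^sub>F t in at_top. exit_surv (1 - u) t / F t = surv y t / F t"
      using eventually_ge_at_top[of "1 - u"] by eventually_elim (use 2 surv_holding in simp)
    ultimately show ?thesis by (rule Lim_transform_eventually)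
  qed
next
  case (1 j)
  interpret Qj: prob_space "Q j" by (rule prob_space_Q)
  have hy: "h y = 1" using 1 h_excursion by simp
  obtain a where a: "a > 0" and int: "integrable (Q j) (\<lambda>w. exp (a * real_of_ereal (hit0 w)))"
    using hit0_exp_moment[OF 1(1)] by blast
  \<comment> \<open>The rate in the long-tail bound is chosen as the order a of the available
    moment, which makes the dominating function integrable.\<close>
  obtain C where C: "\<And>t r. 0 \<le> r \<Longrightarrow> F (t - r) \<le> C * exp (a * r) * F t"
    using long_tailed_exp_bound[OF F_antimono F_pos surv_le_1 F_long_tailed[of 1] a] by auto
  have h0: "0 \<le> real_of_ereal (hit0 w)" for w using hit0_nonneg[of w] by (cases "hit0 w") auto
  have Fm: "F \<in> borel_measurable borel"
  proof -
    have "mono (\<lambda>t. - F t)" using F_antimono by (auto simp: mono_def antimono_def)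
    from borel_measurable_uminus[OF borel_measurable_mono[OF this]] show ?thesis by simp
  qed
  have meas: "(\<lambda>w. F (t - real_of_ereal (hit0 w) - 1) / F t) \<in> borel_measurable (Q j)" for t
  proof -
    have "(\<lambda>w. t - real_of_ereal (hit0 w) - 1) \<in> borel_measurable (path_space S)" by measurable
    from measurable_compose[OF this Fm] show ?thesis by (simp add: measurable_cong_sets[OF sets_Q refl])
  qed
  have bound: "F (t - real_of_ereal (hit0 w) - 1) / F t \<le> C * exp a * exp (a * real_of_ereal (hit0 w))" for t w
  proof -
    have "F (t - (real_of_ereal (hit0 w) + 1)) \<le> C * exp (a * (real_of_ereal (hit0 w) + 1)) * F t"
      by (rule C) (use h0[of w] in simp)
    moreover have "C * exp (a * (real_of_ereal (hit0 w) + 1)) = C * exp a * exp (a * real_of_ereal (hit0 w))"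
      by (simp add: exp_add[symmetric] algebra_simps)
    ultimately have "F (t - real_of_ereal (hit0 w) - 1) \<le> C * exp a * exp (a * real_of_ereal (hit0 w)) * F t"
      by (simp only: diff_diff_eq)
    then show ?thesis using F_pos[of t] by (simp only: pos_divide_le_eq)
  qed
  have nn: "0 \<le> F (t - real_of_ereal (hit0 w) - 1) / F t" for t w by (simp add: surv_nonneg)
  have "((\<lambda>t. \<integral>w. F (t - real_of_ereal (hit0 w) - 1) / F t \<partial>Q j) \<longlongrightarrow> (\<integral>w. 1 \<partial>Q j)) at_top"
  proof (rule integral_dominated_convergence_at_top[where w = "\<lambda>w. C * exp a * exp (a * real_of_ereal (hit0 w))"])
    show "integrable (Q j) (\<lambda>w. C * exp a * exp (a * real_of_ereal (hit0 w)))" using int by simp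
    show "\<forall>\<^sub>F t in at_top. AE w in Q j. norm (F (t - real_of_ereal (hit0 w) - 1) / F t) \<le> C * exp a * exp (a * real_of_ereal (hit0 w))"
      using bound by (intro always_eventually allI AE_I2) (simp only: real_norm_def abs_of_nonneg[OF nn])
    show "AE w in Q j. ((\<lambda>t. F (t - real_of_ereal (hit0 w) - 1) / F t) \<longlongrightarrow> 1) at_top"
    proof (intro AE_I2)
      fix w show "((\<lambda>t. F (t - real_of_ereal (hit0 w) - 1) / F t) \<longlongrightarrow> 1) at_top"
        using F_long_tailed[of "real_of_ereal (hit0 w) + 1"] h0[of w] by (simp add: diff_diff_eq)
    qed
  qed (use meas in auto)
  then have lim: "((\<lambda>t. \<integral>w. F (t - real_of_ereal (hit0 w) - 1) / F t \<partial>Q j) \<longlongrightarrow> 1) at_top"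
    using Qj.prob_space by simp
  have up: "surv y t / F t \<le> (\<integral>w. F (t - real_of_ereal (hit0 w) - 1) / F t \<partial>Q j)" for t
  proof -
    have intF: "integrable (Q j) (\<lambda>w. F (t - real_of_ereal (hit0 w) - 1) / F t)"
      by (rule Bochner_Integration.integrable_bound[OF integrable_mult_right[OF int, of "C * exp a"] meas])
        (intro AE_I2, simp only: real_norm_def abs_of_nonneg[OF nn], rule order_trans[OF bound abs_ge_self])
    have "ennreal (measure (Q j) {w \<in> paths S. alive 0 w t}) \<le>
        (\<integral>\<^sup>+w. ennreal ((\<lambda>d. F (t - d)) (real_of_ereal (hit0 w) + 1)) \<partial>Q j)"
    proof (rule hit_upper[where B = "\<lambda>d w. alive 0 w (t - d)"])
      show "mono (\<lambda>d. F (t - d))" using F_antimono by (auto simp: mono_def antimono_def)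
      show "alive 0 (shift d w) (t - d)" if "0 \<le> d" "alive 0 w t" for w d
      proof (cases "d \<le> t")
        case True
        then have "alive (age 0 w d) (shift d w) (t - d)" using alive_flow[OF that(1), of "t - d" 0 w] that by simp
        then show ?thesis by (rule alive_mono_age) (use age_nonneg that in simp)
      next
        \<comment> \<open>For d > t the time t - d is negative, where survival is vacuous.\<close>
        case False then show ?thesis by (simp add: alive_neg)
      qed
    qed (use 1 hit0_finite F_eq in auto)
    also have "\<dots> = (\<integral>\<^sup>+w. ennreal (F t) * ennreal (F (t - real_of_ereal (hit0 w) - 1) / F t) \<partial>Q j)"
      using F_pos[of t] by (intro nn_integral_cong) (simp add: ennreal_mult[symmetric] surv_nonneg diff_diff_eq)
    also have "\<dots> = ennreal (F t) * ennreal (\<integral>w. F (t - real_of_ereal (hit0 w) - 1) / F t \<partial>Q j)"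
      using meas[of t] by (subst nn_integral_cmult) (auto simp: nn_integral_eq_integral[OF intF] nn)
    also have "\<dots> = ennreal (F t * (\<integral>w. F (t - real_of_ereal (hit0 w) - 1) / F t \<partial>Q j))"
      by (intro ennreal_mult[symmetric] surv_nonneg integral_nonneg_AE AE_I2 nn)
    finally have "surv y t \<le> F t * (\<integral>w. F (t - real_of_ereal (hit0 w) - 1) / F t \<partial>Q j)"
      unfolding 1(2) surv_excursion
      by (subst (asm) ennreal_le_iff) (auto intro!: mult_nonneg_nonneg surv_nonneg integral_nonneg_AE AE_I2 nn)
    then show ?thesis using F_pos[of t] by (simp add: field_simps)
  qed
  show ?thesis unfolding hy
  proof (rule tendsto_sandwich[OF _ _ tendsto_const lim])
    show "\<forall>\<^sub>F t in at_top. 1 \<le> surv y t / F t"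
      using eventually_ge_at_top[of 1]
    proof eventually_elim
      case (elim t)
      then show ?case using hit_lower[OF _ hit0_finite[OF 1(1)] elim] 1 F_pos[of t] by simp
    qed
  qed (use up in simp)
qed

lemma surv_shift_limit:
  assumes y: "y \<in> hat_space S" and s: "0 \<le> s"
  shows "((\<lambda>t. surv y (t - s) / F t) \<longlongrightarrow> h y) at_top"
proof -
  have "filterlim (\<lambda>t. t - s) at_top (at_top :: real filter)" by real_asymp
  from filterlim_compose[OF surv_limit[OF y] this]
  have "((\<lambda>t. surv y (t - s) / F (t - s) * (F (t - s) / F t)) \<longlongrightarrow> h y * 1) at_top"
    by (intro tendsto_mult F_long_tailed[OF s])
  moreover have "surv y (t - s) / F (t - s) * (F (t - s) / F t) = surv y (t - s) / F t" for t
    using F_pos[of "t - s"] by simp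
  ultimately show ?thesis by (simp only: mult_1_right)
qed

text \<open>The bound is uniform in u and dominates the conditional densities in all holding states
  at once.\<close>

lemma surv_holding_le: "u \<in> {0..<1} \<Longrightarrow> surv (holding u) t \<le> F t"
proof -
  assume u: "u \<in> {0..<1}"
  interpret Q0: prob_space "Q 0" by (rule prob_space_Q)
  show ?thesis
    unfolding F_eq unfolding surv_def
    using u sets_Collect_path[OF pred_alive00] alive_mono_age[of u _ t 0]
    by (auto simp: discrete_inverse intro!: Q0.finite_measure_mono)
qed

end


section \<open>The transition semigroup\<close>

lemma measurable_chain_state [measurable]: "(\<lambda>y :: hat. chain_state y) \<in> borel \<rightarrow>\<^sub>M count_space UNIV"
proof -
  have "of_discrete \<in> (borel :: nat discrete measure) \<rightarrow>\<^sub>M count_space UNIV"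
    by (subst measurable_count_space_eq2_countable) (auto intro!: borel_open open_discrete)
  from measurable_compose[OF _ this, of fst] show ?thesis
    by (metis borel_prod measurable_fst)
qed

lemma measurable_snd_hat [measurable]: "(snd :: hat \<Rightarrow> real) \<in> borel_measurable borel"
  by (metis borel_prod measurable_snd)

lemma measurable_hatI:
  fixes a :: "'a \<Rightarrow> real"
  assumes "(\<lambda>x. n x) \<in> M \<rightarrow>\<^sub>M count_space (UNIV :: nat set)" "a \<in> borel_measurable M"
  shows "(\<lambda>x. (discrete (n x), a x)) \<in> borel_measurable M"
proof -
  have "(\<lambda>x. discrete (n x)) \<in> borel_measurable M"
    by (rule measurable_compose[OF assms(1)]) simp
  then show ?thesis using assms(2) by (rule borel_measurable_Pair)
qed

lemma sets_hat_space [measurable]: "hat_space S \<in> sets borel"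
proof -
  have "hat_space S = {y. chain_state y \<in> S - {0} \<and> snd y = 0} \<union> {y. chain_state y = 0 \<and> 0 \<le> snd y \<and> snd y < 1}"
  proof (intro set_eqI)
    fix y :: hat
    have y: "y = (discrete (chain_state y), snd y)" by (simp add: of_discrete_inverse)
    have "y \<in> excursion ` (S - {0}) \<longleftrightarrow> chain_state y \<in> S - {0} \<and> snd y = 0"
      using y by (force simp: discrete_inverse image_iff)
    moreover have "y \<in> holding ` {0..<1} \<longleftrightarrow> chain_state y = 0 \<and> 0 \<le> snd y \<and> snd y < 1"
      using y by (force simp: discrete_inverse image_iff)
    ultimately show "y \<in> hat_space S \<longleftrightarrow> y \<in> {y. chain_state y \<in> S - {0} \<and> snd y = 0} \<union> {y. chain_state y = 0 \<and> 0 \<le> snd y \<and> snd y < 1}"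
      by (simp only: hat_space_def Un_iff mem_Collect_eq)
  qed
  also have "\<dots> = ({y. chain_state y \<in> S - {0}} \<inter> {y. snd y \<in> {0}}) \<union> ({y. chain_state y \<in> {0}} \<inter> {y. snd y \<in> {0..<1}})"
    by auto
  also have "\<dots> \<in> sets borel"
  proof -
    have "{y :: hat. chain_state y \<in> A} \<in> sets borel" for A
      using measurable_sets[OF measurable_chain_state, of A] by (simp add: vimage_def)
    moreover have "{y :: hat. snd y \<in> B} \<in> sets borel" if "B \<in> sets borel" for B
      using measurable_sets[OF measurable_snd_hat that] by (simp add: vimage_def)
    ultimately show ?thesis by (intro sets.Un sets.Int) auto
  qed
  finally show ?thesis .
qed

lemma measurable_h_lim [measurable]: "h_lim c \<in> borel_measurable borel"
  unfolding h_lim_def[abs_def] by measurable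

text \<open>A form of \<open>alive\<close>, valid for \<open>u\<close> in \<open>[0, 1)\<close>, whose joint measurability in \<open>u\<close> and the path is evident.\<close>

definition alv :: "real \<Rightarrow> (real \<Rightarrow> nat) \<Rightarrow> real \<Rightarrow> bool" where
  "alv u w t \<longleftrightarrow> alive 0 w t \<and> (ereal (1 - u) < exit0 w \<longrightarrow> t < 1 - u)"

lemma alive_alv: "w \<in> paths S \<Longrightarrow> u \<in> {0..<1} \<Longrightarrow> alive u w t \<longleftrightarrow> alv u w t"
  unfolding alv_def using alive_exit0[of w S u t] by simp

lemma pred_alv [measurable]: "Measurable.pred (borel \<Otimes>\<^sub>M path_space S) (\<lambda>(u, w). alv u w t)"
  unfolding alv_def using pred_alive_pair .

lemma measurable_hat_path_pair [measurable]:
  "0 \<le> t \<Longrightarrow> (\<lambda>(u, w). hat_path u w t) \<in> borel_measurable (borel \<Otimes>\<^sub>M path_space S)"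
  unfolding hat_path_eq split_beta
  by (rule measurable_hatI)
    (use measurable_age_pair[of t S] measurable_compose[OF measurable_snd measurable_coordinate] in \<open>auto simp: split_beta\<close>)

lemma measurable_hat_path [measurable]:
  "0 \<le> t \<Longrightarrow> (\<lambda>w. hat_path u w t) \<in> borel_measurable (path_space S)"
  unfolding hat_path_eq by (rule measurable_hatI) auto

lemma hat_path_state [simp]: "chain_state (hat_path u w t) = w t" "snd (hat_path u w t) = age u w t"
  by (auto simp: hat_path_eq discrete_inverse)

lemma alive_age: "alive u w t \<Longrightarrow> 0 \<le> t \<Longrightarrow> 0 \<le> u \<Longrightarrow> age u w t \<in> {0..<1}"
  unfolding alive_def using age_nonneg[of u t w] by auto

lemma hat_path_in:
  assumes "w \<in> paths S" "alive u w t" "0 \<le> t" "0 \<le> u"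
  shows "hat_path u w t \<in> hat_space S"
proof (cases "w t = 0")
  case True
  then show ?thesis using alive_age[OF assms(2-4)] unfolding hat_path_eq hat_space_def by auto
next
  case False
  then have "hat_path u w t = excursion (w t)" by (simp add: hat_path_eq age_eq)
  then show ?thesis using False paths_state[OF assms(1,3)] unfolding hat_space_def by auto
qed

lemma hat_path_0:
  assumes "y \<in> hat_space S" "w 0 = chain_state y"
  shows "hat_path (snd y) w 0 = y" "alive (snd y) w 0"
proof -
  have "age (snd y) w 0 = snd y"
    using assms unfolding age_eq hat_space_def by (auto simp: discrete_inverse)
  then show "hat_path (snd y) w 0 = y" unfolding hat_path_eq using assms(2)
    by (simp add: of_discrete_inverse prod_eq_iff)
  show "alive (snd y) w 0" unfolding alive_def using \<open>age (snd y) w 0 = snd y\<close> assms(1)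
    by (auto simp: hat_space_def)
qed

context subexponential_chain
begin

lemma hat_spaceD:
  assumes "y \<in> hat_space S" shows "chain_state y \<in> S" "snd y \<in> {0..<1}"
  using assms zero_state by (auto simp: hat_space_def discrete_inverse)

lemma nn_integral_Q: 
  assumes "j \<in> S" "f \<in> borel_measurable (path_space S)"
  shows "(\<integral>\<^sup>+w. f w \<partial>Q j) = (\<integral>\<^sup>+\<omega>. f (\<lambda>t\<in>{0..}. X t \<omega>) \<partial>P j)"
  unfolding Q_eq[OF assms(1)] using assms by (intro nn_integral_distr measurable_path) simp_all

text \<open>The expectation of f at time t over the surviving paths. It is defined on the whole
  product type, with \<open>alv\<close> for survival, so that it is a Borel function of z; on
  \<open>hat_space S\<close> it is integration against \<open>hat_kernel\<close>.\<close>

definition hat_op :: "real \<Rightarrow> (hat \<Rightarrow> ennreal) \<Rightarrow> hat \<Rightarrow> ennreal" where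
  "hat_op t f z = (\<integral>\<^sup>+w. (if alv (snd z) w t then f (hat_path (snd z) w t) else 0) \<partial>Q (chain_state z))"

text \<open>For a fixed discrete component, Fubini gives measurability in the age; the countably
  many components are then glued together.\<close>

lemma measurable_hat_op [measurable]:
  assumes t: "0 \<le> t" and f [measurable]: "f \<in> borel_measurable borel"
  shows "hat_op t f \<in> borel_measurable borel"
proof -
  have "(\<lambda>(u, w). if alv u w t then f (hat_path u w t) else 0) \<in> borel_measurable (borel \<Otimes>\<^sub>M path_space S)"
  proof -
    note [measurable] = measurable_hat_path_pair[OF t]
    have "(\<lambda>p. if (\<lambda>(u, w). alv u w t) p then f ((\<lambda>(u, w). hat_path u w t) p) else 0) \<in> borel_measurable (borel \<Otimes>\<^sub>M path_space S)"
      by measurable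
    then show ?thesis by (simp add: split_beta)
  qed
  then have m: "(\<lambda>u. \<integral>\<^sup>+w. (if alv u w t then f (hat_path u w t) else 0) \<partial>Q j) \<in> borel_measurable borel" for j
  proof -
    assume a: "(\<lambda>(u, w). if alv u w t then f (hat_path u w t) else 0) \<in> borel_measurable (borel \<Otimes>\<^sub>M path_space S)"
    interpret Qj: prob_space "Q j" by (rule prob_space_Q)
    have "(\<lambda>(u, w). if alv u w t then f (hat_path u w t) else 0) \<in> borel_measurable (borel \<Otimes>\<^sub>M Q j)"
      using a by measurable
    from Qj.borel_measurable_nn_integral[OF this] show ?thesis .
  qed
  show ?thesis unfolding hat_op_def[abs_def]
    by (rule measurable_compose_countable[of "\<lambda>j z. \<integral>\<^sup>+w. (if alv (snd z) w t then f (hat_path (snd z) w t) else 0) \<partial>Q j"])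
      (use measurable_compose[OF measurable_snd_hat m] measurable_chain_state in auto)
qed

lemma hat_op_alive:
  assumes "z \<in> hat_space S"
  shows "hat_op t f z = (\<integral>\<^sup>+w. (if alive (snd z) w t then f (hat_path (snd z) w t) else 0) \<partial>Q (chain_state z))"
  unfolding hat_op_def using alive_alv hat_spaceD[OF assms] by (intro nn_integral_cong) auto

lemma hat_op_one:
  assumes "z \<in> hat_space S"
  shows "hat_op t (\<lambda>_. 1) z = ennreal (surv z t)"
proof -
  interpret Qz: prob_space "Q (chain_state z)" by (rule prob_space_Q)
  have "hat_op t (\<lambda>_. 1) z = (\<integral>\<^sup>+w. indicator {w \<in> paths S. alive (snd z) w t} w \<partial>Q (chain_state z))"
    unfolding hat_op_alive[OF assms] by (intro nn_integral_cong) (auto simp: indicator_def)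
  also have "\<dots> = emeasure (Q (chain_state z)) {w \<in> paths S. alive (snd z) w t}"
    using sets_Collect_path[OF pred_alive[OF hat_spaceD(2)[OF assms]]] by (intro nn_integral_indicator) simp
  finally show ?thesis unfolding surv_def Qz.emeasure_eq_measure .
qed

lemma measurable_alive_integrand:
  assumes "u \<in> {0..<1}" "0 \<le> t" "f \<in> borel_measurable borel"
  shows "(\<lambda>w. if alive u w t then f (hat_path u w t) else (0::ennreal)) \<in> borel_measurable (path_space S)"
  by (intro measurable_If pred_alive[OF assms(1), unfolded pred_def] measurable_compose[OF measurable_hat_path[OF assms(2)] assms(3)] borel_measurable_const)

lemma sets_hat_kernel [simp]: "sets (hat_kernel S P X t y) = sets (restrict_space borel (hat_space S))"
  and space_hat_kernel [simp]: "space (hat_kernel S P X t y) = hat_space S"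
  unfolding hat_kernel_def by (auto simp: space_restrict_space)

lemma hatX_path: "0 \<le> t \<Longrightarrow> hatX X y t \<omega> = hat_path (snd y) (\<lambda>t\<in>{0..}. X t \<omega>) t"
  unfolding hatX_def by (rule hat_path_cong) auto

lemma nn_integral_hat_kernel:
  assumes y: "y \<in> hat_space S" and t: "0 \<le> t" and f: "f \<in> borel_measurable borel"
  shows "(\<integral>\<^sup>+z. f z \<partial>hat_kernel S P X t y) = hat_op t f y"
proof -
  note j = hat_spaceD(1)[OF y] and u = hat_spaceD(2)[OF y]
  let ?j = "chain_state y" and ?u = "snd y"
  let ?O = "{\<omega> \<in> space (P ?j). ereal t < tau X y \<omega>}"
  have O: "?O = {\<omega> \<in> space (P ?j). alive ?u (\<lambda>t\<in>{0..}. X t \<omega>) t}" using tau_gt_alive[OF j _ t] by blast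
  have mO: "?O \<in> sets (P ?j)"
    using measurable_compose[OF measurable_path[OF j] pred_alive[OF u]] unfolding O by (simp add: pred_def)
  have mX: "hatX X y t \<in> restrict_space (P ?j) ?O \<rightarrow>\<^sub>M restrict_space borel (hat_space S)"
  proof (rule measurable_restrict_space2)
    show "hatX X y t \<in> space (restrict_space (P ?j) ?O) \<rightarrow> hat_space S"
      using restrict_paths[OF cadlag_X[OF j]] u t unfolding O
      by (auto simp: space_restrict_space hatX_path intro!: hat_path_in)
    have "hatX X y t \<in> borel_measurable (P ?j)"
    proof -
      have "hatX X y t = (\<lambda>\<omega>. hat_path ?u (\<lambda>t\<in>{0..}. X t \<omega>) t)" by (rule ext) (rule hatX_path[OF t])
      then show ?thesis using measurable_compose[OF measurable_path[OF j] measurable_hat_path[OF t]] by simp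
    qed
    then show "hatX X y t \<in> borel_measurable (restrict_space (P ?j) ?O)" by (rule measurable_restrict_space1)
  qed
  have "(\<integral>\<^sup>+z. f z \<partial>hat_kernel S P X t y) = (\<integral>\<^sup>+\<omega>. f (hatX X y t \<omega>) \<partial>restrict_space (P ?j) ?O)"
    unfolding hat_kernel_def by (rule nn_integral_distr[OF mX]) (simp add: measurable_restrict_space1 f)
  also have "\<dots> = (\<integral>\<^sup>+\<omega>. f (hatX X y t \<omega>) * indicator ?O \<omega> \<partial>P ?j)"
    using mO by (intro nn_integral_restrict_space) (simp add: Int_absorb2 subset_eq)
  also have "\<dots> = (\<integral>\<^sup>+\<omega>. (\<lambda>w. if alive ?u w t then f (hat_path ?u w t) else 0) (\<lambda>t\<in>{0..}. X t \<omega>) \<partial>P ?j)"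
    unfolding O by (intro nn_integral_cong) (simp add: hatX_path[OF t] indicator_def)
  also have "\<dots> = hat_op t f y"
    unfolding hat_op_alive[OF y] by (rule nn_integral_Q[symmetric, OF j measurable_alive_integrand[OF u t f]])
  finally show ?thesis .
qed

lemma sets_hatD: "A \<in> sets (restrict_space borel (hat_space S)) \<Longrightarrow> A \<in> sets borel"
  using sets_restrict_space_iff[of "hat_space S" borel A] sets_hat_space by simp

text \<open>The hypothesis \<open>gs\<close> says that the weight g depends on the path up to s
  only. With g = 1 this gives the semigroup property, with g an event of the past the Markov
  property of the path laws, and with f = 1 the densities of the conditioned laws. The age flow
  turns the age at s into the initial age of the restarted chain.\<close>

lemma hat_markov:
  assumes y: "y \<in> hat_space S" and s: "0 \<le> s" and t: "0 \<le> t"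
    and g [measurable]: "g \<in> borel_measurable (path_space S)" and gs: "\<And>w. w \<in> paths S \<Longrightarrow> g (stop s w) = g w"
    and f [measurable]: "f \<in> borel_measurable borel"
  shows "(\<integral>\<^sup>+w. g w * (if alive (snd y) w (s + t) then f (hat_path (snd y) w (s + t)) else 0) \<partial>Q (chain_state y)) =
    (\<integral>\<^sup>+w. g w * (if alive (snd y) w s then hat_op t f (hat_path (snd y) w s) else 0) \<partial>Q (chain_state y))"
proof -
  note j = hat_spaceD(1)[OF y] and u = hat_spaceD(2)[OF y]
  let ?j = "chain_state y" and ?u = "snd y"
  have u0: "0 \<le> ?u" using u by simp
  define H where "H = (\<lambda>(a, w). if alv a w t then f (hat_path a w t) else 0)"
  have [measurable]: "H \<in> borel_measurable (borel \<Otimes>\<^sub>M path_space S)"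
  proof -
    note [measurable] = measurable_hat_path_pair[OF t]
    have "(\<lambda>p. if (\<lambda>(u, w). alv u w t) p then f ((\<lambda>(u, w). hat_path u w t) p) else 0) \<in> borel_measurable (borel \<Otimes>\<^sub>M path_space S)"
      by measurable
    then show ?thesis unfolding H_def by (simp add: split_beta)
  qed
  \<comment> \<open>The first argument supplies the age at s and survival up to s, the second the
    fate of the restarted path; the \<open>alv\<close> inside H makes their combination jointly
    measurable.\<close>
  define G where "G = (\<lambda>(v, w). g v * (if alive ?u v s then H (age ?u v s, w) else 0))"
  have G: "G \<in> borel_measurable (path_space S \<Otimes>\<^sub>M path_space S)"
  proof -
    note [measurable] = measurable_age[OF s] pred_alive[OF u]
    show ?thesis unfolding G_def by measurable
  qed
  have H: "H (age ?u w s, w') = (if alive (age ?u w s) w' t then f (hat_path (age ?u w s) w' t) else 0)"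
    if "alive ?u w s" "w' \<in> paths S" for w w'
    unfolding H_def using alive_alv[OF that(2) alive_age[OF that(1) s u0]] by simp
  have "(\<integral>\<^sup>+w. g w * (if alive ?u w (s + t) then f (hat_path ?u w (s + t)) else 0) \<partial>Q ?j) =
    (\<integral>\<^sup>+w. G (stop s w, shift s w) \<partial>Q ?j)"
  proof (rule nn_integral_cong)
    fix w assume "w \<in> space (Q ?j)"
    then have w: "w \<in> paths S" by simp
    show "g w * (if alive ?u w (s + t) then f (hat_path ?u w (s + t)) else 0) = G (stop s w, shift s w)"
      unfolding G_def using gs[OF w] s H[OF _ shift_paths[OF w s]] alive_flow[OF s t, of ?u w] hat_path_flow[OF s t, of ?u w]
      by simp
  qed
  also have "\<dots> = (\<integral>\<^sup>+w. (\<integral>\<^sup>+w'. G (stop s w, w') \<partial>Q (w s)) \<partial>Q ?j)"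
    by (rule markov_nn_integral[OF j s G])
  also have "\<dots> = (\<integral>\<^sup>+w. g w * (if alive ?u w s then hat_op t f (hat_path ?u w s) else 0) \<partial>Q ?j)"
  proof (rule nn_integral_cong)
    fix w assume "w \<in> space (Q ?j)"
    then have w: "w \<in> paths S" by simp
    show "(\<integral>\<^sup>+w'. G (stop s w, w') \<partial>Q (w s)) = g w * (if alive ?u w s then hat_op t f (hat_path ?u w s) else 0)"
    proof (cases "alive ?u w s")
      case True
      have m: "(\<lambda>w'. H (age ?u w s, w')) \<in> borel_measurable (Q (w s))" by measurable
      have "(\<integral>\<^sup>+w'. G (stop s w, w') \<partial>Q (w s)) = g w * (\<integral>\<^sup>+w'. H (age ?u w s, w') \<partial>Q (w s))"
        unfolding G_def using gs[OF w] s True nn_integral_cmult[OF m] by simp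
      also have "(\<integral>\<^sup>+w'. H (age ?u w s, w') \<partial>Q (w s)) = hat_op t f (hat_path ?u w s)"
        by (simp only: hat_op_def H_def hat_path_state prod.case)
      finally show ?thesis using True by simp
    next
      case False
      then show ?thesis unfolding G_def using s by simp
    qed
  qed
  finally show ?thesis .
qed

lemma hat_op_flow:
  assumes y: "y \<in> hat_space S" and s: "0 \<le> s" and t: "0 \<le> t" and f: "f \<in> borel_measurable borel"
  shows "hat_op (s + t) f y = hat_op s (hat_op t f) y"
  using hat_markov[OF y s t, of "\<lambda>_. 1" f] f by (simp add: hat_op_alive[OF y])

text \<open>Here the horizon moves forward, so long-tailedness is applied at t + r and enters as a
  divisor.\<close>

lemma surv_add_limit:
  assumes y: "y \<in> hat_space S" and t: "0 \<le> t"
  shows "((\<lambda>r. surv y (t + r) / F r) \<longlongrightarrow> h y) at_top"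
proof -
  have lim: "filterlim (\<lambda>r. t + r) at_top (at_top :: real filter)" by real_asymp
  have "((\<lambda>r. surv y (t + r) / F (t + r) / (F (t + r - t) / F (t + r))) \<longlongrightarrow> h y / 1) at_top"
    by (intro tendsto_divide filterlim_compose[OF surv_limit[OF y] lim]
      filterlim_compose[OF F_long_tailed[OF t] lim]) simp
  moreover have "surv y (t + r) / F (t + r) / (F (t + r - t) / F (t + r)) = surv y (t + r) / F r" for r
    using F_pos[of "t + r"] by (simp add: less_imp_neq[symmetric])
  ultimately show ?thesis by (simp only: div_by_1)
qed

text \<open>Fatou's lemma turns \<open>h = lim\<^sub>n surv _ n / F n\<close> into superharmonicity of \<open>h\<close>.\<close>

lemma hat_op_h_le:
  assumes y: "y \<in> hat_space S" and t: "0 \<le> t"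
  shows "hat_op t (\<lambda>z. ennreal (h z)) y \<le> ennreal (h y)"
proof -
  note j = hat_spaceD(1)[OF y] and u = hat_spaceD(2)[OF y]
  let ?j = "chain_state y" and ?u = "snd y"
  let ?f = "\<lambda>n w. if alive ?u w t then ennreal (surv (hat_path ?u w t) (real n) / F (real n)) else 0"
  have nlim: "filterlim real at_top sequentially" by (rule filterlim_real_sequentially)
  have meas: "?f n \<in> borel_measurable (path_space S)" for n
  proof -
    have mm: "(\<lambda>w. if alive ?u w t then hat_op (real n) (\<lambda>_. 1) (hat_path ?u w t) * ennreal (1 / F (real n)) else 0) \<in> borel_measurable (path_space S)"
      by (rule measurable_alive_integrand[OF u t, of "\<lambda>z. hat_op (real n) (\<lambda>_. 1) z * ennreal (1 / F (real n))"])
        (intro borel_measurable_times_ennreal measurable_hat_op borel_measurable_const, simp)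
    have me: "(if alive ?u w t then hat_op (real n) (\<lambda>_. 1) (hat_path ?u w t) * ennreal (1 / F (real n)) else 0) = ?f n w"
      if "w \<in> space (path_space S)" for w
      using that u t F_pos[of "real n"] by (auto simp: hat_op_one hat_path_in surv_nonneg ennreal_mult[symmetric])
    show ?thesis by (rule measurable_cong[THEN iffD1, OF me mm])
  qed
  have "hat_op t (\<lambda>z. ennreal (h z)) y = (\<integral>\<^sup>+w. liminf (\<lambda>n. ?f n w) \<partial>Q ?j)"
    unfolding hat_op_alive[OF y]
  proof (rule nn_integral_cong)
    fix w assume "w \<in> space (Q ?j)"
    then have w: "w \<in> paths S" by simp
    show "(if alive ?u w t then ennreal (h (hat_path ?u w t)) else 0) = liminf (\<lambda>n. ?f n w)"
    proof (cases "alive ?u w t")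
      case True
      then have z: "hat_path ?u w t \<in> hat_space S" using w t u by (intro hat_path_in) auto
      have "(\<lambda>n. ennreal (surv (hat_path ?u w t) (real n) / F (real n))) \<longlonglongrightarrow> ennreal (h (hat_path ?u w t))"
        by (intro tendsto_ennrealI filterlim_compose[OF surv_limit[OF z] nlim])
      then show ?thesis using True lim_imp_Liminf[OF trivial_limit_sequentially] by fastforce
    qed (simp add: Liminf_const)
  qed
  also have "\<dots> \<le> liminf (\<lambda>n. \<integral>\<^sup>+w. ?f n w \<partial>Q ?j)"
    by (rule nn_integral_liminf) (use meas in \<open>simp add: measurable_cong_sets[OF sets_Q refl]\<close>)
  also have "(\<lambda>n. \<integral>\<^sup>+w. ?f n w \<partial>Q ?j) = (\<lambda>n. ennreal (surv y (t + real n) / F (real n)))"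
  proof
    fix n
    have "(\<integral>\<^sup>+w. ?f n w \<partial>Q ?j) = (\<integral>\<^sup>+w. ennreal (1 / F (real n)) * (if alive ?u w t then hat_op (real n) (\<lambda>_. 1) (hat_path ?u w t) else 0) \<partial>Q ?j)"
      using u t F_pos[of "real n"]
      by (intro nn_integral_cong) (auto simp: hat_op_one hat_path_in surv_nonneg ennreal_mult[symmetric])
    also have "\<dots> = ennreal (1 / F (real n)) * hat_op t (hat_op (real n) (\<lambda>_. 1)) y"
      unfolding hat_op_alive[OF y]
      by (rule nn_integral_cmult)
        (use measurable_alive_integrand[OF u t measurable_hat_op[of "real n" "\<lambda>_. 1"]] in \<open>simp add: measurable_cong_sets[OF sets_Q refl]\<close>)
    also have "\<dots> = ennreal (1 / F (real n)) * ennreal (surv y (t + real n))"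
      using hat_op_flow[OF y t, of "real n" "\<lambda>_. 1"] hat_op_one[OF y, of "t + real n"] by simp
    also have "\<dots> = ennreal (surv y (t + real n) / F (real n))"
      using F_pos[of "real n"] by (simp add: surv_nonneg ennreal_mult[symmetric])
    finally show "(\<integral>\<^sup>+w. ?f n w \<partial>Q ?j) = ennreal (surv y (t + real n) / F (real n))" .
  qed
  also have "liminf (\<lambda>n. ennreal (surv y (t + real n) / F (real n))) = ennreal (h y)"
    by (intro lim_imp_Liminf tendsto_ennrealI filterlim_compose[OF surv_add_limit[OF y t] nlim]) simp
  finally show ?thesis .
qed

lemma superharmonic_h: "superharmonic (hat_space S) (hat_kernel S P X) h"
  unfolding superharmonic_def by (auto simp: nn_integral_hat_kernel hat_op_h_le)

section \<open>The h-transformed semigroup\<close>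

abbreviation P_inf :: "real \<Rightarrow> hat \<Rightarrow> hat measure" where
  "P_inf \<equiv> h_transform h (hat_kernel S P X)"

lemma sets_P_inf [simp]: "sets (P_inf t y) = sets (restrict_space borel (hat_space S))"
  and space_P_inf [simp]: "space (P_inf t y) = hat_space S"
  unfolding h_transform_def by simp_all

lemma measurable_hat_kernelI: "f \<in> borel_measurable borel \<Longrightarrow> f \<in> borel_measurable (hat_kernel S P X t y)"
  by (subst measurable_cong_sets[OF sets_hat_kernel refl]) (rule measurable_restrict_space1)

lemma emeasure_P_inf:
  assumes y: "y \<in> hat_space S" and t: "0 \<le> t" and A: "A \<in> sets (restrict_space borel (hat_space S))"
  shows "emeasure (P_inf t y) A = hat_op t (\<lambda>z. ennreal (h z / h y) * indicator A z) y"
proof -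
  have [measurable]: "A \<in> sets borel" by (rule sets_hatD[OF A])
  have m: "(\<lambda>z. ennreal (h z / h y)) \<in> borel_measurable borel" by measurable
  have "emeasure (P_inf t y) A = (\<integral>\<^sup>+z. ennreal (h z / h y) * indicator A z \<partial>hat_kernel S P X t y)"
    unfolding h_transform_def by (rule emeasure_density[OF measurable_hat_kernelI[OF m]]) (use A in simp)
  also have "\<dots> = hat_op t (\<lambda>z. ennreal (h z / h y) * indicator A z) y"
    by (rule nn_integral_hat_kernel[OF y t]) measurable
  finally show ?thesis .
qed

lemma hat_op_cmult:
  assumes "y \<in> hat_space S" "0 \<le> t" "f \<in> borel_measurable borel"
  shows "hat_op t (\<lambda>z. c * f z) y = c * hat_op t f y"
proof -
  have "hat_op t (\<lambda>z. c * f z) y = (\<integral>\<^sup>+w. c * (if alive (snd y) w t then f (hat_path (snd y) w t) else 0) \<partial>Q (chain_state y))"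
    unfolding hat_op_alive[OF assms(1)] by (intro nn_integral_cong) auto
  also have "\<dots> = c * hat_op t f y"
    unfolding hat_op_alive[OF assms(1)]
    by (rule nn_integral_cmult) 
      (use measurable_alive_integrand[OF hat_spaceD(2)[OF assms(1)] assms(2,3)] in \<open>simp add: measurable_cong_sets[OF sets_Q refl]\<close>)
  finally show ?thesis .
qed

lemma h_nonneg: "y \<in> hat_space S \<Longrightarrow> 0 \<le> h y"
  using h_pos by (simp add: less_imp_le)

lemma hat_op_cong:
  assumes "y \<in> hat_space S" "0 \<le> t" "\<And>z. z \<in> hat_space S \<Longrightarrow> f z = g z"
  shows "hat_op t f y = hat_op t g y"
  unfolding hat_op_alive[OF assms(1)] using assms hat_spaceD[OF assms(1)]
  by (intro nn_integral_cong) (auto simp: hat_path_in)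

text \<open>Taking 1 / h y out leaves \<open>hat_op\<close> of a function that does not depend on y.
  Measurability in y and the composition of kernels are read off from this form.\<close>

lemma emeasure_P_inf':
  assumes y: "y \<in> hat_space S" and t: "0 \<le> t" and A: "A \<in> sets (restrict_space borel (hat_space S))"
  shows "emeasure (P_inf t y) A = ennreal (1 / h y) * hat_op t (\<lambda>z. ennreal (h z) * indicator A z) y"
proof -
  have [measurable]: "A \<in> sets borel" by (rule sets_hatD[OF A])
  have "emeasure (P_inf t y) A = hat_op t (\<lambda>z. ennreal (1 / h y) * (ennreal (h z) * indicator A z)) y"
    unfolding emeasure_P_inf[OF assms]
    by (rule hat_op_cong[OF y t])
      (use h_nonneg h_pos[OF y] in \<open>auto simp: ennreal_mult[symmetric] mult.assoc[symmetric]\<close>)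
  also have "\<dots> = ennreal (1 / h y) * hat_op t (\<lambda>z. ennreal (h z) * indicator A z) y"
    by (rule hat_op_cmult[OF y t]) measurable
  finally show ?thesis .
qed

text \<open>Superharmonicity bounds the total mass by h y / h y = 1, and
  \<open>measurable_hat_op\<close> gives measurability in the starting point.\<close>

lemma measurable_P_inf:
  assumes t: "0 \<le> t"
  shows "P_inf t \<in> restrict_space borel (hat_space S) \<rightarrow>\<^sub>M subprob_algebra (restrict_space borel (hat_space S))"
proof (rule measurable_subprob_algebra)
  fix y assume "y \<in> space (restrict_space borel (hat_space S))"
  then have y: "y \<in> hat_space S" by (simp add: space_restrict_space)
  have top: "hat_space S \<in> sets (restrict_space borel (hat_space S))"
    using sets.top[of "restrict_space borel (hat_space S)"] by (simp add: space_restrict_space)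
  show "subprob_space (P_inf t y)"
  proof (rule subprob_spaceI)
    have "emeasure (P_inf t y) (space (P_inf t y)) = ennreal (1 / h y) * hat_op t (\<lambda>z. ennreal (h z)) y"
      unfolding space_P_inf emeasure_P_inf'[OF y t top]
      by (intro arg_cong2[of _ _ _ _ "(*)"] refl hat_op_cong[OF y t]) simp
    also have "\<dots> \<le> ennreal (1 / h y) * ennreal (h y)" by (intro mult_left_mono hat_op_h_le[OF y t]) simp
    also have "\<dots> = 1" using h_pos[OF y] by (simp add: ennreal_mult[symmetric])
    finally show "emeasure (P_inf t y) (space (P_inf t y)) \<le> 1" .
    show "space (P_inf t y) \<noteq> {}" using y by auto
  qed
  show "sets (P_inf t y) = sets (restrict_space borel (hat_space S))" by simp
next
  fix A assume A: "A \<in> sets (restrict_space borel (hat_space S))"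
  have [measurable]: "A \<in> sets borel" by (rule sets_hatD[OF A])
  have "(\<lambda>y. ennreal (1 / h y) * hat_op t (\<lambda>z. ennreal (h z) * indicator A z) y) \<in> borel_measurable borel"
    by (intro borel_measurable_times_ennreal measurable_hat_op t) measurable
  then have "(\<lambda>y. ennreal (1 / h y) * hat_op t (\<lambda>z. ennreal (h z) * indicator A z) y) \<in> borel_measurable (restrict_space borel (hat_space S))"
    by (rule measurable_restrict_space1)
  then show "(\<lambda>y. emeasure (P_inf t y) A) \<in> borel_measurable (restrict_space borel (hat_space S))"
    by (rule measurable_cong[THEN iffD1, rotated]) (simp add: space_restrict_space emeasure_P_inf'[OF _ t A])
qed

lemma hat_op_0:
  assumes y: "y \<in> hat_space S" shows "hat_op 0 f y = f y"
proof -
  interpret Qy: prob_space "Q (chain_state y)" by (rule prob_space_Q)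
  have "hat_op 0 f y = (\<integral>\<^sup>+w. f y \<partial>Q (chain_state y))"
    unfolding hat_op_alive[OF y]
    using AE_start[OF hat_spaceD(1)[OF y]]
    by (intro nn_integral_cong_AE, eventually_elim) (simp add: hat_path_0[OF y])
  then show ?thesis using Qy.emeasure_space_1 by simp
qed

text \<open>In the composition of two kernels the intermediate factors h z and 1 / h z cancel, so
  Chapman-Kolmogorov reduces to \<open>hat_op_flow\<close>.\<close>

lemma substochastic_P_inf: "substochastic_semigroup (hat_space S) P_inf"
  unfolding substochastic_semigroup_def
proof (intro conjI allI impI ballI)
  show "P_inf t \<in> restrict_space borel (hat_space S) \<rightarrow>\<^sub>M subprob_algebra (restrict_space borel (hat_space S))"
    if "0 \<le> t" for t by (rule measurable_P_inf[OF that])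
next
  fix y assume y: "y \<in> hat_space S"
  show "P_inf 0 y = return (restrict_space borel (hat_space S)) y"
  proof (rule measure_eqI)
    fix A assume "A \<in> sets (P_inf 0 y)"
    then have A: "A \<in> sets (restrict_space borel (hat_space S))" by simp
    show "emeasure (P_inf 0 y) A = emeasure (return (restrict_space borel (hat_space S)) y) A"
      unfolding emeasure_P_inf[OF y order_refl A] hat_op_0[OF y] using A h_pos[OF y] by simp
  qed simp
next
  fix s t :: real and y assume s: "0 \<le> s" and t: "0 \<le> t" and y: "y \<in> hat_space S"
  show "P_inf (s + t) y = P_inf s y \<bind> P_inf t"
  proof (rule measure_eqI)
    have ne: "space (P_inf s y) \<noteq> {}" using y by auto
    have K: "P_inf t \<in> P_inf s y \<rightarrow>\<^sub>M subprob_algebra (restrict_space borel (hat_space S))"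
      using measurable_P_inf[OF t] by (simp add: measurable_cong_sets[OF sets_P_inf refl])
    show "sets (P_inf (s + t) y) = sets (P_inf s y \<bind> P_inf t)"
      using y by (subst sets_bind[where N = "restrict_space borel (hat_space S)"]) auto
    fix A assume "A \<in> sets (P_inf (s + t) y)"
    then have A: "A \<in> sets (restrict_space borel (hat_space S))" by simp
    have [measurable]: "A \<in> sets borel" by (rule sets_hatD[OF A])
    let ?f = "\<lambda>z. ennreal (h z) * indicator A z"
    have f: "?f \<in> borel_measurable borel" by measurable
    have kf: "hat_op t ?f \<in> borel_measurable borel" by (rule measurable_hat_op[OF t f])
    have "emeasure (P_inf s y \<bind> P_inf t) A = (\<integral>\<^sup>+z. emeasure (P_inf t z) A \<partial>P_inf s y)"
      by (rule emeasure_bind[OF ne K A])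
    also have "\<dots> = (\<integral>\<^sup>+z. ennreal (1 / h z) * hat_op t ?f z \<partial>P_inf s y)"
      by (intro nn_integral_cong) (simp add: emeasure_P_inf'[OF _ t A])
    also have "\<dots> = (\<integral>\<^sup>+z. ennreal (h z / h y) * (ennreal (1 / h z) * hat_op t ?f z) \<partial>hat_kernel S P X s y)"
      unfolding h_transform_def
      by (rule nn_integral_density; rule measurable_hat_kernelI) (use kf in measurable)
    also have "\<dots> = (\<integral>\<^sup>+z. ennreal (1 / h y) * hat_op t ?f z \<partial>hat_kernel S P X s y)"
    proof (rule nn_integral_cong)
      fix z assume "z \<in> space (hat_kernel S P X s y)"
      then have z: "z \<in> hat_space S" by simp
      have "ennreal (h z / h y) * ennreal (1 / h z) = ennreal (1 / h y)"
        using h_pos[OF z] h_pos[OF y] by (simp add: ennreal_mult[symmetric])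
      then show "ennreal (h z / h y) * (ennreal (1 / h z) * hat_op t ?f z) = ennreal (1 / h y) * hat_op t ?f z"
        by (simp add: mult.assoc[symmetric])
    qed
    also have "\<dots> = ennreal (1 / h y) * hat_op s (hat_op t ?f) y"
      using kf nn_integral_hat_kernel[OF y s, of "\<lambda>z. ennreal (1 / h y) * hat_op t ?f z"] hat_op_cmult[OF y s kf] by simp
    also have "\<dots> = emeasure (P_inf (s + t) y) A"
      using emeasure_P_inf'[OF y _ A, of "s + t"] hat_op_flow[OF y s t f] s t by simp
    finally show "emeasure (P_inf (s + t) y) A = emeasure (P_inf s y \<bind> P_inf t) A" by simp
  qed
qed

end


section \<open>Path laws\<close>

lemma age_left:
  assumes "0 \<le> p" "p \<le> r" "\<And>q. p \<le> q \<Longrightarrow> q \<le> r \<Longrightarrow> w q = 0"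
  shows "age u w r = age u w p + (r - p)"
proof -
  have "shift p w q = 0" if "q \<in> {0..r - p}" for q using assms that by simp
  then have "stay (r - p) (shift p w)" unfolding stay_def by blast
  then show ?thesis using age_flow[of p "r - p" u w] age_stay[of "r - p" "shift p w"] assms by simp
qed

definition cadlag_hat :: "nat set \<Rightarrow> real \<Rightarrow> (real \<Rightarrow> nat) \<Rightarrow> real \<Rightarrow> bool" where
  "cadlag_hat S u w s \<longleftrightarrow> (\<lambda>t\<in>{0..s}. hat_path u w t) \<in> skorokhod s (hat_space S)"

text \<open>The bad event: the stay in 0 that contains p ends at the very moment at which the age
  would reach 1. The left limit there is (0, 1), outside of \<open>hat_space S\<close>, although the
  age itself never equals 1 during this stay. Anchoring at p makes it an event of the chain
  restarted at p.\<close>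

definition exits_at_one :: "real \<Rightarrow> (real \<Rightarrow> nat) \<Rightarrow> real \<Rightarrow> real \<Rightarrow> bool" where
  "exits_at_one u w s p \<longleftrightarrow> w p = 0 \<and> exit0 (shift p w) = ereal (1 - age u w p) \<and> p + (1 - age u w p) \<le> s"

lemma exit0_eq_iff:
  assumes v: "v \<in> paths S" and b: "0 < b" and e: "exit0 v = ereal b"
  shows "v b \<noteq> 0" "\<And>r. 0 \<le> r \<Longrightarrow> r < b \<Longrightarrow> v r = 0"
proof -
  have z: "v r = 0" if "0 \<le> r" "r < b" for r
    using exit0_gt_iff[OF v that(1)] that e by (simp add: stay_def)
  then show "\<And>r. 0 \<le> r \<Longrightarrow> r < b \<Longrightarrow> v r = 0" .
  have "\<not> stay b v" using exit0_gt_iff[OF v, of b] b e by simp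
  then obtain r where "0 \<le> r" "r \<le> b" "v r \<noteq> 0" unfolding stay_def by auto
  then show "v b \<noteq> 0" using z[of r] by (cases "r = b") auto
qed

text \<open>A left limit of \<open>hat_path\<close> outside of \<open>hat_space S\<close> can only be \<open>holding 1\<close>, reached by staying in
  \<open>0\<close> on an interval that contains a rational time.\<close>

lemma cadlag_hat_iff:
  assumes w: "w \<in> paths S" and u: "u \<in> {0..<1}" and s: "0 \<le> s" and al: "alive u w s"
  shows "cadlag_hat S u w s \<longleftrightarrow> (\<forall>p\<in>\<rat> \<inter> {0..<s}. \<not> exits_at_one u w s p)"
proof
  let ?p = "\<lambda>t\<in>{0..s}. hat_path u w t"
  assume g: "cadlag_hat S u w s"
  show "\<forall>p\<in>\<rat> \<inter> {0..<s}. \<not> exits_at_one u w s p"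
  proof (intro ballI notI)
    fix p assume p: "p \<in> \<rat> \<inter> {0..<s}" and e: "exits_at_one u w s p"
    define t where "t = p + (1 - age u w p)"
    have ap: "age u w p < 1" using al p unfolding alive_def by simp
    have t: "p < t" "t \<le> s" "0 \<le> p" using ap e p unfolding t_def exits_at_one_def by auto
    have sp: "shift p w \<in> paths S" by (rule shift_paths[OF w t(3)])
    have ex: "exit0 (shift p w) = ereal (t - p)" using e unfolding exits_at_one_def t_def by simp
    have z: "w r = 0" if "p \<le> r" "r < t" for r
      using exit0_eq_iff(2)[OF sp _ ex, of "r - p"] that by simp
    have hp: "?p r = (discrete 0, age u w p + (r - p))" if "p < r" "r < t" for r
      using age_left[of p r w u] z that t by (simp add: hat_path_eq)
    have "cadlag {0..s} (hat_space S) ?p" using g unfolding cadlag_hat_def skorokhod_def by blast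
    moreover have "t \<in> {0..s}" using t by simp
    ultimately obtain l where l: "l \<in> hat_space S" "(?p \<longlongrightarrow> l) (at t within {0..s} \<inter> {..<t})"
      unfolding cadlag_def by blast
    have "((\<lambda>r. (discrete 0, age u w p + (r - p))) \<longlongrightarrow> (discrete 0, age u w p + (t - p))) (at t within {0..s} \<inter> {..<t})"
      by (intro tendsto_intros)
    moreover have "\<forall>\<^sub>F r in at t within {0..s} \<inter> {..<t}. (discrete 0, age u w p + (r - p)) = ?p r"
      unfolding eventually_at
    proof (intro exI[of _ "t - p"] conjI ballI impI)
      fix r assume "r \<in> {0..s} \<inter> {..<t}" "r \<noteq> t \<and> dist r t < t - p"
      then have "p < r" "r < t" by (auto simp: dist_real_def)
      then show "(discrete 0, age u w p + (r - p)) = ?p r" by (rule hp[symmetric])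
    qed (use t in simp)
    ultimately have "(?p \<longlongrightarrow> (discrete 0, age u w p + (t - p))) (at t within {0..s} \<inter> {..<t})"
      by (rule Lim_transform_eventually)
    moreover have "at t within {0..s} \<inter> {..<t} \<noteq> bot"
    proof -
      have "{p<..<t} \<subseteq> {0..s} \<inter> {..<t}" using t by auto
      then have "at t within {p<..<t} \<le> at t within {0..s} \<inter> {..<t}" by (rule at_le)
      moreover have "at t within {p<..<t} \<noteq> bot" using t(1) by (simp add: at_within_eq_bot_iff trivial_limit_within islimpt_greaterThanLessThan2)
      ultimately show ?thesis using bot.extremum_uniqueI by metis
    qed
    ultimately have "l = (discrete 0, age u w p + (t - p))" using l(2) tendsto_unique by blast
    then have "l = holding 1" unfolding t_def by simp
    moreover have "holding 1 \<notin> hat_space S" unfolding hat_space_def by auto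
    ultimately show False using l(1) by blast
  qed
next
  let ?p = "\<lambda>t\<in>{0..s}. hat_path u w t"
  assume n: "\<forall>p\<in>\<rat> \<inter> {0..<s}. \<not> exits_at_one u w s p"
  have u0: "0 \<le> u" using u by simp
  have inE: "?p t \<in> hat_space S" if "t \<in> {0..s}" for t
    using hat_path_in[OF w _ _ u0, of t] alive_antimono[OF al] that by simp
  have right: "(?p \<longlongrightarrow> ?p t) (at t within {0..s} \<inter> {t<..})" if t: "t \<in> {0..s}" for t
  proof -
    have "0 \<le> t" using t by simp
    then obtain e where e: "e > 0" "\<And>r. t \<le> r \<Longrightarrow> r < t + e \<Longrightarrow> w r = w t \<and> age u w r = (if w t = 0 then age u w t + (r - t) else 0)"
      using age_right[OF w] by metis
    define g where "g r = (discrete (w t), if w t = 0 then age u w t + (r - t) else 0)" for r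
    have A: "(g \<longlongrightarrow> g t) (at t within {0..s} \<inter> {t<..})"
    proof (cases "w t = 0")
      case True
      have "((\<lambda>r. (discrete (w t), age u w t + (r - t))) \<longlongrightarrow> (discrete (w t), age u w t + (t - t))) (at t within {0..s} \<inter> {t<..})"
        by (intro tendsto_intros)
      then show ?thesis unfolding g_def using True by simp
    next
      case False
      then have "g = (\<lambda>_. excursion (w t))" unfolding g_def by auto
      then show ?thesis by simp
    qed
    have B: "g t = ?p t" unfolding g_def using t by (simp add: hat_path_eq age_eq[of u w t])
    have "g r = ?p r" if "r \<in> {0..s} \<inter> {t<..}" "dist r t < e" for r
      using e(2)[of r] that unfolding g_def by (simp add: hat_path_eq dist_real_def)
    then have C: "\<forall>\<^sub>F r in at t within {0..s} \<inter> {t<..}. g r = ?p r"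
      unfolding eventually_at using e(1) by blast
    show ?thesis by (rule Lim_transform_eventually[OF A[unfolded B] C])
  qed
  have left: "\<exists>l\<in>hat_space S. (?p \<longlongrightarrow> l) (at t within {0..s} \<inter> {..<t})" if t: "t \<in> {0..s}" for t
  proof (cases "t = 0")
    case True
    have "{0..s} \<inter> {..<t} = {}" using True by auto
    then have "(?p \<longlongrightarrow> ?p t) (at t within {0..s} \<inter> {..<t})" by simp
    then show ?thesis using inE[OF t] by blast
  next
    case False
    then have t0: "0 < t" using t by simp
    obtain l e where l: "l \<in> S" "e > 0" "e \<le> t" "\<forall>r\<in>{t-e<..<t}. w r = l" using paths_left[OF w t0] by blast
    show ?thesis
    proof (cases "l = 0")
      case False
      have hp: "excursion l = ?p r" if "r \<in> {0..s} \<inter> {..<t}" "dist r t < e" for r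
        using bspec[OF l(4), of r] that False by (simp add: hat_path_eq dist_real_def age_eq[of u w r])
      then have "\<forall>\<^sub>F r in at t within {0..s} \<inter> {..<t}. excursion l = ?p r"
        unfolding eventually_at using l(2) by blast
      then have "(?p \<longlongrightarrow> excursion l) (at t within {0..s} \<inter> {..<t})"
        by (rule Lim_transform_eventually[OF tendsto_const])
      moreover have "excursion l \<in> hat_space S" using l(1) False unfolding hat_space_def by auto
      ultimately show ?thesis by blast
    next
      case True
      obtain q where q: "q \<in> \<rat>" "t - e < q" "q < t" using Rats_dense_in_real[of "t - e" t] l(2) by auto
      then have q0: "0 \<le> q" using l(3) by simp
      have z: "w r = 0" if "q \<le> r" "r < t" for r using bspec[OF l(4), of r] that q True by simp
      have ag: "age u w r = age u w q + (r - q)" if "q \<le> r" "r < t" for r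
        using age_left[OF q0 that(1), of w u] z that by simp
      \<comment> \<open>A left limit of the age above 1 would mean that age 1 was reached before t,
        against survival.\<close>
      have "age u w q + (t - q) \<le> 1"
      proof (rule ccontr)
        assume a: "\<not> ?thesis"
        define r where "r = q + (1 - age u w q)"
        have "age u w q < 1" using al t q q0 unfolding alive_def by simp
        then have r: "q \<le> r" "r < t" unfolding r_def using a q by auto
        then have "age u w r < 1" using al t q0 unfolding alive_def by simp
        moreover have "age u w r = 1" using ag[OF r] unfolding r_def by simp
        ultimately show False by simp
      qed
      \<comment> \<open>Suppose the left limit is 1. If the path is still in 0 at t, it has age 1
        there and is dead; otherwise it leaves 0 at this moment, which is the excluded event at the
        rational q.\<close>
      moreover have "age u w q + (t - q) \<noteq> 1"
      proof
        assume a: "age u w q + (t - q) = 1"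
        show False
        proof (cases "w t = 0")
          case True
          have "age u w t = age u w q + (t - q)" 
          proof (rule age_left[OF q0])
            fix r assume "q \<le> r" "r \<le> t"
            then show "w r = 0" using z[of r] True by (cases "r = t") auto
          qed (use q in simp)
          then show False using a al t unfolding alive_def by force
        next
          case False
          have sp: "shift q w \<in> paths S" by (rule shift_paths[OF w q0])
          have "\<not> stay (t - q) (shift q w)" using False q unfolding stay_def by (auto intro!: bexI[of _ "t - q"])
          then have "\<not> ereal (t - q) < exit0 (shift q w)" using exit0_gt_iff[OF sp, of "t - q"] q by simp
          moreover have "\<not> exit0 (shift q w) < ereal (t - q)"
          proof
            assume "exit0 (shift q w) < ereal (t - q)"
            then obtain r where "0 \<le> r" "r < t - q" "shift q w r \<noteq> 0" unfolding exit0_def first_time_less_iff by blast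
            then show False using z[of "q + r"] by simp
          qed
          ultimately have "exit0 (shift q w) = ereal (t - q)" by simp
          moreover have "t - q = 1 - age u w q" using a by simp
          ultimately have "exits_at_one u w s q" unfolding exits_at_one_def using z[of q] q t by simp
          then show False using n q q0 t by auto
        qed
      qed
      ultimately have lt: "age u w q + (t - q) < 1" by simp
      have hp: "(discrete 0, age u w q + (r - q)) = ?p r" if "r \<in> {0..s} \<inter> {..<t}" "dist r t < t - q" for r
        using ag[of r] z[of r] that by (simp add: hat_path_eq dist_real_def)
      have "0 < t - q" using q by simp
      then have C: "\<forall>\<^sub>F r in at t within {0..s} \<inter> {..<t}. (discrete 0, age u w q + (r - q)) = ?p r"
        unfolding eventually_at using hp by blast
      have A: "((\<lambda>r. (discrete 0, age u w q + (r - q))) \<longlongrightarrow> holding (age u w q + (t - q))) (at t within {0..s} \<inter> {..<t})"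
        by (intro tendsto_intros)
      have "(?p \<longlongrightarrow> holding (age u w q + (t - q))) (at t within {0..s} \<inter> {..<t})"
        by (rule Lim_transform_eventually[OF A C])
      moreover have "holding (age u w q + (t - q)) \<in> hat_space S"
        using lt age_nonneg[OF u0 q0, of w] q unfolding hat_space_def by auto
      ultimately show ?thesis by blast
    qed
  qed
  show "cadlag_hat S u w s"
    unfolding cadlag_hat_def skorokhod_def cadlag_def
    by (intro CollectI conjI ballI restrict_extensional image_subsetI inE right left)
qed

lemma pred_exits_at_one:
  assumes "0 \<le> p"
  shows "Measurable.pred (path_space S) (\<lambda>w. exits_at_one u w s p)"
proof -
  have 1: "Measurable.pred (path_space S) (\<lambda>w. w p = 0)"
    by (intro pred_count_space_const1 measurable_coordinate assms)
  have 2: "(\<lambda>w. exit0 (shift p w)) \<in> borel_measurable (path_space S)"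
    by (rule measurable_compose[OF measurable_shift[OF assms] measurable_exit0])
  have 3 [measurable]: "(\<lambda>w. age u w p) \<in> borel_measurable (path_space S)" by (rule measurable_age[OF assms])
  have 4: "(\<lambda>w. ereal (1 - age u w p)) \<in> borel_measurable (path_space S)" by measurable
  have 5: "(\<lambda>w. p + (1 - age u w p)) \<in> borel_measurable (path_space S)" by measurable
  have 6: "Measurable.pred (path_space S) (\<lambda>w. exit0 (shift p w) = ereal (1 - age u w p))"
    unfolding pred_def by (rule borel_measurable_eq[OF 2 4])
  have 7: "Measurable.pred (path_space S) (\<lambda>w. p + (1 - age u w p) \<le> s)"
    unfolding pred_def by (rule borel_measurable_le[OF 5 borel_measurable_const])
  show ?thesis unfolding exits_at_one_def by (intro pred_intros_logic(3) 1 6 7)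
qed

text \<open>On surviving paths the cadlag condition reduces to countably many events, so
  measurability is obtained for the conjunction.\<close>

lemma pred_alive_cadlag_hat:
  assumes u: "u \<in> {0..<1}" and s: "0 \<le> s"
  shows "Measurable.pred (path_space S) (\<lambda>w. alive u w s \<and> cadlag_hat S u w s)"
proof -
  have "countable (\<rat> \<inter> {0..<s})" by (simp add: countable_rat)
  then have m: "Measurable.pred (path_space S) (\<lambda>w. alive u w s \<and> (\<forall>p\<in>\<rat> \<inter> {0..<s}. \<not> exits_at_one u w s p))"
    by (intro pred_intros_logic(3) pred_alive[OF u] pred_countable_Ball pred_intros_logic(2) pred_exits_at_one) auto
  show ?thesis
    by (rule measurable_cong[THEN iffD1, OF _ m]) (use cadlag_hat_iff[OF _ u s] in auto)
qed

lemma cadlag_hat_stop [simp]: "0 \<le> s \<Longrightarrow> cadlag_hat S u (stop s w) s = cadlag_hat S u w s"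
proof -
  assume s: "0 \<le> s"
  have "(\<lambda>t\<in>{0..s}. hat_path u (stop s w) t) = (\<lambda>t\<in>{0..s}. hat_path u w t)"
    by (rule restrict_ext) simp
  then show ?thesis unfolding cadlag_hat_def by simp
qed

lemma space_path_sigma [simp]: "space (path_sigma s E) = skorokhod s E"
  unfolding path_sigma_def space_restrict_space space_PiM by (auto simp: skorokhod_def PiE_def)

lemma measurable_path_sigma_coord [measurable]:
  "t \<in> {0..s} \<Longrightarrow> (\<lambda>w. w t) \<in> borel_measurable (path_sigma s E)"
  unfolding path_sigma_def by (intro measurable_restrict_space1 measurable_component_singleton)

lemma skorokhod_in: "w \<in> skorokhod s E \<Longrightarrow> t \<in> {0..s} \<Longrightarrow> w t \<in> E"
  unfolding skorokhod_def cadlag_def by blast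

lemma measurable_hpath:
  assumes u: "u \<in> {0..<1}" and s: "0 \<le> s"
  shows "(\<lambda>w. \<lambda>t\<in>{0..s}. hat_path u w t) \<in> 
    restrict_space (path_space S) {w \<in> paths S. alive u w s \<and> cadlag_hat S u w s} \<rightarrow>\<^sub>M path_sigma s (hat_space S)"
  unfolding path_sigma_def
proof (rule measurable_restrict_space2)
  show "(\<lambda>w. \<lambda>t\<in>{0..s}. hat_path u w t) \<in> restrict_space (path_space S) {w \<in> paths S. alive u w s \<and> cadlag_hat S u w s} \<rightarrow>\<^sub>M PiM {0..s} (\<lambda>_. borel)"
    by (intro measurable_restrict_space1 measurable_restrict measurable_hat_path) simp
qed (auto simp: space_restrict_space cadlag_hat_def)

text \<open>The pullback of a functional of hat paths to chain paths, with value 0 on dead and on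
  discarded paths. Integrals against path laws thus become integrals over chain paths, where the
  Markov property is available.\<close>

definition on_path :: "nat set \<Rightarrow> real \<Rightarrow> real \<Rightarrow> ((real \<Rightarrow> hat) \<Rightarrow> ennreal) \<Rightarrow> (real \<Rightarrow> nat) \<Rightarrow> ennreal" where
  "on_path S u s f w = (if alive u w s \<and> cadlag_hat S u w s then f (\<lambda>t\<in>{0..s}. hat_path u w t) else 0)"

lemma measurable_on_path:
  assumes u: "u \<in> {0..<1}" and s: "0 \<le> s" and f: "f \<in> borel_measurable (path_sigma s (hat_space S))"
  shows "on_path S u s f \<in> borel_measurable (path_space S)"
proof -
  let ?O = "{w \<in> paths S. alive u w s \<and> cadlag_hat S u w s}"
  have O: "?O \<inter> space (path_space S) \<in> sets (path_space S)"
    using sets_Collect_path[OF pred_alive_cadlag_hat[OF u s]] sets.top[of "path_space S"] by auto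
  have "(\<lambda>w. f (\<lambda>t\<in>{0..s}. hat_path u w t)) \<in> borel_measurable (restrict_space (path_space S) ?O)"
    by (rule measurable_compose[OF measurable_hpath[OF u s] f])
  then have m: "(\<lambda>w. f (\<lambda>t\<in>{0..s}. hat_path u w t) * indicator ?O w) \<in> borel_measurable (path_space S)"
    by (simp add: borel_measurable_restrict_space_iff_ennreal[OF O])
  show ?thesis
    by (rule measurable_cong[THEN iffD1, OF _ m]) (auto simp: on_path_def indicator_def)
qed

lemma on_path_stop: "0 \<le> s \<Longrightarrow> on_path S u s f (stop s w) = on_path S u s f w"
proof -
  assume s: "0 \<le> s"
  have "(\<lambda>t\<in>{0..s}. hat_path u (stop s w) t) = (\<lambda>t\<in>{0..s}. hat_path u w t)"
    by (rule restrict_ext) simp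
  then show ?thesis unfolding on_path_def using s by simp
qed

context subexponential_chain
begin

section \<open>Exits at age exactly 1 form a null set\<close>

lemma sets_exit0_eq: "{w \<in> paths S. exit0 w = ereal c} \<in> sets (path_space S)"
proof -
  have "Measurable.pred (path_space S) (\<lambda>w. exit0 w = ereal c)" by measurable
  then show ?thesis by (rule sets_Collect_path)
qed

text \<open>The exit time from 0 has the continuous tail exp(q00 t), hence no atom at c > 0. For c
  \<le> 0, right-continuity at the starting point 0 makes the exit time positive.\<close>

lemma exit0_null: "measure (Q 0) {w \<in> paths S. exit0 w = ereal c} = 0"
proof (cases "0 < c")
  case True
  interpret Q0: prob_space "Q 0" by (rule prob_space_Q)
  \<comment> \<open>Scaling the mesh by c keeps the approximating times in [0, c).\<close>
  have b: "0 \<le> c - c * mesh n" "c - c * mesh n < c" for n using True mesh_bounds[of n] by (auto simp: field_simps)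
  have ms: "{w \<in> paths S. stay r w} \<in> sets (Q 0)" if "0 \<le> r" for r
    using sets_Collect_path[OF pred_stay[OF that]] by simp
  have le: "measure (Q 0) {w \<in> paths S. exit0 w = ereal c} \<le> exp (q 0 0 * (c - c * mesh n)) - exp (q 0 0 * c)" for n
  proof -
    have "measure (Q 0) {w \<in> paths S. exit0 w = ereal c} \<le> measure (Q 0) ({w \<in> paths S. stay (c - c * mesh n) w} - {w \<in> paths S. stay c w})"
    proof (rule Q0.finite_measure_mono)
      show "{w \<in> paths S. exit0 w = ereal c} \<subseteq> {w \<in> paths S. stay (c - c * mesh n) w} - {w \<in> paths S. stay c w}"
      proof
        fix w assume "w \<in> {w \<in> paths S. exit0 w = ereal c}"
        then have w: "w \<in> paths S" "exit0 w = ereal c" by auto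
        have "stay (c - c * mesh n) w" using exit0_gt_iff[OF w(1) b(1)[of n]] b(2)[of n] unfolding w(2) by simp
        moreover have "\<not> stay c w" using exit0_gt_iff[OF w(1), of c] True unfolding w(2) by simp
        ultimately show "w \<in> {w \<in> paths S. stay (c - c * mesh n) w} - {w \<in> paths S. stay c w}" using w by blast
      qed
    qed (use ms b(1)[of n] True in auto)
    also have "\<dots> = exp (q 0 0 * (c - c * mesh n)) - exp (q 0 0 * c)"
      using stay_prob[OF b(1)[of n]] stay_prob[of c] True ms b(1)[of n] stay_antimono[of c _ "c - c * mesh n"] b(2)[of n]
      by (subst Q0.finite_measure_Diff) auto
    finally show ?thesis .
  qed
  have "(\<lambda>n. exp (q 0 0 * (c - c * mesh n)) - exp (q 0 0 * c)) \<longlonglongrightarrow> exp (q 0 0 * (c - c * 0)) - exp (q 0 0 * c)"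
    by (intro tendsto_intros mesh_lim)
  then have "measure (Q 0) {w \<in> paths S. exit0 w = ereal c} \<le> exp (q 0 0 * (c - c * 0)) - exp (q 0 0 * c)"
    by (rule LIMSEQ_le_const) (use le in auto)
  then show ?thesis using measure_nonneg[of "Q 0"] by (simp add: antisym)
next
  case False
  interpret Q0: prob_space "Q 0" by (rule prob_space_Q)
  have "AE w in Q 0. w \<notin> {w \<in> paths S. exit0 w = ereal c}"
    using AE_start[OF zero_state]
  proof eventually_elim
    case (elim w)
    have "ereal 0 < exit0 w" if "w \<in> paths S" using exit0_gt_iff[OF that, of 0] elim by (simp add: stay_def)
    then show ?case using False by auto
  qed
  moreover have "{w \<in> paths S. exit0 w = ereal c} \<in> sets (Q 0)"
    using sets_exit0_eq[of c] by simp
  ultimately show ?thesis by (simp add: Q0.prob_eq_0)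
qed

text \<open>Given the path up to a rational p at which it is in 0, a bad exit requires the exit time
  of the restarted chain to equal the known number 1 - age, which has probability zero. Countably
  many p remain.\<close>

lemma AE_cadlag_hat:
  assumes j: "j \<in> S" and u: "u \<in> {0..<1}" and s: "0 \<le> s"
  shows "AE w in Q j. alive u w s \<longrightarrow> cadlag_hat S u w s"
proof -
  interpret Q0: prob_space "Q 0" by (rule prob_space_Q)
  have "AE w in Q j. \<not> exits_at_one u w s p" if p: "0 \<le> p" for p
  proof -
    define G :: "(real \<Rightarrow> nat) \<times> (real \<Rightarrow> nat) \<Rightarrow> ennreal" where
      "G = (\<lambda>(v, w). if v p = 0 \<and> exit0 w = ereal (1 - age u v p) then 1 else 0)"
    have G: "G \<in> borel_measurable (path_space S \<Otimes>\<^sub>M path_space S)"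
    proof -
      have 1: "Measurable.pred (path_space S) (\<lambda>w. w p = 0)"
        by (intro pred_count_space_const1 measurable_coordinate p)
      note [measurable] = 1 measurable_age[OF p]
      show ?thesis unfolding G_def by measurable
    qed
    have "(\<integral>\<^sup>+w. G (stop p w, shift p w) \<partial>Q j) = (\<integral>\<^sup>+w. (\<integral>\<^sup>+w'. G (stop p w, w') \<partial>Q (w p)) \<partial>Q j)"
      by (rule markov_nn_integral[OF j p G])
    also have "\<dots> = (\<integral>\<^sup>+w. 0 \<partial>Q j)"
    proof (rule nn_integral_cong)
      fix w
      show "(\<integral>\<^sup>+w'. G (stop p w, w') \<partial>Q (w p)) = 0"
      proof (cases "w p = 0")
        case True
        have m: "{w \<in> paths S. exit0 w = ereal (1 - age u w' p)} \<in> sets (Q 0)" for w'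
          using sets_exit0_eq by simp
        have "(\<integral>\<^sup>+w'. G (stop p w, w') \<partial>Q (w p)) = (\<integral>\<^sup>+w'. indicator {w' \<in> paths S. exit0 w' = ereal (1 - age u w p)} w' \<partial>Q 0)"
          unfolding True G_def using True p by (intro nn_integral_cong) (auto simp: indicator_def)
        also have "\<dots> = 0"
          unfolding nn_integral_indicator[OF m] by (simp add: Q0.emeasure_eq_measure exit0_null)
        finally show ?thesis .
      next
        case False
        then show ?thesis unfolding G_def using p by simp
      qed
    qed
    finally have "(\<integral>\<^sup>+w. G (stop p w, shift p w) \<partial>Q j) = 0" by simp
    moreover have "(\<lambda>w. G (stop p w, shift p w)) \<in> borel_measurable (Q j)"
      using measurable_compose[OF measurable_Pair[OF measurable_stop[OF p] measurable_shift[OF p]] G]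
      by (simp add: measurable_cong_sets[OF sets_Q refl])
    ultimately have "AE w in Q j. G (stop p w, shift p w) = 0" by (simp add: nn_integral_0_iff_AE)
    then show ?thesis
    proof eventually_elim
      case (elim w)
      then show ?case unfolding G_def exits_at_one_def using p by (auto split: if_splits)
    qed
  qed
  then have "AE w in Q j. \<forall>p\<in>\<rat> \<inter> {0..<s}. \<not> exits_at_one u w s p"
    by (subst AE_ball_countable) (auto simp: countable_rat)
  then show ?thesis
    using AE_space by eventually_elim (use cadlag_hat_iff[OF _ u s] in auto)
qed

text \<open>M is left open so that the same computation serves the law of the chain and its
  conditioning on survival.\<close>

lemma nn_integral_alive_law:
  assumes y: "y \<in> hat_space S" and s: "0 \<le> s"
    and M: "sets M = sets (P (chain_state y))" and f: "f \<in> borel_measurable (path_sigma s (hat_space S))"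
  shows "(\<integral>\<^sup>+w. f w \<partial>alive_law S X y M s) = (\<integral>\<^sup>+\<omega>. on_path S (snd y) s f (\<lambda>t\<in>{0..}. X t \<omega>) \<partial>M)"
proof -
  note j = hat_spaceD(1)[OF y] and u = hat_spaceD(2)[OF y]
  let ?j = "chain_state y" and ?u = "snd y"
  have sp: "space M = space (P ?j)" by (rule sets_eq_imp_space_eq[OF M])
  let ?pi = "\<lambda>\<omega>. \<lambda>t\<in>{0..}. X t \<omega>"
  have pi: "?pi \<in> M \<rightarrow>\<^sub>M path_space S" using measurable_path[OF j] by (simp add: measurable_cong_sets[OF M refl])
  let ?O = "{\<omega> \<in> space M. ereal s < tau X y \<omega> \<and> (\<lambda>t\<in>{0..s}. hatX X y t \<omega>) \<in> skorokhod s (hat_space S)}"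
  have hp: "(\<lambda>t\<in>{0..s}. hatX X y t \<omega>) = (\<lambda>t\<in>{0..s}. hat_path ?u (?pi \<omega>) t)" for \<omega>
    by (rule restrict_ext) (simp add: hatX_path)
  have iff: "ereal s < tau X y \<omega> \<and> (\<lambda>t\<in>{0..s}. hatX X y t \<omega>) \<in> skorokhod s (hat_space S) \<longleftrightarrow>
      alive ?u (?pi \<omega>) s \<and> cadlag_hat S ?u (?pi \<omega>) s" if "\<omega> \<in> space M" for \<omega>
    unfolding cadlag_hat_def hp using tau_gt_alive[OF j _ s, of \<omega> y] that unfolding sp by blast
  then have O: "?O = {\<omega> \<in> space M. alive ?u (?pi \<omega>) s \<and> cadlag_hat S ?u (?pi \<omega>) s}" by blast
  have mO: "?O \<in> sets M"
    using measurable_compose[OF pi pred_alive_cadlag_hat[OF u s]] unfolding O by (simp add: pred_def)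
  have mX: "(\<lambda>\<omega>. \<lambda>t\<in>{0..s}. hatX X y t \<omega>) \<in> restrict_space M ?O \<rightarrow>\<^sub>M path_sigma s (hat_space S)"
  proof -
    have "?pi \<in> restrict_space M ?O \<rightarrow>\<^sub>M restrict_space (path_space S) {w \<in> paths S. alive ?u w s \<and> cadlag_hat S ?u w s}"
    proof (rule measurable_restrict_space2[OF _ measurable_restrict_space1[OF pi]])
      show "?pi \<in> space (restrict_space M ?O) \<rightarrow> {w \<in> paths S. alive ?u w s \<and> cadlag_hat S ?u w s}"
        using measurable_space[OF pi] unfolding O by (auto simp: space_restrict_space)
    qed
    from measurable_compose[OF this measurable_hpath[OF u s]] show ?thesis unfolding hp .
  qed
  have "(\<integral>\<^sup>+w. f w \<partial>alive_law S X y M s) = (\<integral>\<^sup>+\<omega>. f (\<lambda>t\<in>{0..s}. hatX X y t \<omega>) \<partial>restrict_space M ?O)"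
    unfolding alive_law_def by (rule nn_integral_distr[OF mX]) (simp add: f)
  also have "\<dots> = (\<integral>\<^sup>+\<omega>. f (\<lambda>t\<in>{0..s}. hatX X y t \<omega>) * indicator ?O \<omega> \<partial>M)"
    using mO by (intro nn_integral_restrict_space) (simp add: Int_absorb2 subset_eq)
  also have "\<dots> = (\<integral>\<^sup>+\<omega>. on_path S ?u s f (?pi \<omega>) \<partial>M)"
  proof (rule nn_integral_cong)
    fix \<omega> assume "\<omega> \<in> space M"
    then have "\<omega> \<in> ?O \<longleftrightarrow> alive ?u (?pi \<omega>) s \<and> cadlag_hat S ?u (?pi \<omega>) s" using iff by blast
    then have "on_path S ?u s f (?pi \<omega>) = (if \<omega> \<in> ?O then f (\<lambda>t\<in>{0..s}. hatX X y t \<omega>) else 0)"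
      unfolding on_path_def hp[symmetric] by (simp only:)
    then show "f (\<lambda>t\<in>{0..s}. hatX X y t \<omega>) * indicator ?O \<omega> = on_path S ?u s f (?pi \<omega>)"
      by (simp only: indicator_def) (simp split: if_split)
  qed
  finally show ?thesis .
qed

lemma sets_hat_law [simp]: "sets (hat_law S P X y s) = sets (path_sigma s (hat_space S))"
  and space_hat_law [simp]: "space (hat_law S P X y s) = skorokhod s (hat_space S)"
  unfolding hat_law_def alive_law_def by simp_all

lemma nn_integral_hat_law:
  assumes y: "y \<in> hat_space S" and s: "0 \<le> s" and f: "f \<in> borel_measurable (path_sigma s (hat_space S))"
  shows "(\<integral>\<^sup>+w. f w \<partial>hat_law S P X y s) = (\<integral>\<^sup>+w. on_path S (snd y) s f w \<partial>Q (chain_state y))"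
  unfolding hat_law_def nn_integral_alive_law[OF y s refl f]
  by (rule nn_integral_Q[symmetric, OF hat_spaceD(1)[OF y] measurable_on_path[OF hat_spaceD(2)[OF y] s f]])

end


lemma restrict_skorokhod:
  assumes w: "w \<in> skorokhod r E" and s: "s \<le> r"
  shows "restrict w {0..s} \<in> skorokhod s E"
proof -
  have c: "cadlag {0..r} E w" using w unfolding skorokhod_def by blast
  have ev: "\<forall>\<^sub>F x in at t within {0..s} \<inter> J. w x = restrict w {0..s} x" for t :: real and J
    unfolding eventually_at_filter by (intro always_eventually allI impI) simp
  have "(restrict w {0..s} \<longlongrightarrow> restrict w {0..s} t) (at t within {0..s} \<inter> {t<..})" if t: "t \<in> {0..s}" for t
  proof -
    have "(w \<longlongrightarrow> w t) (at t within {0..r} \<inter> {t<..})" using c t s unfolding cadlag_def by simp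
    then have "(w \<longlongrightarrow> w t) (at t within {0..s} \<inter> {t<..})" by (rule tendsto_within_subset) (use s in auto)
    from Lim_transform_eventually[OF this ev] show ?thesis using t by (simp only: restrict_apply')
  qed
  moreover have "\<exists>l\<in>E. (restrict w {0..s} \<longlongrightarrow> l) (at t within {0..s} \<inter> {..<t})" if t: "t \<in> {0..s}" for t
  proof -
    have "t \<in> {0..r}" using t s by simp
    then obtain l where l: "l \<in> E" "(w \<longlongrightarrow> l) (at t within {0..r} \<inter> {..<t})" using c unfolding cadlag_def by blast
    from l(2) have "(w \<longlongrightarrow> l) (at t within {0..s} \<inter> {..<t})" by (rule tendsto_within_subset) (use s in auto)
    from Lim_transform_eventually[OF this ev] show ?thesis using l(1) by blast
  qed
  moreover have "restrict w {0..s} t \<in> E" if "t \<in> {0..s}" for t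
    using skorokhod_in[OF w, of t] that s by simp
  ultimately show ?thesis unfolding skorokhod_def cadlag_def by blast
qed

lemma measurable_restrict_path:
  assumes "0 \<le> s" "s \<le> r"
  shows "(\<lambda>w. restrict w {0..s}) \<in> path_sigma r E \<rightarrow>\<^sub>M path_sigma s E"
  unfolding path_sigma_def[of s]
proof (rule measurable_restrict_space2)
  show "(\<lambda>w. restrict w {0..s}) \<in> space (path_sigma r E) \<rightarrow> skorokhod s E"
    using restrict_skorokhod assms by auto
  show "(\<lambda>w. restrict w {0..s}) \<in> path_sigma r E \<rightarrow>\<^sub>M PiM {0..s} (\<lambda>_. borel)"
    by (intro measurable_restrict measurable_path_sigma_coord) (use assms in auto)
qed

lemma measurable_at_time:
  assumes "t \<in> {0..s}" "g \<in> borel_measurable (restrict_space borel E)"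
  shows "(\<lambda>w. g (w t)) \<in> borel_measurable (path_sigma s E)"
proof -
  have "(\<lambda>w. w t) \<in> path_sigma s E \<rightarrow>\<^sub>M restrict_space borel E"
    using assms(1) skorokhod_in by (intro measurable_restrict_space2 measurable_path_sigma_coord) auto
  from measurable_compose[OF this assms(2)] show ?thesis .
qed

context subexponential_chain
begin

text \<open>This identifies the limit h(w s) / h y of the conditional densities with the density h(w
  s) / h(w 0) in the definition of the transformed law.\<close>

lemma AE_hat_law_start:
  assumes y: "y \<in> hat_space S" and s: "0 \<le> s"
  shows "AE w in hat_law S P X y s. w 0 = y"
proof -
  let ?f = "\<lambda>w :: real \<Rightarrow> hat. indicator (- {y}) (w 0) :: ennreal"
  have f: "?f \<in> borel_measurable (path_sigma s (hat_space S))"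
    using s by (intro measurable_compose[OF measurable_path_sigma_coord]) auto
  have "(\<integral>\<^sup>+w. ?f w \<partial>hat_law S P X y s) = (\<integral>\<^sup>+w. on_path S (snd y) s ?f w \<partial>Q (chain_state y))"
    by (rule nn_integral_hat_law[OF y s f])
  also have "\<dots> = (\<integral>\<^sup>+w. 0 \<partial>Q (chain_state y))"
    using AE_start[OF hat_spaceD(1)[OF y]]
    by (intro nn_integral_cong_AE, eventually_elim) (use s in \<open>simp add: on_path_def hat_path_0[OF y]\<close>)
  finally have "(\<integral>\<^sup>+w. ?f w \<partial>hat_law S P X y s) = 0" by simp
  moreover have "?f \<in> borel_measurable (hat_law S P X y s)"
    using f by (simp add: measurable_cong_sets[OF sets_hat_law refl])
  ultimately have "AE w in hat_law S P X y s. ?f w = 0" by (simp add: nn_integral_0_iff_AE)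
  then show ?thesis by eventually_elim (simp add: indicator_def split: if_splits)
qed

section \<open>The h-transformed path law\<close>

abbreviation X_inf :: "hat \<Rightarrow> real \<Rightarrow> (real \<Rightarrow> hat) measure" where
  "X_inf \<equiv> \<lambda>y. h_transform_law h (hat_law S P X y)"

lemma measurable_h_ratio:
  assumes "0 \<le> s"
  shows "(\<lambda>w. h (w s) / h (w 0)) \<in> borel_measurable (path_sigma s (hat_space S))"
proof -
  have "(\<lambda>w. h (w t)) \<in> borel_measurable (path_sigma s (hat_space S))" if "t \<in> {0..s}" for t
    by (rule measurable_compose[OF measurable_path_sigma_coord[OF that] measurable_h_lim])
  then show ?thesis using assms by (intro borel_measurable_divide) auto
qed

text \<open>The density at s + t is the density at s times the ratio of \<open>h\<close> at the
  times s + t and s. The Markov property at s integrates the second factor into the transformed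
  kernel and leaves the first as the density of the law up to s.\<close>

lemma has_semigroup_X_inf:
  assumes y: "y \<in> hat_space S"
  shows "has_semigroup (hat_space S) (X_inf y) P_inf"
  unfolding has_semigroup_def
proof (intro allI impI ballI)
  fix s t :: real and B A
  assume s: "0 \<le> s" and t: "0 \<le> t" and B: "B \<in> sets (path_sigma s (hat_space S))"
    and A: "A \<in> sets (restrict_space borel (hat_space S))"
  note j = hat_spaceD(1)[OF y] and u = hat_spaceD(2)[OF y]
  let ?j = "chain_state y" and ?u = "snd y" and ?E = "hat_space S"
  have st: "0 \<le> s + t" "s \<le> s + t" using s t by auto
  have A' [measurable]: "A \<in> sets borel" by (rule sets_hatD[OF A])
  have sL: "sets (X_inf y r) = sets (path_sigma r ?E)" "space (X_inf y r) = skorokhod r ?E" for r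
    unfolding h_transform_law_def by simp_all
  define D where "D = {w \<in> skorokhod (s + t) ?E. restrict w {0..s} \<in> B \<and> w (s + t) \<in> A}"
  have D: "D \<in> sets (path_sigma (s + t) ?E)"
  proof -
    have "D = ((\<lambda>w. restrict w {0..s}) -` B \<inter> space (path_sigma (s + t) ?E)) \<inter> ((\<lambda>w. w (s + t)) -` A \<inter> space (path_sigma (s + t) ?E))"
      unfolding D_def by auto
    also have "\<dots> \<in> sets (path_sigma (s + t) ?E)"
      by (intro sets.Int measurable_sets[OF measurable_restrict_path[OF s st(2)] B]
        measurable_sets[OF measurable_path_sigma_coord A']) (use st in auto)
    finally show ?thesis .
  qed
  let ?r = "\<lambda>s w. ennreal (h (w s) / h (w 0))"
  have mr: "?r s \<in> borel_measurable (path_sigma s ?E)" if "0 \<le> s" for s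
    using measurable_h_ratio[OF that] by measurable
  let ?f = "\<lambda>z. ennreal (h z / h y) * indicator A z"
  have f: "?f \<in> borel_measurable borel" by measurable
  have mPB: "(\<lambda>w. emeasure (P_inf t (w s)) A * indicator B w) \<in> borel_measurable (path_sigma s ?E)"
  proof (rule borel_measurable_times_ennreal)
    have "(\<lambda>z. emeasure (P_inf t z) A) \<in> borel_measurable (restrict_space borel ?E)"
      by (rule measurable_compose[OF measurable_P_inf[OF t] measurable_emeasure_subprob_algebra[OF A]])
    then show "(\<lambda>w. emeasure (P_inf t (w s)) A) \<in> borel_measurable (path_sigma s ?E)"
      by (rule measurable_at_time[rotated]) (use s in simp)
  qed (use B in simp)
  have indB: "(indicator B :: _ \<Rightarrow> ennreal) \<in> borel_measurable (path_sigma s ?E)" using B by simp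
  have "emeasure (X_inf y (s + t)) D = (\<integral>\<^sup>+w. ?r (s + t) w * indicator D w \<partial>hat_law S P X y (s + t))"
    unfolding h_transform_law_def
    by (rule emeasure_density) (use mr[OF st(1)] D in \<open>simp_all add: measurable_cong_sets[OF sets_hat_law refl]\<close>)
  also have "\<dots> = (\<integral>\<^sup>+w. on_path S ?u (s + t) (\<lambda>w. ?r (s + t) w * indicator D w) w \<partial>Q ?j)"
    by (rule nn_integral_hat_law[OF y st(1)]) (intro borel_measurable_times_ennreal mr[OF st(1)] borel_measurable_indicator D)
  \<comment> \<open>The event D separates into an event of the path up to s and a condition on the
    endpoint. Discarded paths are absent almost surely at both horizons, so survival to s + t is the
    only remaining condition.\<close>
  also have "\<dots> = (\<integral>\<^sup>+w. on_path S ?u s (indicator B) w * (if alive ?u w (s + t) then ?f (hat_path ?u w (s + t)) else 0) \<partial>Q ?j)"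
  proof (rule nn_integral_cong_AE, use AE_start[OF j] AE_cadlag_hat[OF j u s] AE_cadlag_hat[OF j u st(1)] in eventually_elim)
    case (elim w)
    show ?case
    proof (cases "alive ?u w (s + t)")
      case True
      then have al: "alive ?u w s" using alive_antimono st by blast
      let ?p = "\<lambda>r. \<lambda>t\<in>{0..r}. hat_path ?u w t"
      have g: "cadlag_hat S ?u w s" "cadlag_hat S ?u w (s + t)" using elim al True by blast+
      have "restrict (?p (s + t)) {0..s} = ?p s" using t by (auto simp: restrict_def)
      then have "?p (s + t) \<in> D \<longleftrightarrow> ?p s \<in> B \<and> hat_path ?u w (s + t) \<in> A"
        using g(2) st unfolding D_def cadlag_hat_def by simp
      then have "indicator D (?p (s + t)) = indicator B (?p s) * (indicator A (hat_path ?u w (s + t)) :: ennreal)"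
        by (simp add: indicator_def)
      moreover have "?r (s + t) (?p (s + t)) = ennreal (h (hat_path ?u w (s + t)) / h y)"
        using st hat_path_0(1)[of y S w, OF y elim(1)] by simp
      ultimately show ?thesis using True al g unfolding on_path_def by (simp add: ac_simps)
    next
      case False then show ?thesis unfolding on_path_def by simp
    qed
  qed
  also have "\<dots> = (\<integral>\<^sup>+w. on_path S ?u s (indicator B) w * (if alive ?u w s then hat_op t ?f (hat_path ?u w s) else 0) \<partial>Q ?j)"
    by (rule hat_markov[OF y s t measurable_on_path[OF u s indB] on_path_stop[OF s] f])
  also have "\<dots> = (\<integral>\<^sup>+w. on_path S ?u s (\<lambda>w. ?r s w * (emeasure (P_inf t (w s)) A * indicator B w)) w \<partial>Q ?j)"
  proof (rule nn_integral_cong_AE, use AE_start[OF j] AE_space in eventually_elim)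
    case (elim w)
    show ?case
    proof (cases "alive ?u w s")
      case True
      let ?z = "hat_path ?u w s"
      have z: "?z \<in> ?E" using hat_path_in[OF _ True s, of S] elim(2) u by simp
      have "hat_op t ?f ?z = hat_op t (\<lambda>x. ennreal (h ?z / h y) * (ennreal (h x / h ?z) * indicator A x)) ?z"
      proof (rule hat_op_cong[OF z t])
        fix x assume x: "x \<in> ?E"
        have "ennreal (h x / h y) = ennreal (h ?z / h y) * ennreal (h x / h ?z)"
          using h_pos[OF z] h_pos[OF y] h_nonneg[OF x] by (simp add: ennreal_mult[symmetric])
        then show "?f x = ennreal (h ?z / h y) * (ennreal (h x / h ?z) * indicator A x)"
          by (simp only: mult.assoc)
      qed
      also have "\<dots> = ennreal (h ?z / h y) * hat_op t (\<lambda>x. ennreal (h x / h ?z) * indicator A x) ?z"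
        by (rule hat_op_cmult[OF z t]) measurable
      also have "hat_op t (\<lambda>x. ennreal (h x / h ?z) * indicator A x) ?z = emeasure (P_inf t ?z) A"
        by (rule emeasure_P_inf[OF z t A, symmetric])
      finally show ?thesis using True s hat_path_0(1)[of y S w, OF y elim(1)] unfolding on_path_def by (simp add: ac_simps)
    next
      case False then show ?thesis unfolding on_path_def by simp
    qed
  qed
  also have "\<dots> = (\<integral>\<^sup>+w. ?r s w * (emeasure (P_inf t (w s)) A * indicator B w) \<partial>hat_law S P X y s)"
    by (rule nn_integral_hat_law[OF y s, symmetric]) (intro borel_measurable_times_ennreal mr[OF s] mPB)
  also have "\<dots> = (\<integral>\<^sup>+w. emeasure (P_inf t (w s)) A * indicator B w \<partial>X_inf y s)"
    unfolding h_transform_law_def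
  proof (rule nn_integral_density[symmetric])
    show "?r s \<in> borel_measurable (hat_law S P X y s)" using mr[OF s] by (simp add: measurable_cong_sets[OF sets_hat_law refl])
    show "(\<lambda>w. emeasure (P_inf t (w s)) A * indicator B w) \<in> borel_measurable (hat_law S P X y s)"
      using mPB by (simp add: measurable_cong_sets[OF sets_hat_law refl])
  qed
  finally show "emeasure (X_inf y (s + t)) {w \<in> space (X_inf y (s + t)). restrict w {0..s} \<in> B \<and> w (s + t) \<in> A} =
      (\<integral>\<^sup>+w\<in>B. emeasure (P_inf t (w s)) A \<partial>X_inf y s)"
    unfolding sL D_def .
qed

section \<open>Conditioning on long survival\<close>

lemma measurable_surv:
  assumes "0 \<le> t"
  shows "(\<lambda>z. surv z t) \<in> borel_measurable (restrict_space borel (hat_space S))"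
proof -
  have "(\<lambda>z. enn2real (hat_op t (\<lambda>_. 1) z)) \<in> borel_measurable (restrict_space borel (hat_space S))"
    by (intro measurable_restrict_space1 borel_measurable_enn2real measurable_hat_op[OF assms]) simp
  then show ?thesis
    by (rule measurable_cong[THEN iffD1, rotated]) (simp add: space_restrict_space hat_op_one surv_nonneg)
qed

text \<open>Given the path up to s, surviving to T is surviving for T - s from the state at s. The
  reference law is thus fixed and T enters through a density alone, which makes dominated
  convergence applicable.\<close>

lemma conditioned_law_eq:
  assumes y: "y \<in> hat_space S" and s: "0 \<le> s" and T: "s \<le> T" and pos: "0 < surv y T"
  shows "conditioned_law S P X y T s = density (hat_law S P X y s) (\<lambda>w. ennreal (surv (w s) (T - s) / surv y T))"
proof (rule measure_eqI)
  note j = hat_spaceD(1)[OF y] and u = hat_spaceD(2)[OF y]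
  let ?j = "chain_state y" and ?u = "snd y" and ?E = "hat_space S"
  let ?O = "{\<omega> \<in> space (P ?j). ereal T < tau X y \<omega>}"
  let ?M = "uniform_measure (P ?j) ?O"
  have T0: "0 \<le> T" "0 \<le> T - s" using s T by auto
  have sc: "sets (conditioned_law S P X y T s) = sets (path_sigma s ?E)"
    unfolding conditioned_law_def alive_law_def by simp
  then show "sets (conditioned_law S P X y T s) = sets (density (hat_law S P X y s) (\<lambda>w. ennreal (surv (w s) (T - s) / surv y T)))"
    by simp
  fix A assume "A \<in> sets (conditioned_law S P X y T s)"
  then have A: "A \<in> sets (path_sigma s ?E)" unfolding sc .
  interpret Pj: prob_space "P ?j" by (rule prob_space_P[OF j])
  have O: "?O = {\<omega> \<in> space (P ?j). alive ?u (\<lambda>t\<in>{0..}. X t \<omega>) T}" using tau_gt_alive[OF j _ T0(1)] by blast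
  have mO: "?O \<in> sets (P ?j)"
    using measurable_compose[OF measurable_path[OF j] pred_alive[OF u]] unfolding O by (simp add: pred_def)
  have eO: "emeasure (P ?j) ?O = ennreal (surv y T)"
    unfolding O Pj.emeasure_eq_measure surv_def Q_Collect[OF j sets_Collect_path[OF pred_alive[OF u]]] ..
  have indA: "(indicator A :: _ \<Rightarrow> ennreal) \<in> borel_measurable (path_sigma s ?E)" using A by simp
  let ?g = "on_path S ?u s (indicator A)"
  have g: "?g \<in> borel_measurable (path_space S)" by (rule measurable_on_path[OF u s indA])
  have gal: "(\<lambda>w. ?g w * (if alive ?u w T then 1 else 0)) \<in> borel_measurable (path_space S)"
    using measurable_alive_integrand[OF u T0(1), of "\<lambda>_. 1"] by (intro borel_measurable_times_ennreal g) simp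
  have msv: "(\<lambda>w. surv (w s) (T - s)) \<in> borel_measurable (path_sigma s ?E)"
    by (rule measurable_at_time[OF _ measurable_surv[OF T0(2)]]) (use s in simp)
  have ms: "(\<lambda>w. ennreal (surv (w s) (T - s) / surv y T)) \<in> borel_measurable (path_sigma s ?E)"
    by (intro measurable_ennreal[THEN measurable_compose[rotated]] borel_measurable_divide msv borel_measurable_const)
  have msA: "(\<lambda>w. ennreal (surv (w s) (T - s)) * indicator A w) \<in> borel_measurable (path_sigma s ?E)"
  proof (rule borel_measurable_times_ennreal[OF _ indA])
    show "(\<lambda>w. ennreal (surv (w s) (T - s))) \<in> borel_measurable (path_sigma s ?E)" using msv by measurable
  qed
  have "emeasure (conditioned_law S P X y T s) A = (\<integral>\<^sup>+w. indicator A w \<partial>conditioned_law S P X y T s)"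
    using A sc by simp
  also have "\<dots> = (\<integral>\<^sup>+\<omega>. ?g (\<lambda>t\<in>{0..}. X t \<omega>) \<partial>?M)"
    unfolding conditioned_law_def by (rule nn_integral_alive_law[OF y s _ indA]) simp
  also have "\<dots> = (\<integral>\<^sup>+\<omega>. ?g (\<lambda>t\<in>{0..}. X t \<omega>) * indicator ?O \<omega> \<partial>P ?j) / emeasure (P ?j) ?O"
    using measurable_compose[OF measurable_path[OF j] g] mO by (intro nn_integral_uniform_measure) auto
  also have "(\<integral>\<^sup>+\<omega>. ?g (\<lambda>t\<in>{0..}. X t \<omega>) * indicator ?O \<omega> \<partial>P ?j) =
      (\<integral>\<^sup>+\<omega>. (\<lambda>w. ?g w * (if alive ?u w T then 1 else 0)) (\<lambda>t\<in>{0..}. X t \<omega>) \<partial>P ?j)"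
    unfolding O by (intro nn_integral_cong) (simp add: indicator_def)
  also have "\<dots> = (\<integral>\<^sup>+w. ?g w * (if alive ?u w (s + (T - s)) then (\<lambda>_. 1) (hat_path ?u w (s + (T - s))) else 0) \<partial>Q ?j)"
    using nn_integral_Q[OF j gal] by simp
  also have "\<dots> = (\<integral>\<^sup>+w. ?g w * (if alive ?u w s then hat_op (T - s) (\<lambda>_. 1) (hat_path ?u w s) else 0) \<partial>Q ?j)"
    by (rule hat_markov[OF y s T0(2) g on_path_stop[OF s]]) simp
  also have "\<dots> = (\<integral>\<^sup>+w. on_path S ?u s (\<lambda>w. ennreal (surv (w s) (T - s)) * indicator A w) w \<partial>Q ?j)"
  proof (rule nn_integral_cong)
    fix w assume "w \<in> space (Q ?j)"
    then have w: "w \<in> paths S" by simp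
    show "?g w * (if alive ?u w s then hat_op (T - s) (\<lambda>_. 1) (hat_path ?u w s) else 0) =
      on_path S ?u s (\<lambda>w. ennreal (surv (w s) (T - s)) * indicator A w) w"
      using hat_path_in[OF w _ s, of ?u] u s by (simp add: on_path_def hat_op_one mult.commute)
  qed
  also have "\<dots> = (\<integral>\<^sup>+w. ennreal (surv (w s) (T - s)) * indicator A w \<partial>hat_law S P X y s)"
    by (rule nn_integral_hat_law[OF y s msA, symmetric])
  also have "\<dots> / emeasure (P ?j) ?O = (\<integral>\<^sup>+w. ennreal (surv (w s) (T - s) / surv y T) * indicator A w \<partial>hat_law S P X y s)"
  proof -
    from msA have "(\<integral>\<^sup>+w. ennreal (surv (w s) (T - s)) * indicator A w / ennreal (surv y T) \<partial>hat_law S P X y s) =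
      (\<integral>\<^sup>+w. ennreal (surv (w s) (T - s)) * indicator A w \<partial>hat_law S P X y s) / ennreal (surv y T)"
      by (intro nn_integral_divide) (simp add: measurable_cong_sets[OF sets_hat_law refl])
    moreover have "ennreal (surv (w s) (T - s)) * indicator A w / ennreal (surv y T) = ennreal (surv (w s) (T - s) / surv y T) * indicator A w" for w
      using pos by (simp add: indicator_def divide_ennreal surv_nonneg)
    ultimately show ?thesis unfolding eO by simp
  qed
  also have "\<dots> = emeasure (density (hat_law S P X y s) (\<lambda>w. ennreal (surv (w s) (T - s) / surv y T))) A"
    by (rule emeasure_density[symmetric]) (use ms A in \<open>simp_all add: measurable_cong_sets[OF sets_hat_law refl]\<close>)
  finally show "emeasure (conditioned_law S P X y T s) A = \<dots>" .
qed

lemma finite_hat_law: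
  assumes y: "y \<in> hat_space S" and s: "0 \<le> s"
  shows "finite_measure (hat_law S P X y s)"
proof (rule finite_measureI)
  interpret Qj: prob_space "Q (chain_state y)" by (rule prob_space_Q)
  have "emeasure (hat_law S P X y s) (space (hat_law S P X y s)) = (\<integral>\<^sup>+w. 1 \<partial>hat_law S P X y s)" by simp
  also have "\<dots> = (\<integral>\<^sup>+w. on_path S (snd y) s (\<lambda>_. 1) w \<partial>Q (chain_state y))"
    by (rule nn_integral_hat_law[OF y s]) simp
  also have "\<dots> \<le> (\<integral>\<^sup>+w. 1 \<partial>Q (chain_state y))" by (intro nn_integral_mono) (simp add: on_path_def)
  also have "\<dots> < \<infinity>" using Qj.emeasure_space_1 by simp
  finally show "emeasure (hat_law S P X y s) (space (hat_law S P X y s)) \<noteq> \<infinity>" by simp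
qed

lemma surv_ratio_limit:
  assumes y: "y \<in> hat_space S" and z: "z \<in> hat_space S" and s: "0 \<le> s"
  shows "((\<lambda>T. surv z (T - s) / surv y T) \<longlongrightarrow> h z / h y) at_top"
proof -
  have "((\<lambda>T. (surv z (T - s) / F T) / (surv y T / F T)) \<longlongrightarrow> h z / h y) at_top"
    by (intro tendsto_divide surv_shift_limit[OF z s] surv_limit[OF y]) (use h_pos[OF y] in simp)
  moreover have "(surv z (T - s) / F T) / (surv y T / F T) = surv z (T - s) / surv y T" for T
    using F_pos[of T] by (simp add: less_imp_neq[symmetric])
  ultimately show ?thesis by (simp only:)
qed

text \<open>\<open>f\<close> need not be assumed measurable: otherwise all Bochner integrals in question are \<open>0\<close>.\<close>

lemma vaguely_converges_X_inf:
  assumes y: "y \<in> hat_space S" and s: "0 < s"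
  shows "vaguely_converges S s (\<lambda>T. conditioned_law S P X y T s) (X_inf y s)"
  unfolding vaguely_converges_def
proof (intro allI impI)
  fix f :: "(real \<Rightarrow> hat) \<Rightarrow> real"
  let ?E = "hat_space S" and ?N = "hat_law S P X y s"
  assume bf: "bounded (f ` skorokhod s ?E)"
    and ex: "\<exists>K. finite K \<and> K \<subseteq> S - {0} \<and> (\<forall>w\<in>skorokhod s ?E.
                (\<exists>r\<in>{0..s}. w r \<notin> excursion ` K \<union> holding ` {0..<1}) \<longrightarrow> f w = 0)"
  have s0: "0 \<le> s" using s by simp
  have sc: "sets (conditioned_law S P X y T s) = sets (path_sigma s ?E)" for T
    unfolding conditioned_law_def alive_law_def by simp
  have sX: "sets (X_inf y s) = sets (path_sigma s ?E)" unfolding h_transform_law_def by simp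
  show "((\<lambda>T. \<integral>w. f w \<partial>conditioned_law S P X y T s) \<longlongrightarrow> (\<integral>w. f w \<partial>X_inf y s)) at_top"
  proof (cases "f \<in> borel_measurable (path_sigma s ?E)")
    case False
    then have "\<not> integrable (conditioned_law S P X y T s) f" "\<not> integrable (X_inf y s) f" for T
      using borel_measurable_integrable[of _ f] measurable_cong_sets[OF sc refl] measurable_cong_sets[OF sX refl] by blast+
    then show ?thesis by (simp add: not_integrable_integral_eq)
  next
    case f: True
    have fN: "f \<in> borel_measurable ?N" using f by (simp add: measurable_cong_sets[OF sets_hat_law refl])
    obtain b where b: "\<And>w. w \<in> skorokhod s ?E \<Longrightarrow> \<bar>f w\<bar> \<le> b" using bf unfolding bounded_iff by auto
    from ex obtain K where K01: "finite K \<and> K \<subseteq> S - {0}" and K2: "\<forall>w\<in>skorokhod s ?E.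
        (\<exists>r\<in>{0..s}. w r \<notin> excursion ` K \<union> holding ` {0..<1}) \<longrightarrow> f w = 0"
      by (elim exE conjE) simp
    have K3: "f w = 0" if "w \<in> skorokhod s ?E" "r \<in> {0..s}" "w r \<notin> excursion ` K \<union> holding ` {0..<1}" for w r
      by (rule K2[rule_format, OF that(1)], rule bexI[of _ r]) (fact that)+
    note K = conjunct1[OF K01] conjunct2[OF K01] K3
    interpret N: finite_measure ?N by (rule finite_hat_law[OF y s0])
    have wE: "w t \<in> ?E" if "w \<in> skorokhod s ?E" "t \<in> {0..s}" for w t using skorokhod_in[OF that] .
    have mh: "(\<lambda>w. h (w s) / h (w 0)) \<in> borel_measurable ?N"
      using measurable_h_ratio[OF s0] by (simp add: measurable_cong_sets[OF sets_hat_law refl])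
    have ms: "(\<lambda>w. surv (w s) (T - s) / surv y T) \<in> borel_measurable ?N" if "s \<le> T" for T
    proof -
      have "(\<lambda>w. surv (w s) (T - s)) \<in> borel_measurable (path_sigma s ?E)"
        by (rule measurable_at_time[OF _ measurable_surv]) (use s0 that in auto)
      then show ?thesis by (simp add: measurable_cong_sets[OF sets_hat_law refl])
    qed
    have rhs: "(\<integral>w. f w \<partial>X_inf y s) = (\<integral>w. h (w s) / h (w 0) * f w \<partial>?N)"
      unfolding h_transform_law_def
    proof (subst integral_density[OF fN mh])
      have "0 \<le> h (w s) / h (w 0)" if "w \<in> skorokhod s ?E" for w
        using s0 by (intro divide_nonneg_nonneg h_nonneg wE[OF that]) auto
      then show "AE w in ?N. 0 \<le> h (w s) / h (w 0)" by (intro AE_I2) simp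
    qed simp
    have lim0: "((\<lambda>T. surv y T / F T) \<longlongrightarrow> h y) at_top" by (rule surv_limit[OF y])
    have ev1: "\<forall>\<^sub>F T in at_top. h y / 2 < surv y T / F T"
      using order_tendstoD(1)[OF lim0, of "h y / 2"] h_pos[OF y] by simp
    have ev2: "\<forall>\<^sub>F T in at_top. F (T - s) / F T < 2"
      using order_tendstoD(2)[OF F_long_tailed[OF s0], of 2] by simp
    \<comment> \<open>The finiteness of \<open>K\<close> is used here: the limit 1 is known for each
      state of C separately. States outside of \<open>K\<close> do not matter, since f vanishes on
      paths that visit them.\<close>
    have ev3: "\<forall>\<^sub>F T in at_top. \<forall>k\<in>K. surv (excursion k) (T - s) / F T < 2"
    proof (rule eventually_ball_finite[OF K(1)], rule ballI)
      fix k assume k: "k \<in> K"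
      then have "excursion k \<in> ?E" "k \<noteq> 0" using K(2) unfolding hat_space_def by auto
      then show "\<forall>\<^sub>F T in at_top. surv (excursion k) (T - s) / F T < 2"
        using order_tendstoD(2)[OF surv_shift_limit[OF _ s0], of "excursion k" 2] by (simp add: h_excursion)
    qed
    have lhs: "\<forall>\<^sub>F T in at_top. (\<integral>w. surv (w s) (T - s) / surv y T * f w \<partial>?N) = (\<integral>w. f w \<partial>conditioned_law S P X y T s)"
      using ev1 eventually_ge_at_top[of s]
    proof eventually_elim
      case (elim T)
      have "0 < surv y T / F T" using elim(1) h_pos[OF y] by linarith
      then have pos: "0 < surv y T" using F_pos[of T] by (simp add: zero_less_divide_iff)
      show ?case unfolding conditioned_law_eq[OF y s0 elim(2) pos]
        by (subst integral_density[OF fN ms[OF elim(2)]]) (auto intro!: AE_I2 divide_nonneg_nonneg surv_nonneg)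
    qed
    \<comment> \<open>The constant 4 / h y is 2 divided by h y / 2: the numerator is at most 2
      \<open>F T\<close> by \<open>ev2\<close> in holding states and by \<open>ev3\<close> in states
      of \<open>K\<close>, and the denominator at least (h y / 2) \<open>F T\<close> by
      \<open>ev1\<close>. The indicator sets the integrand to 0 for T < s, because the convergence
      rule asks for measurability at every T and T - s is negative there.\<close>
    have tail: "\<forall>\<^sub>F T in at_top. AE w in ?N. norm (indicator {s..} T * (surv (w s) (T - s) / surv y T * f w)) \<le> 4 / h y * b"
      using ev1 ev2 ev3
    proof eventually_elim
      case (elim T)
      show ?case
      proof (rule AE_I2)
        fix w assume "w \<in> space ?N"
        then have w: "w \<in> skorokhod s ?E" by simp
        have b0: "0 \<le> b" using b[OF w] by linarith
        show "norm (indicator {s..} T * (surv (w s) (T - s) / surv y T * f w)) \<le> 4 / h y * b"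
        proof (cases "f w = 0")
          case True then show ?thesis using b0 h_pos[OF y] by simp
        next
          case False
          then have "w s \<in> excursion ` K \<union> holding ` {0..<1}" using K(3)[OF w, of s] s0 by auto
          then have up: "surv (w s) (T - s) / F T \<le> 2"
          proof
            assume "w s \<in> excursion ` K" then show ?thesis using elim(3) by auto
          next
            assume "w s \<in> holding ` {0..<1}"
            then obtain v where v: "v \<in> {0..<1}" "w s = holding v" by blast
            have "surv (w s) (T - s) / F T \<le> F (T - s) / F T"
              unfolding v(2) by (intro divide_right_mono surv_holding_le[OF v(1)] surv_nonneg)
            then show ?thesis using elim(2) by linarith
          qed
          have "surv (w s) (T - s) / surv y T = (surv (w s) (T - s) / F T) / (surv y T / F T)"
            using F_pos[of T] by (simp add: less_imp_neq[symmetric])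
          also have "\<dots> \<le> 2 / (h y / 2)"
            by (rule frac_le) (use up elim(1) h_pos[OF y] in auto)
          finally have "surv (w s) (T - s) / surv y T \<le> 4 / h y" by simp
          then have "surv (w s) (T - s) / surv y T * \<bar>f w\<bar> \<le> 4 / h y * b"
            using b[OF w] h_pos[OF y] by (intro mult_mono) (auto intro: divide_nonneg_nonneg)
          then show ?thesis using b0 h_pos[OF y] by (simp add: abs_mult surv_nonneg indicator_def)
        qed
      qed
    qed
    have lim: "((\<lambda>T. \<integral>w. indicator {s..} T * (surv (w s) (T - s) / surv y T * f w) \<partial>?N) \<longlongrightarrow>
        (\<integral>w. h (w s) / h (w 0) * f w \<partial>?N)) at_top"
    proof (rule integral_dominated_convergence_at_top[OF _ _ _ _ tail])
      show "integrable ?N (\<lambda>w. 4 / h y * b)" by simp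
      show "(\<lambda>w. h (w s) / h (w 0) * f w) \<in> borel_measurable ?N" using mh fN by measurable
      show "(\<lambda>w. indicator {s..} T * (surv (w s) (T - s) / surv y T * f w)) \<in> borel_measurable ?N" for T
      proof (cases "s \<le> T")
        case True
        show ?thesis using ms[OF True] fN by measurable
      next
        case False
        then have "indicator {s..} T = (0::real)" by simp
        then show ?thesis by (simp only: mult_zero_left borel_measurable_const)
      qed
      show "AE w in ?N. ((\<lambda>T. indicator {s..} T * (surv (w s) (T - s) / surv y T * f w)) \<longlongrightarrow> h (w s) / h (w 0) * f w) at_top"
        using AE_hat_law_start[OF y s0] AE_space
      proof eventually_elim
        case (elim w)
        then have "w s \<in> ?E" using wE s0 by simp
        from tendsto_mult_right[OF surv_ratio_limit[OF y this s0], of "f w"]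
        have "((\<lambda>T. surv (w s) (T - s) / surv y T * f w) \<longlongrightarrow> h (w s) / h (w 0) * f w) at_top" unfolding elim(1) .
        moreover have "\<forall>\<^sub>F T in at_top. surv (w s) (T - s) / surv y T * f w = indicator {s..} T * (surv (w s) (T - s) / surv y T * f w)"
          using eventually_ge_at_top[of s] by eventually_elim simp
        ultimately show ?case by (rule Lim_transform_eventually)
      qed
    qed
    have "\<forall>\<^sub>F T in at_top. (\<integral>w. indicator {s..} T * (surv (w s) (T - s) / surv y T * f w) \<partial>?N) = (\<integral>w. f w \<partial>conditioned_law S P X y T s)"
      using lhs eventually_ge_at_top[of s]
    proof eventually_elim
      case (elim T)
      have "indicator {s..} T = (1::real)" using elim(2) by simp
      then show ?case using elim(1) by (simp only: mult_1_left)
    qed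
    from Lim_transform_eventually[OF lim this] show ?thesis unfolding rhs .
  qed
qed

section \<open>The death rate in a holding state\<close>

lemma h_holding_bounds:
  assumes "0 \<le> a" "a \<le> t" "t \<le> 1"
  shows "h (holding t) \<le> h (holding a)" "h (holding a) \<le> 1"
proof -
  have c: "0 < 1 - exp (q 0 0)" using q00_neg by simp
  have "exp (q 0 0 * (1 - a)) \<le> exp (q 0 0 * (1 - t))" using assms q00_neg by (simp add: mult_left_mono_neg)
  then show "h (holding t) \<le> h (holding a)" unfolding h_holding using c by (intro divide_right_mono) auto
  have "q 0 0 \<le> q 0 0 * (1 - a)" using assms q00_neg mult_left_mono_neg[of "1 - a" 1 "q 0 0"] by simp
  then show "h (holding a) \<le> 1" unfolding h_holding using c by simp
qed

text \<open>No death is possible within a time t < 1 - u. With probability p the chain has not left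
  0 and its state is (0, u + t). Otherwise it is in C or has an age of at most t, so
  \<open>h\<close> lies between \<open>h (holding t)\<close> and 1. These two values differ by O(t)
  and are weighted by 1 - p, which is also O(t), so both bounds have the same derivative at
  0.\<close>

lemma hat_op_h_holding:
  assumes u: "u \<in> {0..<1}" and t: "0 < t" "t < 1 - u"
  defines "p \<equiv> exp (q 0 0 * t)"
  shows "ennreal (h (holding (u + t)) * p + h (holding t) * (1 - p)) \<le> hat_op t (\<lambda>z. ennreal (h z)) (holding u)"
    and "hat_op t (\<lambda>z. ennreal (h z)) (holding u) \<le> ennreal (h (holding (u + t)) * p + 1 * (1 - p))"
proof -
  interpret Q0: prob_space "Q 0" by (rule prob_space_Q)
  have t0: "0 \<le> t" using t by simp
  have y: "holding u \<in> hat_space S" using u unfolding hat_space_def by auto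
  have p: "0 \<le> 1 - p" "0 \<le> p" unfolding p_def using q00_neg t by (auto simp: mult_le_0_iff)
  have mA: "{w \<in> paths S. stay t w} \<in> sets (path_space S)" by (rule sets_Collect_path[OF pred_stay[OF t0]])
  have n: "{w \<in> paths S. \<not> stay t w} = space (path_space S) - {w \<in> paths S. stay t w}" by auto
  have mB: "{w \<in> paths S. \<not> stay t w} \<in> sets (path_space S)" unfolding n by (rule sets.Diff[OF sets.top mA])
  have eA: "emeasure (Q 0) {w \<in> paths S. stay t w} = ennreal p"
    unfolding Q0.emeasure_eq_measure stay_prob[OF t0] p_def ..
  have eB: "emeasure (Q 0) {w \<in> paths S. \<not> stay t w} = ennreal (1 - p)"
    unfolding Q0.emeasure_eq_measure n p_def using mA stay_prob[OF t0] Q0.prob_compl[of "{w \<in> paths S. stay t w}"] by simp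
  have I: "(\<integral>\<^sup>+w. ennreal a * indicator {w \<in> paths S. stay t w} w + ennreal b * indicator {w \<in> paths S. \<not> stay t w} w \<partial>Q 0) = ennreal (a * p + b * (1 - p))"
    if "0 \<le> a" "0 \<le> b" for a b
    using mA mB eA eB that p by (simp add: nn_integral_add nn_integral_cmult_indicator ennreal_mult ennreal_plus)
  have h0: "0 \<le> h (holding (u + t))" "0 \<le> h (holding t)"
    using h_nonneg[of "holding (u + t)"] h_nonneg[of "holding t"] u t unfolding hat_space_def by auto
  have K: "hat_op t (\<lambda>z. ennreal (h z)) (holding u) = (\<integral>\<^sup>+w. ennreal (h (hat_path u w t)) \<partial>Q 0)"
    unfolding hat_op_alive[OF y] using alive_short[OF t0, of u] u t
    by (intro nn_integral_cong_simp arg_cong2[of _ _ _ _ nn_integral]) (auto simp: discrete_inverse)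
  have st: "h (hat_path u w t) = h (holding (u + t))" if "stay t w" for w
    using that age_stay[OF t0 that, of u] t0 by (simp add: hat_path_eq stay_def)
  have nst: "h (holding t) \<le> h (hat_path u w t)" "h (hat_path u w t) \<le> 1" if "\<not> stay t w" for w
  proof -
    have a: "age u w t = age 0 w t" using age_cases[OF t0, of u w] that by simp
    have "h (holding t) \<le> h (hat_path u w t) \<and> h (hat_path u w t) \<le> 1"
    proof (cases "w t = 0")
      case True
      then show ?thesis using h_holding_bounds[of "age 0 w t" t] age0_le[OF t0, of w] age_nonneg[OF order_refl t0, of w] t u
        by (simp add: hat_path_eq a)
    next
      case False
      then show ?thesis using h_excursion[OF False] h_holding_bounds(2)[of t t] t u by (simp add: hat_path_eq age_eq)
    qed
    then show "h (holding t) \<le> h (hat_path u w t)" "h (hat_path u w t) \<le> 1" by auto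
  qed
  have "ennreal (h (holding (u + t)) * p + h (holding t) * (1 - p)) =
    (\<integral>\<^sup>+w. ennreal (h (holding (u + t))) * indicator {w \<in> paths S. stay t w} w + ennreal (h (holding t)) * indicator {w \<in> paths S. \<not> stay t w} w \<partial>Q 0)"
    by (rule I[symmetric, OF h0])
  also have "\<dots> \<le> (\<integral>\<^sup>+w. ennreal (h (hat_path u w t)) \<partial>Q 0)"
    by (intro nn_integral_mono) (auto simp: indicator_def st nst ennreal_leI)
  finally show "ennreal (h (holding (u + t)) * p + h (holding t) * (1 - p)) \<le> hat_op t (\<lambda>z. ennreal (h z)) (holding u)"
    unfolding K .
  have "(\<integral>\<^sup>+w. ennreal (h (hat_path u w t)) \<partial>Q 0) \<le>
    (\<integral>\<^sup>+w. ennreal (h (holding (u + t))) * indicator {w \<in> paths S. stay t w} w + ennreal 1 * indicator {w \<in> paths S. \<not> stay t w} w \<partial>Q 0)"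
    by (intro nn_integral_mono) (use nst(2) in \<open>auto simp: indicator_def st intro!: ennreal_leI[of _ 1, simplified]\<close>)
  also have "\<dots> = ennreal (h (holding (u + t)) * p + 1 * (1 - p))" by (rule I[OF h0(1)]) simp
  finally show "hat_op t (\<lambda>z. ennreal (h z)) (holding u) \<le> ennreal (h (holding (u + t)) * p + 1 * (1 - p))"
    unfolding K .
qed

text \<open>The two bounds for the surviving mass have this shape, with k t = 1 and with k t =
  \<open>h (holding t)\<close>. As k 0 = 1 and 1 - exp(c t) vanishes at 0, the derivative does not
  involve k'. The rate is -(H'(u) + c H(u) - c) / H(u), and inserting H gives the stated hazard rate
  with c = -q0.\<close>

lemma death_rate_limit:
  fixes c u :: real and k :: "real \<Rightarrow> real"
  assumes c: "c < 0" and u: "0 \<le> u" "u < 1" and k: "(k has_real_derivative k') (at 0)" "k 0 = 1"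
  defines "H \<equiv> \<lambda>v. (1 - exp (c * (1 - v))) / (1 - exp c)"
  shows "((\<lambda>t. (1 - (H (u + t) * exp (c * t) + k t * (1 - exp (c * t))) / H u) / t) \<longlongrightarrow>
     (- c * exp c / (1 - exp (c * (1 - u))))) (at_right 0)"
proof -
  let ?f = "\<lambda>t. 1 - (H (u + t) * exp (c * t) + k t * (1 - exp (c * t))) / H u"
  have B: "1 - exp c \<noteq> 0" using c by simp
  have "c * (1 - u) < 0" using c u by (simp add: mult_less_0_iff)
  then have "exp (c * (1 - u)) < 1" by (simp only: exp_less_one_iff)
  then have A: "1 - exp (c * (1 - u)) \<noteq> 0" by linarith
  have Hu: "H u \<noteq> 0" unfolding H_def using A B by simp
  have dH: "((\<lambda>t. H (u + t)) has_real_derivative c * exp (c * (1 - u)) / (1 - exp c)) (at 0)"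
    unfolding H_def using c by (auto intro!: derivative_eq_intros simp: B)
  have "(?f has_real_derivative - ((c * exp (c * (1 - u)) / (1 - exp c) + H u * c) - c) / H u) (at 0)"
    by (rule derivative_eq_intros dH k(1) refl | simp add: Hu k(2) minus_divide_left mult.commute)+
  moreover have "- ((c * exp (c * (1 - u)) / (1 - exp c) + H u * c) - c) / H u = - c * exp c / (1 - exp (c * (1 - u)))"
  proof -
    have "- ((c * (1 - a) / b + a / b * c) - c) / (a / b) = - c * (1 - b) / a" if "a \<noteq> 0" "b \<noteq> 0" for a b
      using that by (simp add: field_simps)
    from this[OF A B] show ?thesis unfolding H_def by simp
  qed
  ultimately have "(?f has_real_derivative - c * exp c / (1 - exp (c * (1 - u)))) (at 0)" by simp
  then have "((\<lambda>t. (?f t - ?f 0) / (t - 0)) \<longlongrightarrow> - c * exp c / (1 - exp (c * (1 - u)))) (at 0)"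
    unfolding has_field_derivative_iff .
  moreover have "?f 0 = 0" using Hu by simp
  ultimately have "((\<lambda>t. ?f t / t) \<longlongrightarrow> - c * exp c / (1 - exp (c * (1 - u)))) (at 0)" by simp
  then show ?thesis by (rule filterlim_at_split[THEN iffD1, THEN conjunct2])
qed

lemma dies_at_rate_P_inf:
  assumes u: "u \<in> {0..<1}"
  shows "dies_at_rate P_inf (holding u) (- q 0 0 * exp (q 0 0) / (1 - exp (q 0 0 * (1 - u))))"
  unfolding dies_at_rate_def
proof -
  let ?c = "q 0 0" and ?y = "holding u"
  have y: "?y \<in> hat_space S" using u unfolding hat_space_def by auto
  have u': "0 \<le> u" "u < 1" using u by auto
  have hy: "0 < h ?y" by (rule h_pos[OF y])
  let ?p = "\<lambda>t. exp (?c * t)"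
  let ?lo = "\<lambda>t. (1 - (h (holding (u + t)) * ?p t + 1 * (1 - ?p t)) / h ?y) / t"
  let ?up = "\<lambda>t. (1 - (h (holding (u + t)) * ?p t + h (holding t) * (1 - ?p t)) / h ?y) / t"
  have lo: "(?lo \<longlongrightarrow> (- ?c * exp ?c / (1 - exp (?c * (1 - u))))) (at_right 0)"
    using death_rate_limit[OF q00_neg u', of "\<lambda>_. 1" 0] unfolding h_holding by simp
  have up: "(?up \<longlongrightarrow> (- ?c * exp ?c / (1 - exp (?c * (1 - u))))) (at_right 0)"
  proof -
    have "1 - exp ?c \<noteq> 0" using q00_neg by simp
    then have "((\<lambda>t. (1 - exp (?c * (1 - t))) / (1 - exp ?c)) has_real_derivative ?c * exp ?c / (1 - exp ?c)) (at 0)"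
      by (auto intro!: derivative_eq_intros)
    from death_rate_limit[OF q00_neg u' this] show ?thesis unfolding h_holding using q00_neg by simp
  qed
  have ev: "\<forall>\<^sub>F t in at_right 0. 0 < t \<and> t < 1 - u"
    unfolding eventually_at_right_field using u by (intro exI[of _ "1 - u"]) auto
  have bounds: "?lo t \<le> (1 - measure (P_inf t ?y) (space (P_inf t ?y))) / t \<and>
      (1 - measure (P_inf t ?y) (space (P_inf t ?y))) / t \<le> ?up t" if t: "0 < t" "t < 1 - u" for t
  proof -
    have t0: "0 \<le> t" using t by simp
    have top: "hat_space S \<in> sets (restrict_space borel (hat_space S))"
      using sets.top[of "restrict_space borel (hat_space S)"] by (simp add: space_restrict_space)
    have "emeasure (P_inf t ?y) (space (P_inf t ?y)) = ennreal (1 / h ?y) * hat_op t (\<lambda>z. ennreal (h z)) ?y"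
      unfolding space_P_inf emeasure_P_inf'[OF y t0 top]
      by (intro arg_cong2[of _ _ _ _ "(*)"] refl hat_op_cong[OF y t0]) simp
    moreover obtain k where k: "hat_op t (\<lambda>z. ennreal (h z)) ?y = ennreal k" "0 \<le> k"
      using hat_op_h_holding(2)[OF u t] by (cases "hat_op t (\<lambda>z. ennreal (h z)) ?y") (auto simp: top_unique)
    ultimately have m: "measure (P_inf t ?y) (space (P_inf t ?y)) = k / h ?y"
      using hy by (simp add: measure_def ennreal_mult[symmetric])
    have hh: "0 \<le> h (holding (u + t))" using h_nonneg[of "holding (u + t)"] u t unfolding hat_space_def by auto
    have "0 \<le> 1 - ?p t" using q00_neg t0 by (simp add: mult_le_0_iff)
    then have nn: "0 \<le> h (holding (u + t)) * ?p t + 1 * (1 - ?p t)" using hh by simp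
    have k1: "h (holding (u + t)) * ?p t + h (holding t) * (1 - ?p t) \<le> k"
      using hat_op_h_holding(1)[OF u t] k by (simp add: ennreal_le_iff)
    have k2: "k \<le> h (holding (u + t)) * ?p t + 1 * (1 - ?p t)"
      using hat_op_h_holding(2)[OF u t] unfolding k(1) by (rule ennreal_le_iff[OF nn, THEN iffD1])
    show ?thesis unfolding m
      by (intro conjI divide_right_mono diff_left_mono t0 less_imp_le[OF hy] k1 k2)
  qed
  show "((\<lambda>t. (1 - measure (P_inf t ?y) (space (P_inf t ?y))) / t) \<longlongrightarrow> - ?c * exp ?c / (1 - exp (?c * (1 - u)))) (at_right 0)"
    by (rule tendsto_sandwich[OF _ _ lo up]; rule eventually_mono[OF ev]) (use bounds in blast)+
qed

end

theorem theorem3p7: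
  fixes S :: "nat set" and q :: "nat \<Rightarrow> nat \<Rightarrow> real"
    and P :: "nat \<Rightarrow> 'w measure" and X :: "real \<Rightarrow> 'w \<Rightarrow> nat" and i :: nat
    and q0 :: real and h :: "hat \<Rightarrow> real"
    and P_inf :: "real \<Rightarrow> hat \<Rightarrow> (hat) measure"
    and X_inf :: "hat \<Rightarrow> real \<Rightarrow> (real \<Rightarrow> hat) measure"
  assumes "markov_chain S q P X"
    and "irreducible_chain S P X"
    and "recurrent_chain S P X"
    and "irreducible_killed S P X"
    and "i \<in> S - {0}"
    and "phi P X = 0" and "0 < muC P X i"
    and "subexponential (tau_distribution P X)"
  defines "q0 \<equiv> - q 0 0"
    and "h \<equiv> h_lim q0"
    and "P_inf \<equiv> h_transform h (hat_kernel S P X)"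
    and "X_inf \<equiv> \<lambda>y. h_transform_law h (hat_law S P X y)"
  shows "(\<forall>y\<in>hat_space S. 0 < h y) \<and>
    superharmonic (hat_space S) (hat_kernel S P X) h \<and>
    substochastic_semigroup (hat_space S) P_inf \<and>
    (\<forall>y\<in>hat_space S. has_semigroup (hat_space S) (X_inf y) P_inf) \<and>
    (\<forall>y\<in>hat_space S. \<forall>s>0.
       vaguely_converges S s (\<lambda>T. conditioned_law S P X y T s) (X_inf y s)) \<and>
    (\<forall>u\<in>{0..<1}. dies_at_rate P_inf (holding u) (q0 * exp (- q0) / (1 - exp (- q0 * (1 - u)))))"
proof -
  interpret subexponential_chain S q P X i
    using assms(1,2,4,5,7,8) by (simp add: subexponential_chain_def subexponential_chain_axioms_def)
  show ?thesis
    unfolding X_inf_def P_inf_def h_def q0_def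
    using h_pos superharmonic_h substochastic_P_inf has_semigroup_X_inf vaguely_converges_X_inf dies_at_rate_P_inf
    by simp
qed

end
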